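(* Let $\mu$ be a positive Radon measure on $\mathbb{R}^d$ with bounded support, let $\alpha\in[0,1]$ and $\varepsilon>0$. Assume that $\mathcal{IP}(\mu)\neq\emptyset$. Then there exists an admissible irrigation plan $\chi\in\mathcal{IP}(\mu)$ that minimizes the mollified cost $\mathcal{E}^\alpha_\varepsilon$ over $\mathcal{IP}(\mu)$.
   Context: Let $\mathbb{R}_+=[0,\infty)$, $M=\mu(\mathbb{R}^d)$, $\Theta=[0,M]$ with Lebesgue measure. An admissible irrigation plan for $\mu$ is a measurable map $\chi:\Theta\times\mathbb{R}_+\to\mathbb{R}^d$ such that: (i) for each $\theta\in\Theta$ the path $t\mapsto\chi(\theta,t)$ is 1-Lipschitz and eventually constant, with stopping time $T(\theta)=\inf\{t>0:\chi(\theta,t')=\chi(\theta,t)\ \text{for all } t'\ge t\}$; (ii) $\chi(\theta,0)=0$ for all $\theta\in\Theta$; (iii) the push-forward of Lebesgue measure on $[0,M]$ under $\theta\mapsto\chi(\theta,T(\theta))$ equals $\mu$. $\mathcal{IP}(\mu)$ denotes the set of all such plans, and $\dot\chi=\partial\chi/\partial t$. Mollified cost: fix a non-increasing Lipschitz function $J:\mathbb{R}_+\to\mathbb{R}_+$ with $J(0)=1$, $\lim_{r\to+\infty}J(r)=0$, and set $J_\varepsilon(r)=J(r/\varepsilon)$, $$W_\varepsilon(x,\chi)=\int_\Theta J_\varepsilon\Big(\min_{t\ge0}|\chi(\theta,t)-x|\Big)d\theta,\qquad \mathcal{E}^\alpha_\varepsilon(\chi)=\int_\Theta\int_{\mathbb{R}_+}\big[W_\varepsilon(\chi(\theta,t),\chi)\big]^{\alpha-1}|\dot\chi(\theta,t)|\,dt\,d\theta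 .$$ Costs take values in $[0,+\infty]$, with the conventions $0^{\alpha-1}=+\infty$ if $\alpha<1$, $0^0=1$, and $0\cdot\infty=0$. *)

theory Defs
  imports "HOL-Analysis.Analysis"
begin

(* On a Euclidean space a Borel measure that is finite on compact sets is automatically
   inner and outer regular, so no regularity clause is needed. *)
definition radon_measure :: "'a::euclidean_space measure \<Rightarrow> bool" where
  "radon_measure \<mu> \<longleftrightarrow>
     sets \<mu> = sets borel \<and> (\<forall>K. compact K \<longrightarrow> emeasure \<mu> K < \<infinity>)"

definition measure_support :: "'a::euclidean_space measure \<Rightarrow> 'a set" where
  "measure_support \<mu> = {x. \<forall>U. open U \<longrightarrow> x \<in> U \<longrightarrow> emeasure \<mu> U > 0}"

(* The measure of the whole space is real-valued: it is finite for every Radon measure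
   with bounded support. *)
definition fibres :: "'a::euclidean_space measure \<Rightarrow> real set" where
  "fibres \<mu> = {0..measure \<mu> UNIV}"

definition stopping_time :: "(real \<Rightarrow> real \<Rightarrow> 'a::euclidean_space) \<Rightarrow> real \<Rightarrow> real" where
  "stopping_time \<gamma> \<theta> = Inf {t. t > 0 \<and> (\<forall>t'\<ge>t. \<gamma> \<theta> t' = \<gamma> \<theta> t)}"

(* Plans are called \<gamma> because \<chi> is the vector binder of HOL-Analysis. They are total
   functions; their values for \<theta> outside the fibre interval or for t < 0
   play no role. Joint measurability is with respect to the product of the Lebesgue
   sigma-algebras; since the paths are continuous in t, this is the same as measurability
   with respect to its completion. *)
definition irrigation_plans ::
  "'a::euclidean_space measure \<Rightarrow> (real \<Rightarrow> real \<Rightarrow> 'a) set" where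
  "irrigation_plans \<mu> = {\<gamma>.
     (\<lambda>(\<theta>, t). \<gamma> \<theta> t) \<in>
       borel_measurable (lebesgue_on (fibres \<mu>) \<Otimes>\<^sub>M lebesgue_on {0..}) \<and>
     (\<forall>\<theta>\<in>fibres \<mu>.
        1-lipschitz_on {0..} (\<gamma> \<theta>) \<and>
        (\<exists>t\<ge>0. \<forall>t'\<ge>t. \<gamma> \<theta> t' = \<gamma> \<theta> t)) \<and>
     (\<forall>\<theta>\<in>fibres \<mu>. \<gamma> \<theta> 0 = 0) \<and>
     distr (lebesgue_on (fibres \<mu>)) borel (\<lambda>\<theta>. \<gamma> \<theta> (stopping_time \<gamma> \<theta>)) = \<mu>}"

definition mollifier :: "(real \<Rightarrow> real) \<Rightarrow> bool" where
  "mollifier J \<longleftrightarrow>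
     (\<forall>r\<ge>0. J r \<ge> 0) \<and> antimono_on {0..} J \<and> (\<exists>L. L-lipschitz_on {0..} J) \<and>
     J 0 = 1 \<and> (J \<longlongrightarrow> 0) at_top"

(* The infimum over t is attained for an admissible plan, because each path is continuous
   and eventually constant. The integrand is bounded and measurable for such a plan. *)
definition mollified_multiplicity ::
  "(real \<Rightarrow> real) \<Rightarrow> real \<Rightarrow> 'a::euclidean_space measure \<Rightarrow>
     (real \<Rightarrow> real \<Rightarrow> 'a) \<Rightarrow> 'a \<Rightarrow> real" where
  "mollified_multiplicity J \<epsilon> \<mu> \<gamma> x =
     (LINT \<theta>|lebesgue_on (fibres \<mu>). J ((INF t\<in>{0..}. norm (\<gamma> \<theta> t - x)) / \<epsilon>))"

(* powr alone does not suffice, since 0 powr a = 0 for every a. *)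
definition ext_powr :: "real \<Rightarrow> real \<Rightarrow> ennreal" where
  "ext_powr w a =
     (if w = 0 then (if a < 0 then \<infinity> else if a = 0 then 1 else 0)
      else ennreal (w powr a))"

(* The derivative exists for almost every t by Rademacher's theorem; the unspecified
   value of vector_derivative on the exceptional null set does not affect the integral.
   Multiplication on ennreal satisfies 0 * \<infinity> = 0. *)
definition mollified_cost ::
  "(real \<Rightarrow> real) \<Rightarrow> real \<Rightarrow> real \<Rightarrow> 'a::euclidean_space measure \<Rightarrow>
     (real \<Rightarrow> real \<Rightarrow> 'a) \<Rightarrow> ennreal" where
  "mollified_cost J \<alpha> \<epsilon> \<mu> \<gamma> =
     (\<integral>\<^sup>+\<theta>. (\<integral>\<^sup>+t.
          ext_powr (mollified_multiplicity J \<epsilon> \<mu> \<gamma> (\<gamma> \<theta> t)) (\<alpha> - 1) *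
          ennreal (norm (vector_derivative (\<gamma> \<theta>) (at t within {0..})))
        \<partial>lebesgue_on {0..}) \<partial>lebesgue_on (fibres \<mu>))"

end

(* A minimizing sequence is parametrized by arc length. Since the multiplicity is at most the total
   mass M, the cost bounds M^(alpha - 1) times the average length, so the stopping times are tight.
   Coding a path and its length by a point of a Cantor set and replacing the random codes by their
   quantile functions, Helly's theorem yields plans with the same laws on the same interval [0, M]
   that converge, along a subsequence, for almost every fibre; tightness makes the convergence of
   almost every path uniform, so the multiplicities converge as well. Lower semicontinuity comes from
   dyadic Riemann sums: they depend on the law only and bound the cost from below, they pass to the
   limit by Fatou's lemma, and they recover the cost of the limit plan because Lipschitz paths are
   differentiable almost everywhere. *)
theory Submission
  imports Defs "HOL-Probability.Helly_Selection"
begin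

text \<open>The cost is not continuous in the plan: speeds need not converge, and for \<alpha> < 1
  the weight W^(\<alpha> - 1) blows up where W vanishes. A sum of weights times increments over a
  fixed dyadic mesh, however, involves finitely many times, and enlarging W by a bound for its
  oscillation along one step makes every term continuous and the sum a lower bound. Arc length
  removes waiting, which costs nothing and would let stopping times escape. The limit must again be
  a plan on [0, M] with end law exactly \<mu>, so no new probability space may be introduced.
  Quantile functions live on an interval but describe a single real variable, hence the coding: the
  values at rational times are bounded, their binary digits become ternary digits 0 and 1, and the
  gaps of the resulting Cantor set make decoding continuous on it. Length is unbounded, so 1 / (1 +
  length) is coded; a limit 0 would mean infinite length, which the bound on the mean length
  excludes by Fatou's lemma. The limit path need not be parametrized by arc length, but its
  multiplicity depends on traces only and the final inequality holds for every Lipschitz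
  path.\<close>

section \<open>Lipschitz functions of a real variable\<close>

text \<open>Adding a linear function of slope L + 1 makes f increasing and bi-Lipschitz. Its
  Stieltjes measure vanishes on null sets, because Lipschitz maps preserve them, and the
  Radon-Nikodym density minus L + 1 is the sought derivative.\<close>

lemma lipschitz_real_indefinite_integral:
  fixes f :: "real \<Rightarrow> real"
  assumes f: "L-lipschitz_on UNIV f"
  obtains h where "h \<in> borel_measurable borel"
    and "\<And>a b. a \<le> b \<Longrightarrow> (h has_integral f b - f a) {a..b}"
proof -
  have L: "0 \<le> L" using f by (rule lipschitz_on_nonneg)
  have fL: "\<bar>f x - f y\<bar> \<le> L * \<bar>x - y\<bar>" for x y
    using lipschitz_onD[OF f, of x y] by (simp add: dist_real_def)
  (* G is bi-Lipschitz, so the image of lborel under its inverse has a density. *)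
  define G where "G x = f x + (L + 1) * x" for x
  have G_mono: "y - x \<le> G y - G x" if "x \<le> y" for x y
    using fL[of x y] that by (simp add: G_def abs_le_iff algebra_simps)
  have G_lip: "\<bar>G x - G y\<bar> \<le> (2 * L + 1) * \<bar>x - y\<bar>" for x y
    using fL[of x y] L by (simp add: G_def algebra_simps abs_if split: if_splits)
  have G_cont: "continuous_on UNIV G"
    unfolding G_def using lipschitz_on_continuous_on[OF f] by (intro continuous_intros)
  have G_inj: "x \<le> y \<longleftrightarrow> G x \<le> G y" for x y
    using G_mono[of x y] G_mono[of y x] by linarith
  have G_eq: "G x = G y \<longleftrightarrow> x = y" for x y
    using G_inj[of x y] G_inj[of y x] by linarith
  have G_surj: "\<exists>x. G x = y" for y
  proof -
    define c where "c = \<bar>y - G 0\<bar>"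
    have "G (- c) \<le> y" "y \<le> G c"
      using G_mono[of "-c" 0] G_mono[of 0 c] by (auto simp: c_def)
    moreover have "- c \<le> c" by (simp add: c_def)
    ultimately show ?thesis
      using IVT'[of G "-c" y c] G_cont continuous_on_subset by blast
  qed
  define H where "H = inv G"
  have GH: "G (H y) = y" for y unfolding H_def using G_surj[of y] by (auto intro: f_inv_into_f)
  have HG: "H (G x) = x" for x using GH[of "G x"] G_eq by blast
  have H_lip: "\<bar>H x - H y\<bar> \<le> \<bar>x - y\<bar>" for x y
    using G_mono[of "H x" "H y"] G_mono[of "H y" "H x"] by (cases "H x \<le> H y") (auto simp: GH)
  have "1-lipschitz_on UNIV H"
    using H_lip by (intro lipschitz_onI) (auto simp: dist_real_def)
  then have H_meas[measurable]: "H \<in> borel_measurable borel"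
    using lipschitz_on_continuous_on borel_measurable_continuous_onI by blast
  have vim: "H -` A = G ` A" for A
  proof safe
    fix x assume "H x \<in> A"
    then show "x \<in> G ` A" using GH[of x] by (metis imageI)
  qed (simp add: HG)
  define \<nu> where "\<nu> = distr lborel borel H"
  have \<nu>_Icc: "emeasure \<nu> {a..b} = ennreal (G b - G a)" if "a \<le> b" for a b
  proof -
    have "H -` {a..b} = {G a..G b}"
      using G_inj by (auto simp: GH) (metis GH G_inj)+
    then show ?thesis
      using that G_inj by (simp add: \<nu>_def emeasure_distr)
  qed
  have "absolutely_continuous lborel \<nu>"
    unfolding absolutely_continuous_def
  proof
    fix A assume A: "A \<in> null_sets (lborel :: real measure)"
    then have "negligible A"
      using negligible_iff_null_sets null_sets_completionI by blast
    then have "negligible (G ` A)"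
      by (rule negligible_locally_Lipschitz_image[rotated])
         (use G_lip in \<open>auto intro!: exI[of _ UNIV] exI[of _ "2 * L + 1"]\<close>)
    moreover have [measurable]: "A \<in> sets borel" using A by auto
    have "H -` A \<in> sets borel"
      using measurable_sets[OF H_meas, of A] by simp
    ultimately show "A \<in> null_sets \<nu>"
      by (simp add: \<nu>_def null_sets_def emeasure_distr vim negligible_iff_emeasure0 sets_completionI_sets)
  qed
  then obtain g where g[measurable]: "g \<in> borel_measurable borel" and g\<nu>: "density lborel g = \<nu>"
    using sigma_finite_measure.Radon_Nikodym[OF sigma_finite_lborel, of \<nu>] by (auto simp: \<nu>_def)
  have g_Icc: "(\<integral>\<^sup>+x. g x * indicator {a..b} x \<partial>lborel) = ennreal (G b - G a)" if "a \<le> b" for a b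
    using \<nu>_Icc[OF that] by (simp flip: g\<nu> add: emeasure_density)
  \<comment> \<open>Finite mass on each [-n, n] makes the density finite almost everywhere, so that
    \<open>enn2real\<close> loses nothing below.\<close>
  have "AE x in lborel. g x * indicator {- real n..real n} x \<noteq> \<infinity>" for n
    using g_Icc[of "- real n" "real n"] by (intro nn_integral_PInf_AE) auto
  then have "AE x in lborel. \<forall>n. g x * indicator {- real n..real n} x \<noteq> \<infinity>"
    by (simp add: AE_all_countable)
  then have g_fin: "AE x in lborel. g x \<noteq> \<infinity>"
  proof eventually_elim
    case (elim x)
    obtain n where "\<bar>x\<bar> \<le> real n" using real_arch_simple by blast
    then show ?case using elim[rule_format, of n] by (auto simp: indicator_def abs_le_iff)
  qed
  define h where "h x = enn2real (g x) - (L + 1)" for x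
  show thesis
  proof
    show "h \<in> borel_measurable borel" unfolding h_def by measurable
    fix a b :: real assume ab: "a \<le> b"
    have "(\<integral>\<^sup>+x. ennreal (enn2real (g x) * indicator {a..b} x) \<partial>lborel) = (\<integral>\<^sup>+x. g x * indicator {a..b} x \<partial>lborel)"
      using g_fin by (intro nn_integral_cong_AE) (auto simp: indicator_def less_top)
    also have "\<dots> = ennreal (G b - G a)" using g_Icc[OF ab] .
    finally have "((\<lambda>x. enn2real (g x) * indicator {a..b} x) has_integral (G b - G a)) UNIV"
      using G_mono[OF ab] ab by (intro nn_integral_has_integral) auto
    moreover have "(\<lambda>x. enn2real (g x) * indicator {a..b} x) = (\<lambda>x. if x \<in> {a..b} then enn2real (g x) else 0)"
      by (auto simp: indicator_def)
    ultimately have "((\<lambda>x. enn2real (g x)) has_integral (G b - G a)) {a..b}"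
      by (simp only: has_integral_restrict_UNIV)
    from has_integral_diff[OF this has_integral_const_real[of "L + 1" a b]]
    show "(h has_integral f b - f a) {a..b}"
      using ab by (simp add: h_def[abs_def] G_def algebra_simps)
  qed
qed

lemma lipschitz_indefinite_integral:
  fixes p :: "real \<Rightarrow> 'a::euclidean_space"
  assumes p: "L-lipschitz_on UNIV p"
  obtains h where "h \<in> borel_measurable borel"
    and "\<And>a b. a \<le> b \<Longrightarrow> (h has_integral p b - p a) {a..b}"
proof -
  have "\<exists>h. h \<in> borel_measurable borel \<and> (\<forall>a b. a \<le> b \<longrightarrow> (h has_integral p b \<bullet> i - p a \<bullet> i) {a..b})"
    if "i \<in> Basis" for i
  proof -
    have "L-lipschitz_on UNIV (\<lambda>x. p x \<bullet> i)"
    proof (rule lipschitz_onI)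
      show "dist (p x \<bullet> i) (p y \<bullet> i) \<le> L * dist x y" for x y
        using lipschitz_onD[OF p, of x y] norm_nth_le[OF that, of "p x - p y"]
        by (simp add: dist_norm inner_diff_left)
    qed (rule lipschitz_on_nonneg[OF p])
    then show ?thesis using lipschitz_real_indefinite_integral by metis
  qed
  then obtain h where h: "\<And>i. i \<in> Basis \<Longrightarrow> h i \<in> borel_measurable borel"
    "\<And>i a b. i \<in> Basis \<Longrightarrow> a \<le> b \<Longrightarrow> (h i has_integral p b \<bullet> i - p a \<bullet> i) {a..b}"
    by metis
  show thesis
  proof
    show "(\<lambda>x. \<Sum>i\<in>Basis. h i x *\<^sub>R i) \<in> borel_measurable borel"
      using h(1) by (intro borel_measurable_sum borel_measurable_scaleR) auto
    show "((\<lambda>x. \<Sum>i\<in>Basis. h i x *\<^sub>R i) has_integral p b - p a) {a..b}" if "a \<le> b" for a b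
      using h(2)[OF _ that] by (subst has_integral_componentwise_iff) (simp add: inner_diff_left)
  qed
qed

text \<open>Lebesgue's differentiation theorem in the form
  \<open>integrable_ccontinuous_explicit\<close> averages over cubes with lower corner x. On the
  line these are the intervals [x, x + k], so it yields right difference quotients.\<close>

lemma indefinite_integral_right_derivative:
  fixes p :: "real \<Rightarrow> 'a::euclidean_space"
  assumes h: "\<And>a b. a \<le> b \<Longrightarrow> (h has_integral p b - p a) {a..b}"
  obtains N where "negligible N"
    and "\<And>x. x \<notin> N \<Longrightarrow> ((\<lambda>d. (p (x + d) - p x) /\<^sub>R d) \<longlongrightarrow> h x) (at_right 0)"
proof -
  have "h integrable_on cbox a b" for a b
  proof (cases "a \<le> b")
    case True then show ?thesis using h[OF True] by (auto simp: integrable_on_def)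
  qed (auto simp: integrable_on_empty)
  from integrable_ccontinuous_explicit[OF this] obtain N where N: "negligible N"
    and lim: "\<And>x e. \<lbrakk>x \<notin> N; 0 < e\<rbrakk> \<Longrightarrow> \<exists>d>0. \<forall>k. 0 < k \<and> k < d \<longrightarrow>
                 norm (integral (cbox x (x + k *\<^sub>R One)) h /\<^sub>R k ^ DIM(real) - h x) < e"
    by blast
  show thesis
  proof
    show "negligible N" by fact
    fix x assume x: "x \<notin> N"
    show "((\<lambda>d. (p (x + d) - p x) /\<^sub>R d) \<longlongrightarrow> h x) (at_right 0)"
    proof (rule tendstoI)
      fix e :: real assume e: "0 < e"
      from lim[OF x e] obtain d where d: "d > 0" and
        dd: "\<And>k. 0 < k \<Longrightarrow> k < d \<Longrightarrow> norm (integral {x..x + k} h /\<^sub>R k - h x) < e"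
        by auto
      have "integral {x..x+k} h = p (x + k) - p x" if "0 < k" for k
        using h[of x "x + k"] that by (intro integral_unique) auto
      then show "\<forall>\<^sub>F k in at_right 0. dist ((p (x + k) - p x) /\<^sub>R k) (h x) < e"
        unfolding eventually_at_right_field using d dd by (auto simp: dist_norm intro!: exI[of _ d])
    qed
  qed
qed

text \<open>The left quotients of p are the right quotients of its reflection - p (- x), so the
  one-sided result is applied to both functions and the second exceptional set is reflected
  back.\<close>

lemma indefinite_integral_has_vector_derivative_AE:
  fixes p :: "real \<Rightarrow> 'a::euclidean_space"
  assumes h: "\<And>a b. a \<le> b \<Longrightarrow> (h has_integral p b - p a) {a..b}"
  obtains N where "negligible N" and "\<And>x. x \<notin> N \<Longrightarrow> (p has_vector_derivative h x) (at x)"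
proof -
  obtain N1 where N1: "negligible N1"
    "\<And>x. x \<notin> N1 \<Longrightarrow> ((\<lambda>d. (p (x + d) - p x) /\<^sub>R d) \<longlongrightarrow> h x) (at_right 0)"
    using indefinite_integral_right_derivative[OF h] by blast
  define p' where "p' x = - p (- x)" for x
  define h' where "h' x = h (- x)" for x
  have "(h' has_integral p' b - p' a) {a..b}" if "a \<le> b" for a b
    using h[of "-b" "-a"] that has_integral_reflect_lemma_real[of h "p (-a) - p (-b)" "-b" "-a"]
    by (simp add: p'_def h'_def[abs_def])
  from indefinite_integral_right_derivative[OF this] obtain N2 where N2: "negligible N2"
    "\<And>x. x \<notin> N2 \<Longrightarrow> ((\<lambda>d. (p' (x + d) - p' x) /\<^sub>R d) \<longlongrightarrow> h' x) (at_right 0)"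
    by blast
  show thesis
  proof
    show "negligible (N1 \<union> uminus ` N2)"
      using N1(1) N2(1)
      by (auto intro!: negligible_Un negligible_differentiable_image_negligible derivative_intros
               simp: differentiable_on_def)
    fix x assume x: "x \<notin> N1 \<union> uminus ` N2"
    then have "- x \<notin> N2" by force
    from N2(2)[OF this] have "((\<lambda>d. (p (x + d) - p x) /\<^sub>R d) \<longlongrightarrow> h x) (at_left 0)"
      unfolding filterlim_at_left_to_right by (simp add: p'_def h'_def algebra_simps)
    with N1(2)[of x] x have "((\<lambda>d. (p (x + d) - p x) /\<^sub>R d) \<longlongrightarrow> h x) (at 0)"
      by (auto intro: filterlim_split_at)
    from tendsto_norm_zero[OF LIM_zero[OF this]]
    have "((\<lambda>d. norm (p (x + d) - p x - d *\<^sub>R h x) / norm d) \<longlongrightarrow> 0) (at 0)"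
    proof (rule Lim_transform_eventually)
      have "norm ((p (x + d) - p x) /\<^sub>R d - h x) = norm (p (x + d) - p x - d *\<^sub>R h x) / norm d"
        if "d \<noteq> 0" for d
      proof -
        have "(p (x + d) - p x) /\<^sub>R d - h x = (p (x + d) - p x - d *\<^sub>R h x) /\<^sub>R d"
          using that by (simp add: scaleR_diff_right)
        then show ?thesis by (simp add: divide_inverse_commute)
      qed
      then show "\<forall>\<^sub>F d in at 0. norm ((p (x + d) - p x) /\<^sub>R d - h x)
          = norm (p (x + d) - p x - d *\<^sub>R h x) / norm d"
        by (auto simp: eventually_at_filter)
    qed
    then show "(p has_vector_derivative h x) (at x)"
      by (simp add: has_vector_derivative_def has_derivative_at bounded_linear_scaleR_left)
  qed
qed

lemma AE_lebesgue_on_negligible: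
  assumes "negligible N" "S \<in> sets lebesgue" "\<And>t. t \<in> S \<Longrightarrow> t \<notin> N \<Longrightarrow> P t"
  shows "AE t in lebesgue_on S. P t"
proof -
  have "AE t in lebesgue. t \<notin> N"
    using assms(1) by (intro AE_not_in) (simp add: negligible_iff_null_sets)
  then have "AE t in lebesgue. t \<in> S \<longrightarrow> P t"
    by eventually_elim (use assms(3) in auto)
  then show ?thesis
    using assms(2) by (simp add: AE_restrict_space_iff)
qed

lemma borel_measurable_lebesgue_on_of_borel:
  assumes "f \<in> borel_measurable borel" shows "f \<in> borel_measurable (lebesgue_on S)"
  using assms by (simp add: measurable_completion measurable_restrict_space1)

text \<open>As a n \<le> t < b n, the two first-order errors at t add up to a small multiple of b n
  - a n itself. This permits dyadic intervals that contain t in place of intervals that start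
  there.\<close>

lemma straddle_difference_quotient_tendsto:
  fixes p :: "real \<Rightarrow> 'a::real_normed_vector"
  assumes der: "(p has_vector_derivative v) (at t)"
    and a: "\<And>n. a n \<le> t" and b: "\<And>n. t < b n" and lim: "(\<lambda>n. b n - a n) \<longlonglongrightarrow> 0"
  shows "(\<lambda>n. (p (b n) - p (a n)) /\<^sub>R (b n - a n)) \<longlonglongrightarrow> v"
proof (rule tendstoI)
  fix e :: real assume e: "0 < e"
  obtain d where d: "0 < d" "\<And>y. \<bar>y - t\<bar> < d \<Longrightarrow> norm (p y - p t - (y - t) *\<^sub>R v) \<le> e / 2 * \<bar>y - t\<bar>"
    using der e unfolding has_vector_derivative_def has_derivative_at_alt
    by (metis half_gt_zero real_norm_def)
  from order_tendstoD(2)[OF lim d(1)]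
  show "\<forall>\<^sub>F n in sequentially. dist ((p (b n) - p (a n)) /\<^sub>R (b n - a n)) v < e"
  proof eventually_elim
    case (elim n)
    define w where "w = b n - a n"
    have w: "0 < w" using a[of n] b[of n] by (simp add: w_def)
    have "norm (p (b n) - p (a n) - w *\<^sub>R v)
        = norm ((p (b n) - p t - (b n - t) *\<^sub>R v) - (p (a n) - p t - (a n - t) *\<^sub>R v))"
      by (simp add: algebra_simps w_def)
    also have "\<dots> \<le> e / 2 * \<bar>b n - t\<bar> + e / 2 * \<bar>a n - t\<bar>"
      using elim a[of n] b[of n] by (intro order_trans[OF norm_triangle_ineq4] add_mono d(2)) auto
    also have "\<dots> = e / 2 * w"
      using a[of n] b[of n] by (simp add: w_def field_simps)
    finally have "norm ((p (b n) - p (a n) - w *\<^sub>R v) /\<^sub>R w) \<le> e / 2"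
      using w by (simp add: divide_simps mult.commute)
    moreover have "(p (b n) - p (a n) - w *\<^sub>R v) /\<^sub>R w = (p (b n) - p (a n)) /\<^sub>R w - v"
      using w by (simp add: scaleR_diff_right)
    ultimately have "norm ((p (b n) - p (a n)) /\<^sub>R w - v) \<le> e / 2" by metis
    then show ?case using e by (simp add: dist_norm w_def)
  qed
qed

section \<open>Speed of Lipschitz paths on the half-line\<close>

definition speed :: "(real \<Rightarrow> 'a::euclidean_space) \<Rightarrow> real \<Rightarrow> real" where
  "speed p t = norm (vector_derivative p (at t within {0..}))"

lemma speed_nonneg[simp]: "0 \<le> speed p t"
  by (simp add: speed_def)

text \<open>\<open>vector_derivative\<close> is unspecified where p is not differentiable; h is a
  Borel version of it that also represents p as an indefinite integral.\<close>

lemma lipschitz_halfline_derivative: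
  fixes p :: "real \<Rightarrow> 'a::euclidean_space"
  assumes p: "L-lipschitz_on {0..} p"
  obtains h N where "h \<in> borel_measurable borel" "negligible N"
    and "\<And>a b. 0 \<le> a \<Longrightarrow> a \<le> b \<Longrightarrow> (h has_integral p b - p a) {a..b}"
    and "\<And>t. 0 \<le> t \<Longrightarrow> t \<notin> N \<Longrightarrow> 0 < t"
    and "\<And>t. 0 \<le> t \<Longrightarrow> t \<notin> N \<Longrightarrow> (p has_vector_derivative h t) (at t)"
    and "\<And>t. 0 \<le> t \<Longrightarrow> t \<notin> N \<Longrightarrow> vector_derivative p (at t within {0..}) = h t"
    and "\<And>t. 0 \<le> t \<Longrightarrow> t \<notin> N \<Longrightarrow> norm (h t) \<le> L"
proof -
  have L: "0 \<le> L" using p by (rule lipschitz_on_nonneg)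
  \<comment> \<open>Freezing p to the left of 0 keeps the Lipschitz constant and gives a function on
    the whole line.\<close>
  define p' where "p' t = p (max 0 t)" for t
  have p'_lip: "L-lipschitz_on UNIV p'"
  proof (rule lipschitz_onI[OF _ L])
    fix x y :: real
    have "dist (p' x) (p' y) \<le> L * dist (max 0 x) (max 0 y)"
      unfolding p'_def using lipschitz_onD[OF p] by auto
    also have "\<dots> \<le> L * dist x y"
      using L by (intro mult_left_mono) (auto simp: dist_real_def)
    finally show "dist (p' x) (p' y) \<le> L * dist x y" .
  qed
  obtain h where h: "h \<in> borel_measurable borel"
    and h_int: "\<And>a b. a \<le> b \<Longrightarrow> (h has_integral p' b - p' a) {a..b}"
    using lipschitz_indefinite_integral[OF p'_lip] by blast
  obtain N where N: "negligible N"
    and h_der: "\<And>t. t \<notin> N \<Longrightarrow> (p' has_vector_derivative h t) (at t)"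
    using indefinite_integral_has_vector_derivative_AE[OF h_int] by blast
  have der: "(p has_vector_derivative h t) (at t)" if "0 < t" "t \<notin> N" for t
    using h_der[OF that(2)]
    by (rule has_vector_derivative_transform_within_open[where S="{0<..}"])
       (use that in \<open>auto simp: p'_def\<close>)
  show thesis
  \<comment> \<open>Adding 0 to the exceptional set leaves only interior points, where the
    derivative within \<open>{0..}\<close> is the two-sided one.\<close>
  proof (rule that[of h "insert 0 N"])
    fix a b :: real assume "0 \<le> a" "a \<le> b"
    then show "(h has_integral p b - p a) {a..b}"
      using h_int[of a b] by (simp add: p'_def max_def)
  next
    fix t :: real assume "0 \<le> t" "t \<notin> insert 0 N"
    then have t: "0 < t" "t \<notin> N" by auto
    show "0 < t" by fact
    show d: "(p has_vector_derivative h t) (at t)" using der[OF t] .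
    have "at t within {0..} = at t"
      using t by (intro at_within_interior) (auto simp: interior_real_atLeast)
    then show "vector_derivative p (at t within {0..}) = h t"
      using vector_derivative_at[OF d] by simp
    show "norm (h t) \<le> L"
    proof (rule LIMSEQ_le_const2)
      have "(\<lambda>n. (p (t + 1 / real (Suc n)) - p t) /\<^sub>R (t + 1 / real (Suc n) - t)) \<longlonglongrightarrow> h t"
        by (rule straddle_difference_quotient_tendsto[OF d])
           (use LIMSEQ_inverse_real_of_nat in \<open>auto simp: inverse_eq_divide\<close>)
      from tendsto_norm[OF this]
      show "(\<lambda>n. norm ((p (t + 1 / real (Suc n)) - p t) /\<^sub>R (1 / real (Suc n)))) \<longlonglongrightarrow> norm (h t)"
        by simp
      have "norm ((p (t + 1 / real (Suc n)) - p t) /\<^sub>R (1 / real (Suc n))) \<le> L" for n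
      proof -
        have "norm (p (t + 1 / real (Suc n)) - p t) \<le> L * (1 / real (Suc n))"
          using lipschitz_onD[OF p, of "t + 1 / real (Suc n)" t] t by (simp add: dist_norm)
        moreover have "norm (y /\<^sub>R c) = norm y / c" if "0 < c" for y :: 'a and c
          using that by (simp add: divide_inverse_commute)
        ultimately show ?thesis by (simp add: pos_le_divide_eq mult.commute)
      qed
      then show "\<exists>N. \<forall>n\<ge>N. norm ((p (t + 1 / real (Suc n)) - p t) /\<^sub>R (1 / real (Suc n))) \<le> L"
        by blast
    qed
  qed (use h N in auto)
qed

lemma
  fixes p :: "real \<Rightarrow> 'a::euclidean_space"
  assumes p: "L-lipschitz_on {0..} p"
  shows borel_measurable_speed: "speed p \<in> borel_measurable (lebesgue_on {0..})"
    and speed_le: "AE t in lebesgue_on {0..}. speed p t \<le> L"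
    and lipschitz_AE_derivative: "AE t in lebesgue_on {0..}.
          0 < t \<and> (p has_vector_derivative vector_derivative p (at t within {0..})) (at t)"
    and norm_diff_le_integral_speed: "0 \<le> a \<Longrightarrow> a \<le> b \<Longrightarrow>
          ennreal (norm (p b - p a)) \<le> (\<integral>\<^sup>+t\<in>{a..b}. ennreal (speed p t) \<partial>lebesgue_on {0..})"
proof -
  obtain h N where h[measurable]: "h \<in> borel_measurable borel" and N: "negligible N"
    and int: "\<And>a b. 0 \<le> a \<Longrightarrow> a \<le> b \<Longrightarrow> (h has_integral p b - p a) {a..b}"
    and pos: "\<And>t. 0 \<le> t \<Longrightarrow> t \<notin> N \<Longrightarrow> 0 < t"
    and der: "\<And>t. 0 \<le> t \<Longrightarrow> t \<notin> N \<Longrightarrow> (p has_vector_derivative h t) (at t)"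
    and vd: "\<And>t. 0 \<le> t \<Longrightarrow> t \<notin> N \<Longrightarrow> vector_derivative p (at t within {0..}) = h t"
    and hL: "\<And>t. 0 \<le> t \<Longrightarrow> t \<notin> N \<Longrightarrow> norm (h t) \<le> L"
    using lipschitz_halfline_derivative[OF p] by blast
  show "AE t in lebesgue_on {0..}. speed p t \<le> L"
    by (rule AE_lebesgue_on_negligible[OF N]) (use vd hL in \<open>auto simp: speed_def\<close>)
  show "AE t in lebesgue_on {0..}.
          0 < t \<and> (p has_vector_derivative vector_derivative p (at t within {0..})) (at t)"
    by (rule AE_lebesgue_on_negligible[OF N]) (use vd der pos in \<open>auto simp: speed_def\<close>)
  have eq: "AE t in lebesgue_on {0..}. norm (h t) = speed p t"
    by (rule AE_lebesgue_on_negligible[OF N]) (use vd in \<open>auto simp: speed_def\<close>)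
  have hm: "h \<in> borel_measurable (lebesgue_on S)" for S
    by (rule borel_measurable_lebesgue_on_of_borel) fact
  \<comment> \<open>The speed agrees with the Borel function norm (h t) only almost everywhere, so
    its measurability rests on the completeness of Lebesgue measure.\<close>
  show "speed p \<in> borel_measurable (lebesgue_on {0..})"
  proof (rule borel_measurable_if_D)
    show "(\<lambda>t. if t \<in> {0..} then speed p t else 0) \<in> borel_measurable lebesgue"
    proof (rule borel_measurable_AE)
      show "(\<lambda>t. if t \<in> {0..} then norm (h t) else 0) \<in> borel_measurable lebesgue"
        by (rule measurable_completion) measurable
      show "AE t in lebesgue. (if t \<in> {0..} then norm (h t) else 0) = (if t \<in> {0..} then speed p t else 0)"
        using eq by (simp add: AE_restrict_space_iff)    qed
  qed
  show "ennreal (norm (p b - p a)) \<le> (\<integral>\<^sup>+t\<in>{a..b}. ennreal (speed p t) \<partial>lebesgue_on {0..})"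
    if ab: "0 \<le> a" "a \<le> b" for a b
  proof -
    \<comment> \<open>The bound L makes h Bochner integrable on the interval, so that the gauge
      integral is a Lebesgue integral and the norm can be moved inside.\<close>
    have "(\<integral>\<^sup>+t. ennreal (norm (h t)) \<partial>lebesgue_on {a..b}) \<le> (\<integral>\<^sup>+t. ennreal L \<partial>lebesgue_on {a..b})"
      by (intro nn_integral_mono_AE AE_lebesgue_on_negligible[OF N])
         (use ab hL in \<open>auto intro!: ennreal_leI\<close>)
    also have "\<dots> < \<infinity>"
      using ab by (simp add: emeasure_restrict_space ennreal_mult_less_top)
    finally have hi: "integrable (lebesgue_on {a..b}) h"
      using hm by (auto intro: integrableI_bounded)
    have "p b - p a = (LINT t|lebesgue_on {a..b}. h t)"
      using int[OF ab] lebesgue_integral_eq_integral[OF hi] by (simp add: integral_unique)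
    then have "ennreal (norm (p b - p a)) \<le> (\<integral>\<^sup>+t. ennreal (norm (h t)) \<partial>lebesgue_on {a..b})"
      using integral_norm_bound_ennreal[OF hi] by simp
    also have "\<dots> = (\<integral>\<^sup>+t\<in>{a..b}. ennreal (norm (h t)) \<partial>lebesgue_on {0..})"
      using ab by (auto simp: nn_integral_restrict_space indicator_def intro!: nn_integral_cong)
    also have "\<dots> = (\<integral>\<^sup>+t\<in>{a..b}. ennreal (speed p t) \<partial>lebesgue_on {0..})"
      using eq by (intro nn_integral_cong_AE) auto
    finally show ?thesis .
  qed
qed

section \<open>Dyadic Riemann sums and lower semicontinuity of weighted length\<close>

lemma ennreal_mult_le_liminf:
  fixes f g :: "nat \<Rightarrow> ennreal"
  assumes "f \<longlonglongrightarrow> a" "g \<longlonglongrightarrow> b" "b \<noteq> \<infinity>"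
  shows "a * b \<le> liminf (\<lambda>n. f n * g n)"
\<comment> \<open>For b = 0 and a = \<infinity> the products need not converge to a * b, but the
  inequality is trivial since \<infinity> * 0 = 0.\<close>
proof (cases "b = 0")
  case False
  have "(\<lambda>n. f n * g n) \<longlonglongrightarrow> a * b"
    using assms False by (intro tendsto_mult_ennreal) auto
  then show ?thesis using lim_imp_Liminf[of sequentially] by fastforce
qed simp

lemma dyadic_floor_tendsto: "(\<lambda>N. of_int \<lfloor>2 ^ N * x\<rfloor> / (2::real) ^ N) \<longlonglongrightarrow> x"
proof (rule real_tendsto_sandwich)
  have "(\<lambda>N. x - (1/2::real) ^ N) \<longlonglongrightarrow> x - 0"
    by (intro tendsto_intros LIMSEQ_power_zero) simp
  then show "(\<lambda>N. x - (1/2::real) ^ N) \<longlonglongrightarrow> x" by simp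
  have "x - (1/2) ^ N \<le> of_int \<lfloor>2 ^ N * x\<rfloor> / 2 ^ N" for N
  proof -
    have "(2 ^ N * x - 1) / 2 ^ N \<le> of_int \<lfloor>2 ^ N * x\<rfloor> / 2 ^ N"
      by (intro divide_right_mono) (linarith, simp)
    then show ?thesis by (simp add: diff_divide_distrib power_one_over)
  qed
  then show "\<forall>\<^sub>F N in sequentially. x - (1/2) ^ N \<le> of_int \<lfloor>2 ^ N * x\<rfloor> / 2 ^ N" by simp
  have "of_int \<lfloor>2 ^ N * x\<rfloor> / 2 ^ N \<le> x" for N
    using of_int_floor_le[of "2 ^ N * x"] by (simp add: pos_divide_le_eq mult.commute)
  then show "\<forall>\<^sub>F N in sequentially. of_int \<lfloor>2 ^ N * x\<rfloor> / 2 ^ N \<le> x" by simp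
qed simp

lemma emeasure_lebesgue_on_halfline_Ico:
  assumes "0 \<le> a" "a \<le> b" shows "emeasure (lebesgue_on {0..}) {a..<b} = ennreal (b - a)"
  using assms by (subst emeasure_restrict_space) auto

text \<open>Each sum is the integral of the step function \<open>F N\<close>, whose value at t is
  the weight at the dyadic point below t times a difference quotient over the dyadic interval
  containing t. At almost every t the liminf of these values is at least c t * speed p t, and
  Fatou's lemma concludes. The intervals cover [0, N), so every t is eventually reached. The weights
  depend on N because the base of the power will be corrected by a term of order 2^(-N).\<close>

lemma weighted_length_le_liminf:
  fixes p :: "real \<Rightarrow> 'a::euclidean_space" and c :: "real \<Rightarrow> ennreal"
  assumes p: "L-lipschitz_on {0..} p" and C: "\<And>N s. 0 \<le> C N s"
    and c: "AE t in lebesgue_on {0..}. (\<lambda>N. ennreal (C N (real (nat \<lfloor>2 ^ N * t\<rfloor>) / 2 ^ N))) \<longlonglongrightarrow> c t"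
  shows "(\<integral>\<^sup>+t. c t * ennreal (speed p t) \<partial>lebesgue_on {0..}) \<le>
    liminf (\<lambda>N. \<Sum>i<N * 2 ^ N. ennreal (C N (real i / 2 ^ N) *
      norm (p (real (Suc i) / 2 ^ N) - p (real i / 2 ^ N))))"
proof -
  define Q where "Q N i = norm (p (real (Suc i) / 2 ^ N) - p (real i / 2 ^ N))" for N i
  \<comment> \<open>The factor 2 ^ N is the inverse length of the interval: it turns increments into
    difference quotients and cancels in the integral.\<close>
  define F where "F N t = (\<Sum>i<N * 2 ^ N. ennreal (C N (real i / 2 ^ N) * Q N i * 2 ^ N)
      * indicator {real i / 2 ^ N..<real (Suc i) / 2 ^ N} t)" for N t
  have Fm: "F N \<in> borel_measurable (lebesgue_on {0..})" for N
    unfolding F_def by (rule borel_measurable_lebesgue_on_of_borel) measurable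
  have F_int: "(\<integral>\<^sup>+t. F N t \<partial>lebesgue_on {0..}) = (\<Sum>i<N * 2 ^ N. ennreal (C N (real i / 2 ^ N) * Q N i))" for N
  proof -
    have I: "{real i / 2 ^ N..<real (Suc i) / 2 ^ N} \<in> sets (lebesgue_on {0..})" for i
      by (subst sets_restrict_space_iff) (auto intro: order_trans[rotated])
    have "(\<integral>\<^sup>+t. F N t \<partial>lebesgue_on {0..}) =
        (\<Sum>i<N * 2 ^ N. ennreal (C N (real i / 2 ^ N) * Q N i * 2 ^ N) * ennreal (1 / 2 ^ N))"
      unfolding F_def using I
      by (subst nn_integral_sum)
         (auto simp: nn_integral_cmult_indicator emeasure_lebesgue_on_halfline_Ico divide_right_mono
            simp flip: diff_divide_distrib intro!: sum.cong)
    also have "\<dots> = (\<Sum>i<N * 2 ^ N. ennreal (C N (real i / 2 ^ N) * Q N i))"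
      using C by (intro sum.cong refl) (simp add: Q_def flip: ennreal_mult)
    finally show ?thesis .
  qed
  have "AE t in lebesgue_on {0..}. c t * ennreal (speed p t) \<le> liminf (\<lambda>N. F N t)"
    using c lipschitz_AE_derivative[OF p]
  proof eventually_elim
    case (elim t)
    define k where "k N = nat \<lfloor>2 ^ N * t\<rfloor>" for N
    have rk: "real (k N) = of_int \<lfloor>2 ^ N * t\<rfloor>" for N
      using elim(2) by (simp add: k_def)
    have k1: "real (k N) / 2 ^ N \<le> t" for N
      using rk[of N] of_int_floor_le[of "2 ^ N * t"] by (simp add: pos_divide_le_eq mult.commute)
    have k2: "t < real (Suc (k N)) / 2 ^ N" for N
      proof -
      have "t * 2 ^ N < real (Suc (k N))"
        unfolding of_nat_Suc rk[of N] by (subst mult.commute) linarith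
      then show ?thesis by (simp add: pos_less_divide_eq)
    qed
    have "(\<lambda>N. (p (real (Suc (k N)) / 2 ^ N) - p (real (k N) / 2 ^ N)) /\<^sub>R (real (Suc (k N)) / 2 ^ N - real (k N) / 2 ^ N))
        \<longlonglongrightarrow> vector_derivative p (at t within {0..})"
    proof (rule straddle_difference_quotient_tendsto)
      have "(\<lambda>N. (1/2::real) ^ N) \<longlonglongrightarrow> 0" by (rule LIMSEQ_power_zero) simp
      then show "(\<lambda>N. real (Suc (k N)) / 2 ^ N - real (k N) / 2 ^ N) \<longlonglongrightarrow> 0"
        by (simp add: power_one_over flip: diff_divide_distrib)
    qed (use elim k1 k2 in auto)
    from tendsto_norm[OF this]
    have "(\<lambda>N. Q N (k N) * 2 ^ N) \<longlonglongrightarrow> speed p t"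
      by (simp add: Q_def speed_def mult.commute flip: diff_divide_distrib)
    then have "(\<lambda>N. ennreal (Q N (k N) * 2 ^ N)) \<longlonglongrightarrow> ennreal (speed p t)"
      by (rule tendsto_ennrealI)
    moreover have "(\<lambda>N. ennreal (C N (real (k N) / 2 ^ N))) \<longlonglongrightarrow> c t"
      using elim(1) by (simp add: k_def)
    ultimately have "c t * ennreal (speed p t) \<le> liminf (\<lambda>N. ennreal (C N (real (k N) / 2 ^ N)) * ennreal (Q N (k N) * 2 ^ N))"
      by (intro ennreal_mult_le_liminf) auto
    also have "\<dots> \<le> liminf (\<lambda>N. F N t)"
    proof (rule Liminf_mono)
      obtain N0 where N0: "t < real N0" using reals_Archimedean2 by blast
      show "\<forall>\<^sub>F N in sequentially. ennreal (C N (real (k N) / 2 ^ N)) * ennreal (Q N (k N) * 2 ^ N) \<le> F N t"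
        using eventually_ge_at_top[of N0]
      proof eventually_elim
        case (elim N)
        have "real (k N) < real (N * 2 ^ N)"
        proof -
          have "real (k N) \<le> t * 2 ^ N" using k1[of N] by (simp add: pos_divide_le_eq)
          also have "\<dots> < real N * 2 ^ N" using N0 elim by (intro mult_strict_right_mono) auto
          finally show ?thesis by simp
        qed
        then have kN: "k N < N * 2 ^ N" by linarith
        have "ennreal (C N (real (k N) / 2 ^ N)) * ennreal (Q N (k N) * 2 ^ N)
            = ennreal (C N (real (k N) / 2 ^ N) * Q N (k N) * 2 ^ N)
              * indicator {real (k N) / 2 ^ N..<real (Suc (k N)) / 2 ^ N} t"
          using C k1[of N] k2[of N] by (simp add: Q_def mult.assoc flip: ennreal_mult)
        also have "\<dots> \<le> F N t"
          unfolding F_def by (rule member_le_sum[where i="k N"]) (use kN in auto)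
        finally show ?case .
      qed
    qed
    finally show ?case .
  qed
  then have "(\<integral>\<^sup>+t. c t * ennreal (speed p t) \<partial>lebesgue_on {0..}) \<le> (\<integral>\<^sup>+t. liminf (\<lambda>N. F N t) \<partial>lebesgue_on {0..})"
    by (rule nn_integral_mono_AE)
  also have "\<dots> \<le> liminf (\<lambda>N. \<integral>\<^sup>+t. F N t \<partial>lebesgue_on {0..})"
    by (rule nn_integral_liminf) (rule Fm)
  finally show ?thesis by (simp add: F_int Q_def)
qed

section \<open>Arc length\<close>

definition arclen :: "(real \<Rightarrow> 'a::euclidean_space) \<Rightarrow> real \<Rightarrow> real" where
  "arclen p t = enn2real (\<integral>\<^sup>+u\<in>{0..<t}. ennreal (speed p u) \<partial>lebesgue_on {0..})"

definition total_len :: "(real \<Rightarrow> 'a::euclidean_space) \<Rightarrow> real" where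
  "total_len p = enn2real (\<integral>\<^sup>+u. ennreal (speed p u) \<partial>lebesgue_on {0..})"

text \<open>The first time at which length s has been travelled. Capping s at the total length keeps
  the set nonempty, so the reparametrized path rests at its end afterwards.\<close>

definition arclen_time :: "(real \<Rightarrow> 'a::euclidean_space) \<Rightarrow> real \<Rightarrow> real" where
  "arclen_time p s = Inf {t. 0 \<le> t \<and> min s (total_len p) \<le> arclen p t}"

definition arclen_param :: "(real \<Rightarrow> 'a::euclidean_space) \<Rightarrow> real \<Rightarrow> 'a" where
  "arclen_param p s = p (arclen_time p s)"

lemma arclen_nonneg[simp]: "0 \<le> arclen p t"
  by (simp add: arclen_def)

lemma total_len_nonneg[simp]: "0 \<le> total_len p"
  by (simp add: total_len_def)

lemma Ico_in_sets_halfline[measurable]: "0 \<le> a \<Longrightarrow> {a..<b::real} \<in> sets (lebesgue_on {0..})"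
  by (subst sets_restrict_space_iff) auto

text \<open>T is any time from which the path rests, not necessarily the first.\<close>

locale stopped_path =
  fixes p :: "real \<Rightarrow> 'a::euclidean_space" and T :: real
  assumes lip: "1-lipschitz_on {0..} p" and T: "0 \<le> T" and const: "\<And>t. T \<le> t \<Longrightarrow> p t = p T"
begin

lemma speed_measurable[measurable]: "speed p \<in> borel_measurable (lebesgue_on {0..})"
  by (rule borel_measurable_speed[OF lip])

lemma integral_speed_Ico:
  assumes "0 \<le> a" "a \<le> b"
  shows "(\<integral>\<^sup>+u\<in>{a..<b}. ennreal (speed p u) \<partial>lebesgue_on {0..}) = ennreal (arclen p b - arclen p a)"
    and "(\<integral>\<^sup>+u\<in>{a..<b}. ennreal (speed p u) \<partial>lebesgue_on {0..}) \<le> ennreal (b - a)"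
proof -
  have le: "(\<integral>\<^sup>+u\<in>{a..<b}. ennreal (speed p u) \<partial>lebesgue_on {0..}) \<le> ennreal (b - a)" if "0 \<le> a" "a \<le> b" for a b
  proof -
    have "(\<integral>\<^sup>+u\<in>{a..<b}. ennreal (speed p u) \<partial>lebesgue_on {0..}) \<le> (\<integral>\<^sup>+u. indicator {a..<b} u \<partial>lebesgue_on {0..})"
      using speed_le[OF lip] by (intro nn_integral_mono_AE) (auto elim!: eventually_mono simp: indicator_def)
    then show ?thesis using that by (simp add: emeasure_lebesgue_on_halfline_Ico)
  qed
  then show "(\<integral>\<^sup>+u\<in>{a..<b}. ennreal (speed p u) \<partial>lebesgue_on {0..}) \<le> ennreal (b - a)"
    using assms by blast
  have fin: "(\<integral>\<^sup>+u\<in>{0..<t}. ennreal (speed p u) \<partial>lebesgue_on {0..}) = ennreal (arclen p t)" if "0 \<le> t" for t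
    using le_less_trans[OF le[of 0 t] ennreal_less_top] that by (simp add: arclen_def ennreal_enn2real)
  have "(\<integral>\<^sup>+u\<in>{0..<b}. ennreal (speed p u) \<partial>lebesgue_on {0..})
      = (\<integral>\<^sup>+u. (ennreal (speed p u) * indicator {0..<a} u + ennreal (speed p u) * indicator {a..<b} u) \<partial>lebesgue_on {0..})"
    using assms by (intro nn_integral_cong) (auto simp: indicator_def)
  also have "\<dots> = (\<integral>\<^sup>+u\<in>{0..<a}. ennreal (speed p u) \<partial>lebesgue_on {0..}) + (\<integral>\<^sup>+u\<in>{a..<b}. ennreal (speed p u) \<partial>lebesgue_on {0..})"
    using assms by (intro nn_integral_add) auto
  finally have "ennreal (arclen p b) = ennreal (arclen p a) + (\<integral>\<^sup>+u\<in>{a..<b}. ennreal (speed p u) \<partial>lebesgue_on {0..})"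
    using fin assms by simp
  then show "(\<integral>\<^sup>+u\<in>{a..<b}. ennreal (speed p u) \<partial>lebesgue_on {0..}) = ennreal (arclen p b - arclen p a)"
    using ennreal_minus[of "arclen p a" "arclen p b"] by (simp add: ennreal_add_diff_cancel_left)
qed

lemma arclen_diff_le: "0 \<le> a \<Longrightarrow> a \<le> b \<Longrightarrow> arclen p b - arclen p a \<le> b - a"
  using integral_speed_Ico[of a b] by (cases "arclen p b - arclen p a \<le> 0") (auto simp: ennreal_le_iff)

lemma arclen_0[simp]: "arclen p 0 = 0"
  by (simp add: arclen_def)

lemma arclen_mono: assumes "0 \<le> a" "a \<le> b" shows "arclen p a \<le> arclen p b"
proof -
  have "(\<integral>\<^sup>+u\<in>{0..<a}. ennreal (speed p u) \<partial>lebesgue_on {0..}) \<le> (\<integral>\<^sup>+u\<in>{0..<b}. ennreal (speed p u) \<partial>lebesgue_on {0..})"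
    using assms by (intro nn_integral_mono) (auto simp: indicator_def)
  moreover have "(\<integral>\<^sup>+u\<in>{0..<b}. ennreal (speed p u) \<partial>lebesgue_on {0..}) < \<infinity>"
    using integral_speed_Ico(1)[of 0 b] assms by simp
  ultimately show ?thesis
    unfolding arclen_def by (intro enn2real_mono) auto
qed

lemma norm_diff_le_integral_Ico:
  assumes "0 \<le> a" "a \<le> b"
  shows "ennreal (norm (p b - p a)) \<le> (\<integral>\<^sup>+u\<in>{a..<b}. ennreal (speed p u) \<partial>lebesgue_on {0..})"
proof -
  have "AE u in lebesgue_on {0..}. u \<noteq> b"
    by (rule AE_lebesgue_on_negligible[of "{b}"]) auto
  then have "(\<integral>\<^sup>+u\<in>{a..b}. ennreal (speed p u) \<partial>lebesgue_on {0..}) = (\<integral>\<^sup>+u\<in>{a..<b}. ennreal (speed p u) \<partial>lebesgue_on {0..})"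
    by (intro nn_integral_cong_AE) (auto elim!: eventually_mono simp: indicator_def)
  with norm_diff_le_integral_speed[OF lip assms] show ?thesis by simp
qed

lemma norm_diff_le_arclen: assumes "0 \<le> a" "a \<le> b" shows "norm (p b - p a) \<le> arclen p b - arclen p a"
  using norm_diff_le_integral_Ico[OF assms] integral_speed_Ico(1)[OF assms] arclen_mono[OF assms]
  by (simp add: ennreal_le_iff)

lemma integral_speed: "(\<integral>\<^sup>+u. ennreal (speed p u) \<partial>lebesgue_on {0..}) = ennreal (arclen p t)" if "T \<le> t"
proof -
  have spd: "speed p u = 0" if "T < u" for u
  proof -
    have "(p has_vector_derivative 0) (at u)"
      by (rule has_vector_derivative_transform_within_open[where S="{T<..}" and f="\<lambda>_. p T"])
         (use that in \<open>auto intro!: const[symmetric]\<close>)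
    moreover have "at u within {0..} = at u"
      using that T by (intro at_within_interior) (auto simp: interior_real_atLeast)
    ultimately show ?thesis by (simp add: speed_def vector_derivative_at)
  qed
  have "AE u in lebesgue_on {0..}. u \<noteq> t \<and> 0 \<le> u"
    by (rule AE_lebesgue_on_negligible[of "{t}"]) auto
  then have "AE u in lebesgue_on {0..}. ennreal (speed p u) = ennreal (speed p u) * indicator {0..<t} u"
  proof eventually_elim
    case (elim u)
    then show ?case using that T spd[of u] by (auto simp: indicator_def not_less)
  qed
  then have "(\<integral>\<^sup>+u. ennreal (speed p u) \<partial>lebesgue_on {0..}) = (\<integral>\<^sup>+u\<in>{0..<t}. ennreal (speed p u) \<partial>lebesgue_on {0..})"
    by (rule nn_integral_cong_AE)
  then show ?thesis using integral_speed_Ico(1)[of 0 t] that T by simp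
qed

lemma arclen_eq_total_len: "T \<le> t \<Longrightarrow> arclen p t = total_len p"
  using integral_speed[of t] by (simp add: total_len_def)

lemma integral_speed_eq_total_len: "(\<integral>\<^sup>+u. ennreal (speed p u) \<partial>lebesgue_on {0..}) = ennreal (total_len p)"
  using integral_speed[of T] by (simp add: total_len_def)

lemma arclen_le_total_len: "0 \<le> t \<Longrightarrow> arclen p t \<le> total_len p"
  using arclen_mono[of t "max t T"] arclen_eq_total_len[of "max t T"] by simp

lemma continuous_on_arclen: "continuous_on {0..} (arclen p)"
proof -
  have "1-lipschitz_on {0..} (arclen p)"
  proof (rule lipschitz_onI)
    show "dist (arclen p x) (arclen p y) \<le> 1 * dist x y" if "x \<in> {0..}" "y \<in> {0..}" for x y
      using that arclen_diff_le[of x y] arclen_diff_le[of y x] arclen_mono[of x y] arclen_mono[of y x]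
      by (cases "x \<le> y") (auto simp: dist_real_def)
  qed simp
  then show ?thesis by (rule lipschitz_on_continuous_on)
qed

section \<open>Arrival times and the parametrization by arc length\<close>

abbreviation "F s \<equiv> {t. 0 \<le> t \<and> min s (total_len p) \<le> arclen p t}"

lemma T_in_F: "T \<in> F s"
  using T arclen_eq_total_len[of T] by auto

lemma bdd_below_F: "bdd_below (F s)"
  by (rule bdd_belowI[of _ 0]) auto

lemma arclen_time_le: "t \<in> F s \<Longrightarrow> arclen_time p s \<le> t"
  unfolding arclen_time_def by (rule cInf_lower) (use bdd_below_F in auto)

lemma arclen_time_nonneg: "0 \<le> arclen_time p s"
  unfolding arclen_time_def by (rule cInf_greatest) (use T_in_F in auto)

lemma arclen_time_mono: "s \<le> s' \<Longrightarrow> arclen_time p s \<le> arclen_time p s'"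
  unfolding arclen_time_def by (rule cInf_superset_mono) (use T_in_F[of s'] bdd_below_F in auto)

text \<open>Arc length is continuous, so the infimum is attained, and by the intermediate value
  theorem the length at the first arrival cannot overshoot the level.\<close>

lemma arclen_arclen_time:
  assumes "0 \<le> s" shows "arclen p (arclen_time p s) = min s (total_len p)"
proof -
  have "closed ({0..} \<inter> arclen p -` {min s (total_len p)..})"
    by (rule continuous_closed_preimage[OF continuous_on_arclen]) auto
  moreover have "{0..} \<inter> arclen p -` {min s (total_len p)..} = F s" by auto
  ultimately have "arclen_time p s \<in> F s"
    unfolding arclen_time_def using closed_contains_Inf[OF _ bdd_below_F, of s] T_in_F[of s] by auto
  then have ge: "min s (total_len p) \<le> arclen p (arclen_time p s)" by auto
  have "\<exists>x\<ge>0. x \<le> arclen_time p s \<and> arclen p x = min s (total_len p)"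
    using IVT'[of "arclen p" 0 "min s (total_len p)" "arclen_time p s"] ge assms arclen_time_nonneg[of s]
      continuous_on_subset[OF continuous_on_arclen, of "{0..arclen_time p s}"] by auto
  then obtain x where x: "0 \<le> x" "x \<le> arclen_time p s" "arclen p x = min s (total_len p)" by blast
  then have "arclen_time p s \<le> x" by (intro arclen_time_le) auto
  with x show ?thesis by simp
qed

lemma norm_arclen_param_diff:
  assumes "0 \<le> s" "0 \<le> s'" shows "norm (arclen_param p s - arclen_param p s') \<le> \<bar>s - s'\<bar>"
proof -
  have *: "norm (arclen_param p s' - arclen_param p s) \<le> s' - s" if "0 \<le> s" "s \<le> s'" for s s'
    using norm_diff_le_arclen[OF arclen_time_nonneg arclen_time_mono[OF that(2)]] that
      arclen_arclen_time[of s] arclen_arclen_time[of s']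
    by (simp add: arclen_param_def)
  show ?thesis using *[of s s'] *[of s' s] assms by (cases "s \<le> s'") (auto simp: norm_minus_commute)
qed

text \<open>Between the first arrival time and t no length is travelled, so p does not move
  there.\<close>

lemma arclen_param_arclen: assumes "0 \<le> t" shows "arclen_param p (arclen p t) = p t"
proof -
  have "arclen_time p (arclen p t) \<le> t"
    using assms by (intro arclen_time_le) auto
  from norm_diff_le_arclen[OF arclen_time_nonneg this]
  show ?thesis
    using arclen_arclen_time[of "arclen p t"] arclen_le_total_len[OF assms] by (simp add: arclen_param_def)
qed

lemma arclen_param_0[simp]: "arclen_param p 0 = p 0"
  using arclen_param_arclen[of 0] by simp

lemma arclen_param_final: assumes "total_len p \<le> s" shows "arclen_param p s = p T"
proof -
  have "arclen_time p s \<le> T" by (rule arclen_time_le[OF T_in_F])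
  from norm_diff_le_arclen[OF arclen_time_nonneg this]
  show ?thesis
    using arclen_arclen_time[of s] assms arclen_eq_total_len[of T] total_len_nonneg[of p]
    by (simp add: arclen_param_def min_def split: if_splits)
qed

lemma arclen_param_image: "arclen_param p ` {0..} = p ` {0..}"
proof
  show "arclen_param p ` {0..} \<subseteq> p ` {0..}"
    using arclen_time_nonneg by (auto simp: arclen_param_def)
  show "p ` {0..} \<subseteq> arclen_param p ` {0..}"
  proof
    fix y assume "y \<in> p ` {0..}"
    then obtain t where "0 \<le> t" "y = arclen_param p (arclen p t)"
      using arclen_param_arclen by fastforce
    then show "y \<in> arclen_param p ` {0..}" by auto
  qed
qed

text \<open>Between the arrivals at the levels i * h and (i + 1) * h at most length h is travelled,
  so the path stays within h of its position at level i and the hypothesis on C applies on that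
  whole time interval. Adding up over these disjoint time intervals compares the reparametrized path
  with the original one without a change of variables.\<close>

lemma arclen_param_riemann_sum_le:
  fixes c :: "real \<Rightarrow> ennreal"
  assumes c[measurable]: "c \<in> borel_measurable (lebesgue_on {0..})" and h: "0 \<le> h" and C: "\<And>i. 0 \<le> C i"
    and le: "\<And>i t. 0 \<le> t \<Longrightarrow> norm (p t - arclen_param p (real i * h)) \<le> h \<Longrightarrow> ennreal (C i) \<le> c t"
  shows "(\<Sum>i<K. ennreal (C i * norm (arclen_param p (real (Suc i) * h) - arclen_param p (real i * h))))
     \<le> (\<integral>\<^sup>+t. c t * ennreal (speed p t) \<partial>lebesgue_on {0..})"
proof -
  define \<tau> where "\<tau> i = arclen_time p (real i * h)" for i
  have \<tau>0: "0 \<le> \<tau> i" for i using arclen_time_nonneg by (simp add: \<tau>_def)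
  have \<tau>m: "\<tau> i \<le> \<tau> (Suc i)" for i
    unfolding \<tau>_def using h by (intro arclen_time_mono) (simp add: algebra_simps)
  have "(\<Sum>i<K. ennreal (C i * norm (p (\<tau> (Suc i)) - p (\<tau> i))))
     \<le> (\<integral>\<^sup>+t\<in>{0..<\<tau> K}. c t * ennreal (speed p t) \<partial>lebesgue_on {0..})"
  proof (induction K)
    case (Suc K)
    have "ennreal (C K * norm (p (\<tau> (Suc K)) - p (\<tau> K))) \<le> ennreal (C K) * (\<integral>\<^sup>+t\<in>{\<tau> K..<\<tau> (Suc K)}. ennreal (speed p t) \<partial>lebesgue_on {0..})"
      using C norm_diff_le_integral_Ico[OF \<tau>0 \<tau>m, of K] by (simp add: ennreal_mult mult_left_mono)
    also have "\<dots> = (\<integral>\<^sup>+t. ennreal (C K) * (ennreal (speed p t) * indicator {\<tau> K..<\<tau> (Suc K)} t) \<partial>lebesgue_on {0..})"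
      using \<tau>0 by (intro nn_integral_cmult[symmetric]) auto
    also have "\<dots> \<le> (\<integral>\<^sup>+t\<in>{\<tau> K..<\<tau> (Suc K)}. c t * ennreal (speed p t) \<partial>lebesgue_on {0..})"
    proof (rule nn_integral_mono)
      fix t
      have "ennreal (C K) \<le> c t" if t: "\<tau> K \<le> t" "t < \<tau> (Suc K)"
      proof (rule le)
        show t0: "0 \<le> t" using t \<tau>0[of K] by simp
        have "arclen p t \<le> arclen p (\<tau> (Suc K))" using t t0 by (intro arclen_mono) auto
        also have "\<dots> = min (real (Suc K) * h) (total_len p)"
          using h by (simp add: \<tau>_def arclen_arclen_time)
        also have "\<dots> \<le> min (real K * h) (total_len p) + h"
          using h by (simp add: algebra_simps min_def)
        also have "\<dots> = arclen p (\<tau> K) + h"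
          using h by (simp add: \<tau>_def arclen_arclen_time)
        finally show "norm (p t - arclen_param p (real K * h)) \<le> h"
          using norm_diff_le_arclen[OF \<tau>0 t(1)] by (simp add: arclen_param_def \<tau>_def)
      qed
      then show "ennreal (C K) * (ennreal (speed p t) * indicator {\<tau> K..<\<tau> (Suc K)} t)
          \<le> c t * ennreal (speed p t) * indicator {\<tau> K..<\<tau> (Suc K)} t"
        by (auto simp: indicator_def intro!: mult_right_mono)
    qed
    finally have "(\<Sum>i<Suc K. ennreal (C i * norm (p (\<tau> (Suc i)) - p (\<tau> i))))
      \<le> (\<integral>\<^sup>+t\<in>{0..<\<tau> K}. c t * ennreal (speed p t) \<partial>lebesgue_on {0..}) + (\<integral>\<^sup>+t\<in>{\<tau> K..<\<tau> (Suc K)}. c t * ennreal (speed p t) \<partial>lebesgue_on {0..})"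
      using Suc by (simp add: add_mono)
    also have "\<dots> = (\<integral>\<^sup>+t. (c t * ennreal (speed p t) * indicator {0..<\<tau> K} t + c t * ennreal (speed p t) * indicator {\<tau> K..<\<tau> (Suc K)} t) \<partial>lebesgue_on {0..})"
      using \<tau>0 by (intro nn_integral_add[symmetric]) auto
    also have "\<dots> = (\<integral>\<^sup>+t\<in>{0..<\<tau> (Suc K)}. c t * ennreal (speed p t) \<partial>lebesgue_on {0..})"
      using \<tau>0[of K] \<tau>m[of K] by (intro nn_integral_cong) (auto simp: indicator_def)
    finally show ?case .
  qed simp
  also have "\<dots> \<le> (\<integral>\<^sup>+t. c t * ennreal (speed p t) \<partial>lebesgue_on {0..})"
    by (intro nn_integral_mono) (auto simp: indicator_def)
  finally show ?thesis by (simp add: \<tau>_def arclen_param_def)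
qed

text \<open>A formula for arc length in terms of countably many values of p, from which its
  measurability in a parameter follows. One inequality is \<open>weighted_length_le_liminf\<close>
  with an indicator as weight; for the other, chords are shorter than arcs and the sum runs at most
  one mesh width past t.\<close>

lemma arclen_eq_liminf:
  assumes t: "0 \<le> t"
  shows "ennreal (arclen p t) = liminf (\<lambda>N. \<Sum>i<N * 2 ^ N. ennreal (indicator {..<t} (real i / 2 ^ N) *
      norm (p (real (Suc i) / 2 ^ N) - p (real i / 2 ^ N))))"
proof (rule antisym)
  have dyadic: "(\<lambda>N. real (nat \<lfloor>2 ^ N * u\<rfloor>) / 2 ^ N) \<longlonglongrightarrow> u" if "0 \<le> u" for u
    using dyadic_floor_tendsto[of u] that by (simp add: of_nat_nat)
  have "(\<integral>\<^sup>+u. indicator {..<t} u * ennreal (speed p u) \<partial>lebesgue_on {0..}) \<le>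
     liminf (\<lambda>N. \<Sum>i<N * 2 ^ N. ennreal (indicator {..<t} (real i / 2 ^ N) *
      norm (p (real (Suc i) / 2 ^ N) - p (real i / 2 ^ N))))"
  proof (rule weighted_length_le_liminf[OF lip, where C="\<lambda>N. indicator {..<t}"])
    show "AE u in lebesgue_on {0..}. (\<lambda>N. ennreal (indicator {..<t} (real (nat \<lfloor>2 ^ N * u\<rfloor>) / 2 ^ N))) \<longlonglongrightarrow> indicator {..<t} u"
    proof (rule AE_lebesgue_on_negligible[of "{t}"])
      fix u :: real assume u: "u \<in> {0..}" "u \<notin> {t}"
      have *: "(\<lambda>N. real (nat \<lfloor>2 ^ N * u\<rfloor>) / 2 ^ N) \<longlonglongrightarrow> u" using dyadic u by auto
      show "(\<lambda>N. ennreal (indicator {..<t} (real (nat \<lfloor>2 ^ N * u\<rfloor>) / 2 ^ N))) \<longlonglongrightarrow> indicator {..<t} u"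
      proof (cases "u < t")
        case True
        from order_tendstoD(2)[OF * True] show ?thesis
          by (intro tendsto_eventually) (auto elim!: eventually_mono simp: True)
      next
        case False
        with u have "t < u" by auto
        from order_tendstoD(1)[OF * this] show ?thesis
          by (intro tendsto_eventually) (use False in \<open>auto elim!: eventually_mono\<close>)
      qed
    qed auto
  qed simp
  moreover have "(\<integral>\<^sup>+u. indicator {..<t} u * ennreal (speed p u) \<partial>lebesgue_on {0..}) = ennreal (arclen p t)"
    using integral_speed_Ico(1)[of 0 t] t
    by (subst nn_integral_cong[where v="\<lambda>u. ennreal (speed p u) * indicator {0..<t} u"]) (auto simp: indicator_def)
  ultimately show "ennreal (arclen p t) \<le> liminf (\<lambda>N. \<Sum>i<N * 2 ^ N. ennreal (indicator {..<t} (real i / 2 ^ N) *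
      norm (p (real (Suc i) / 2 ^ N) - p (real i / 2 ^ N))))" by simp
next
  \<comment> \<open>The truncation point t + (1/2) ^ N accounts for the last interval, which starts
    before t and may end after it.\<close>
  have sum_le: "(\<Sum>i<K. ennreal (indicator {..<t} (real i / 2 ^ N) * norm (p (real (Suc i) / 2 ^ N) - p (real i / 2 ^ N))))
     \<le> ennreal (arclen p (min (real K / 2 ^ N) (t + (1/2) ^ N)))" for K N
  proof (induction K)
    case 0
    then show ?case using t by (simp add: min_def)
  next
    case (Suc K)
    show ?case
    proof (cases "real K / 2 ^ N < t")
      case True
      then have eq: "min (real K / 2 ^ N) (t + (1/2) ^ N) = real K / 2 ^ N"
        "min (real (Suc K) / 2 ^ N) (t + (1/2) ^ N) = real (Suc K) / 2 ^ N"
        by (auto simp: field_simps min_def)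
      have "(\<Sum>i<Suc K. ennreal (indicator {..<t} (real i / 2 ^ N) * norm (p (real (Suc i) / 2 ^ N) - p (real i / 2 ^ N))))
        \<le> ennreal (arclen p (real K / 2 ^ N)) + ennreal (arclen p (real (Suc K) / 2 ^ N) - arclen p (real K / 2 ^ N))"
        using Suc True eq norm_diff_le_arclen[of "real K / 2 ^ N" "real (Suc K) / 2 ^ N"]
        by (auto intro!: add_mono ennreal_leI simp: divide_right_mono)
      also have "\<dots> = ennreal (arclen p (real (Suc K) / 2 ^ N))"
        using arclen_mono[of "real K / 2 ^ N" "real (Suc K) / 2 ^ N"]
        by (subst ennreal_plus[symmetric]) (auto simp: divide_right_mono)
      finally show ?thesis by (simp only: eq)
    next
      case False
      then have "(\<Sum>i<Suc K. ennreal (indicator {..<t} (real i / 2 ^ N) * norm (p (real (Suc i) / 2 ^ N) - p (real i / 2 ^ N))))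
        \<le> ennreal (arclen p (min (real K / 2 ^ N) (t + (1/2) ^ N)))"
        using Suc by simp
      also have "\<dots> \<le> ennreal (arclen p (min (real (Suc K) / 2 ^ N) (t + (1/2) ^ N)))"
        using t by (intro ennreal_leI arclen_mono) (auto simp: min_def divide_right_mono field_simps)
      finally show ?thesis .
    qed
  qed
  have "liminf (\<lambda>N. \<Sum>i<N * 2 ^ N. ennreal (indicator {..<t} (real i / 2 ^ N) *
      norm (p (real (Suc i) / 2 ^ N) - p (real i / 2 ^ N)))) \<le> liminf (\<lambda>N. ennreal (arclen p t + (1/2) ^ N))"
  proof (intro Liminf_mono always_eventually allI order_trans[OF sum_le] ennreal_leI)
    fix N
    have "arclen p (min (real (N * 2 ^ N) / 2 ^ N) (t + (1/2) ^ N)) \<le> arclen p (t + (1/2) ^ N)"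
      using t by (intro arclen_mono) auto
    also have "\<dots> \<le> arclen p t + (1/2) ^ N"
      using arclen_diff_le[of t "t + (1/2) ^ N"] t by simp
    finally show "arclen p (min (real (N * 2 ^ N) / 2 ^ N) (t + (1/2) ^ N)) \<le> arclen p t + (1/2) ^ N" .
  qed
  also have "\<dots> = ennreal (arclen p t)"
  proof (rule lim_imp_Liminf)
    have "(\<lambda>N. arclen p t + (1/2) ^ N) \<longlonglongrightarrow> arclen p t + 0"
      by (intro tendsto_intros LIMSEQ_power_zero) simp
    then show "(\<lambda>N. ennreal (arclen p t + (1/2) ^ N)) \<longlonglongrightarrow> ennreal (arclen p t)"
      by (intro tendsto_ennrealI) simp
  qed simp
  finally show "liminf (\<lambda>N. \<Sum>i<N * 2 ^ N. ennreal (indicator {..<t} (real i / 2 ^ N) *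
      norm (p (real (Suc i) / 2 ^ N) - p (real i / 2 ^ N)))) \<le> ennreal (arclen p t)" .
qed

end

text \<open>The arrival time at level s is approximated from above by the first dyadic time at which
  the level is reached. That time takes countably many values, so evaluating the path there is
  measurable, and these values converge to \<open>arclen_param\<close>.\<close>

lemma
  fixes p :: "'b \<Rightarrow> real \<Rightarrow> 'a::euclidean_space"
  assumes path: "\<And>x. x \<in> space M \<Longrightarrow> stopped_path (p x) (T x)"
    and meas: "\<And>t. 0 \<le> t \<Longrightarrow> (\<lambda>x. p x t) \<in> borel_measurable M"
  shows borel_measurable_total_len: "(\<lambda>x. total_len (p x)) \<in> borel_measurable M"
    and borel_measurable_arclen_param: "0 \<le> s \<Longrightarrow> (\<lambda>x. arclen_param (p x) s) \<in> borel_measurable M"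
proof -
  have m[measurable]: "(\<lambda>x. arclen (p x) t) \<in> borel_measurable M" if t: "0 \<le> t" for t
  proof -
    have [measurable]: "(\<lambda>x. p x (real i / 2 ^ N)) \<in> borel_measurable M" for i and N :: nat
      by (rule meas) simp
    have *: "(\<lambda>x. enn2real (liminf (\<lambda>N. \<Sum>i<N * 2 ^ N. ennreal (indicator {..<t} (real i / 2 ^ N) *
      norm (p x (real (Suc i) / 2 ^ N) - p x (real i / 2 ^ N)))))) \<in> borel_measurable M"
      by measurable
    show ?thesis
    proof (rule measurable_cong[THEN iffD2, OF _ *])
      fix x assume "x \<in> space M"
      from stopped_path.arclen_eq_liminf[OF path[OF this] t, symmetric]
      show "arclen (p x) t = enn2real (liminf (\<lambda>N. \<Sum>i<N * 2 ^ N. ennreal (indicator {..<t} (real i / 2 ^ N) *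
          norm (p x (real (Suc i) / 2 ^ N) - p x (real i / 2 ^ N)))))"
        by (simp only: enn2real_ennreal arclen_nonneg)
    qed
  qed
  show mt[measurable]: "(\<lambda>x. total_len (p x)) \<in> borel_measurable M"
  proof (rule borel_measurable_LIMSEQ_real)
    show "(\<lambda>x. arclen (p x) (real n)) \<in> borel_measurable M" for n by (rule m) simp
    fix x assume x: "x \<in> space M"
    obtain n where "T x \<le> real n" using real_arch_simple by blast
    then show "(\<lambda>n. arclen (p x) (real n)) \<longlonglongrightarrow> total_len (p x)"
      by (intro tendsto_eventually eventually_sequentiallyI[of n])
         (simp add: stopped_path.arclen_eq_total_len[OF path[OF x]])
  qed
  show "(\<lambda>x. arclen_param (p x) s) \<in> borel_measurable M" if s: "0 \<le> s"
  proof (rule borel_measurable_LIMSEQ_metric)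
    define j where "j m x = (LEAST i. min s (total_len (p x)) \<le> arclen (p x) (real i / 2 ^ m))" for m :: nat and x
    have [measurable]: "(\<lambda>x. arclen (p x) (real i / 2 ^ m)) \<in> borel_measurable M" for i and m :: nat
      by (rule m) simp
    have [measurable]: "j m \<in> measurable M (count_space UNIV)" for m
      unfolding j_def by measurable
    show "(\<lambda>x. p x (real (j m x) / 2 ^ m)) \<in> borel_measurable M" for m
      by (rule measurable_compose_countable[where f="\<lambda>i x. p x (real i / 2 ^ m)" and g="j m"])
         (auto intro: meas)
    fix x assume x: "x \<in> space M"
    interpret stopped_path "p x" "T x" by (rule path[OF x])
    have bound: "dist (p x (real (j m x) / 2 ^ m)) (arclen_param (p x) s) \<le> (1/2) ^ m" for m
    proof -
      define u where "u = min s (total_len (p x))"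
      define k where "k = j m x"
      have ex: "u \<le> arclen (p x) (real i / 2 ^ m)" if "T x * 2 ^ m \<le> real i" for i
        using arclen_eq_total_len[of "real i / 2 ^ m"] that by (simp add: u_def field_simps)
      obtain i :: nat where "T x * 2 ^ m \<le> real i" using real_arch_simple by blast
      from ex[OF this] have k: "u \<le> arclen (p x) (real k / 2 ^ m)"
        unfolding k_def j_def u_def by (rule LeastI)
      \<comment> \<open>The preceding dyadic time has not yet reached the level, and during one mesh
        width the length grows by at most 2^(-m).\<close>
      have kle: "arclen (p x) (real k / 2 ^ m) \<le> u + (1/2) ^ m"
      proof (cases k)
        case 0
        then show ?thesis using s by (simp add: u_def)
      next
        case (Suc l)
        then have "\<not> u \<le> arclen (p x) (real l / 2 ^ m)"
          using not_less_Least[of l "\<lambda>i. min s (total_len (p x)) \<le> arclen (p x) (real i / 2 ^ m)"]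
          by (simp add: k_def j_def u_def)
        moreover have "arclen (p x) (real k / 2 ^ m) \<le> arclen (p x) (real l / 2 ^ m) + (1/2) ^ m"
          using arclen_diff_le[of "real l / 2 ^ m" "real k / 2 ^ m"] Suc
          by (simp add: add_divide_distrib power_one_over divide_right_mono)
        ultimately show ?thesis by simp
      qed
      have le: "arclen_time (p x) s \<le> real k / 2 ^ m"
        using k by (intro arclen_time_le) (auto simp: u_def)
      show ?thesis
        using norm_diff_le_arclen[OF arclen_time_nonneg le] arclen_arclen_time[OF s] kle
        by (simp add: dist_norm arclen_param_def k_def u_def)
    qed
    show "(\<lambda>m. p x (real (j m x) / 2 ^ m)) \<longlonglongrightarrow> arclen_param (p x) s"
    proof (subst tendsto_dist_iff, rule Lim_null_comparison)
      show "\<forall>\<^sub>F m in sequentially. norm (dist (p x (real (j m x) / 2 ^ m)) (arclen_param (p x) s)) \<le> (1/2) ^ m"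
        using bound by simp
      show "(\<lambda>m. (1/2::real) ^ m) \<longlonglongrightarrow> 0" by (rule LIMSEQ_power_zero) simp
    qed
  qed
qed

section \<open>A Skorokhod representation for countable families\<close>

text \<open>Binary expansions jump at dyadic points, so digit sequences are stored as ternary digits
  0 and 1 instead. The digits after any position then contribute at most half a unit of that
  position, which leaves a gap between different digits.\<close>

definition cantor_code :: "(nat \<Rightarrow> bool) \<Rightarrow> real" where
  "cantor_code B = (\<Sum>m. of_bool (B m) / 3 ^ Suc m)"

definition cantor_digit :: "nat \<Rightarrow> real \<Rightarrow> bool" where
  "cantor_digit m c \<longleftrightarrow> \<lfloor>3 ^ Suc m * c\<rfloor> mod 3 = 1"

(* On this set floor (3 ^ m * c) is locally constant in c, so that the digits converge whenever c does. *)
definition cantor_range :: "real set" where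
  "cantor_range = {c. \<forall>m. frac (3 ^ m * c) \<le> 1 / 2}"

definition binary_value :: "(nat \<Rightarrow> bool) \<Rightarrow> real" where
  "binary_value B = (\<Sum>l. of_bool (B l) / 2 ^ Suc l)"

lemma summable_cantor_code: "summable (\<lambda>m. of_bool (B m) / (3::real) ^ Suc m)"
proof (rule summable_comparison_test')
  show "summable (\<lambda>m. (1/3::real) ^ Suc m)" by (intro summable_Suc_iff[THEN iffD2] summable_geometric) simp
  show "norm (of_bool (B m) / (3::real) ^ Suc m) \<le> (1/3) ^ Suc m" for m
    by (simp add: power_one_over)
qed

lemma cantor_code_bounds: "0 \<le> cantor_code B" "cantor_code B \<le> 1 / 2"
proof -
  show "0 \<le> cantor_code B"
    unfolding cantor_code_def by (intro suminf_nonneg summable_cantor_code) simp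
  have s: "(\<lambda>m. (1/3::real) * (1/3) ^ m) sums (1 / 3 * (1 / (1 - 1/3)))"
    by (intro sums_mult geometric_sums) simp
  have "cantor_code B \<le> (\<Sum>m. (1/3::real) * (1/3) ^ m)"
    unfolding cantor_code_def
    by (intro suminf_le summable_cantor_code sums_summable[OF s]) (simp add: power_one_over)
  also have "\<dots> = 1 / 2" using sums_unique[OF s] by simp
  finally show "cantor_code B \<le> 1 / 2" .
qed

lemma cantor_code_rec: "3 * cantor_code B = of_bool (B 0) + cantor_code (\<lambda>m. B (Suc m))"
proof -
  have "cantor_code B = of_bool (B 0) / 3 + (\<Sum>m. of_bool (B (Suc m)) / 3 ^ Suc (Suc m))"
    unfolding cantor_code_def using suminf_split_head[OF summable_cantor_code[of B]] by simp
  also have "(\<Sum>m. of_bool (B (Suc m)) / 3 ^ Suc (Suc m)) = (\<Sum>m. (1/3) * (of_bool (B (Suc m)) / (3::real) ^ Suc m))"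
    by simp
  also have "\<dots> = 1/3 * cantor_code (\<lambda>m. B (Suc m))"
    unfolding cantor_code_def by (rule suminf_mult[OF summable_cantor_code])
  finally show ?thesis by simp
qed

text \<open>Multiplication by 3 ^ m moves the first m digits into the integer k. What remains is
  again a code, hence in [0, 1/2], and this yields both the decoding of digits and membership in
  \<open>cantor_range\<close>.\<close>

lemma cantor_code_shift: "\<exists>k::int. 3 ^ m * cantor_code B = of_int k + cantor_code (\<lambda>j. B (j + m))"
proof (induction m)
  case 0
  show ?case by (rule exI[of _ 0]) simp
next
  case (Suc m)
  then obtain k where k: "3 ^ m * cantor_code B = of_int k + cantor_code (\<lambda>j. B (j + m))" by blast
  have "3 ^ Suc m * cantor_code B = 3 * of_int k + (of_bool (B m) + cantor_code (\<lambda>j. B (j + Suc m)))"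
    using cantor_code_rec[of "\<lambda>j. B (j + m)"] k by (simp add: algebra_simps)
  then show ?case
    by (intro exI[of _ "3 * k + of_bool (B m)"]) simp
qed

lemma cantor_digit_code: "cantor_digit m (cantor_code B) = B m"
proof -
  obtain k where k: "3 ^ m * cantor_code B = of_int k + cantor_code (\<lambda>j. B (j + m))"
    using cantor_code_shift by blast
  have "3 ^ Suc m * cantor_code B = of_int (3 * k + of_bool (B m)) + cantor_code (\<lambda>j. B (j + Suc m))"
    using cantor_code_rec[of "\<lambda>j. B (j + m)"] k by (simp add: algebra_simps)
  moreover have "\<lfloor>cantor_code (\<lambda>j. B (j + Suc m))\<rfloor> = 0"
    using cantor_code_bounds[of "\<lambda>j. B (j + Suc m)"] by (simp add: floor_eq_iff)
  ultimately have "\<lfloor>3 ^ Suc m * cantor_code B\<rfloor> = 3 * k + of_bool (B m)"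
    by (metis add.right_neutral int_add_floor)
  then show ?thesis by (simp add: cantor_digit_def)
qed

lemma cantor_code_in_range: "cantor_code B \<in> cantor_range"
proof -
  have "frac (3 ^ m * cantor_code B) \<le> 1 / 2" for m
  proof -
    obtain k where k: "3 ^ m * cantor_code B = of_int k + cantor_code (\<lambda>j. B (j + m))"
      using cantor_code_shift by blast
    have "frac (cantor_code (\<lambda>j. B (j + m))) = cantor_code (\<lambda>j. B (j + m))"
      using cantor_code_bounds[of "\<lambda>j. B (j + m)"] by (simp add: frac_eq)
    then show ?thesis using cantor_code_bounds(2)[of "\<lambda>j. B (j + m)"] by (simp add: k)
  qed
  then show ?thesis by (simp add: cantor_range_def)
qed

lemma measurable_cantor_digit[measurable]: "cantor_digit m \<in> measurable borel (count_space UNIV)"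
  unfolding cantor_digit_def[abs_def] by measurable

lemma sets_cantor_range[measurable]: "cantor_range \<in> sets borel"
  unfolding cantor_range_def frac_def by measurable

lemma measurable_cantor_code:
  assumes [measurable]: "\<And>m. (\<lambda>x. B x m) \<in> measurable M (count_space UNIV)"
  shows "(\<lambda>x. cantor_code (B x)) \<in> borel_measurable M"
  unfolding cantor_code_def of_bool_def by measurable

text \<open>After scaling by 3 ^ Suc m, fractional parts are at most 1/2, so points with different
  floors are at least 1/2 apart. The Cauchy property brings the scaled points closer than
  1/4.\<close>

lemma eventually_cantor_digit_const:
  assumes c: "\<And>n. c n \<in> cantor_range" and lim: "convergent c"
  shows "\<exists>d. \<forall>\<^sub>F n in sequentially. cantor_digit m (c n) = d"
proof -
  have "Cauchy c" using lim by (rule convergent_Cauchy)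
  from CauchyD[OF this, of "1 / (4 * 3 ^ Suc m)"]
  obtain N where N: "\<And>n k. N \<le> n \<Longrightarrow> N \<le> k \<Longrightarrow> \<bar>c n - c k\<bar> < 1 / (4 * 3 ^ Suc m)"
    by auto
  have "\<lfloor>3 ^ Suc m * c n\<rfloor> = \<lfloor>3 ^ Suc m * c N\<rfloor>" if "N \<le> n" for n
  proof -
    have "\<bar>3 ^ Suc m * c n - 3 ^ Suc m * c N\<bar> = 3 ^ Suc m * \<bar>c n - c N\<bar>"
      by (simp add: abs_mult flip: right_diff_distrib)
    also have "\<dots> < 3 ^ Suc m * (1 / (4 * 3 ^ Suc m))"
      using N[OF that, of N] by (intro mult_strict_left_mono) auto
    finally have d: "\<bar>3 ^ Suc m * c n - 3 ^ Suc m * c N\<bar> < 1 / 4" by simp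
    have f: "frac (3 ^ Suc m * c k) \<le> 1 / 2" for k
      using c[of k] unfolding cantor_range_def by (simp only: mem_Collect_eq)
    have close: "k = l" if "\<bar>x - y\<bar> < 1 / 4" "x - of_int k \<le> 1 / 2" "y - of_int l \<le> 1 / 2"
      "0 \<le> x - of_int k" "0 \<le> y - of_int l" for x y :: real and k l :: int
    proof -
      have "real_of_int k < of_int (l + 1)" "real_of_int l < of_int (k + 1)" unfolding of_int_add of_int_1 using that by linarith+
      then show "k = l" unfolding of_int_less_iff by simp
    qed
    show ?thesis
      by (rule close[OF d f[unfolded frac_def] f[unfolded frac_def] frac_ge_0[unfolded frac_def] frac_ge_0[unfolded frac_def]])
  qed
  then have "cantor_digit m (c n) = cantor_digit m (c N)" if "N \<le> n" for n
    unfolding cantor_digit_def using that by metis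
  then show ?thesis unfolding eventually_sequentially by blast
qed

lemma binary_value_digits:
  assumes "0 \<le> x" "x < 1" shows "binary_value (\<lambda>l. odd \<lfloor>2 ^ Suc l * x\<rfloor>) = x"
proof -
  have floor_double: "\<lfloor>2 * y\<rfloor> = 2 * \<lfloor>y\<rfloor> + of_bool (odd \<lfloor>2 * y\<rfloor>)" for y :: real
  proof -
    define k where "k = \<lfloor>y\<rfloor>"
    have k: "of_int k \<le> y" "y < of_int k + 1" unfolding k_def by linarith+
    show ?thesis
    proof (cases "y < of_int k + 1 / 2")
      case True
      then have "\<lfloor>2 * y\<rfloor> = 2 * k" using k by (intro floor_unique) auto
      then show ?thesis by (simp flip: k_def)
    next
      case False
      then have "\<lfloor>2 * y\<rfloor> = 2 * k + 1" using k by (intro floor_unique) auto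
      then show ?thesis by (simp flip: k_def)
    qed
  qed
  have part: "(\<Sum>l<L. of_bool (odd \<lfloor>2 ^ Suc l * x\<rfloor>) / 2 ^ Suc l) = of_int \<lfloor>2 ^ L * x\<rfloor> / (2::real) ^ L" for L
  proof (induction L)
    case 0
    then show ?case using assms by (simp add: floor_eq_iff)
  next
    case (Suc L)
    have *: "real_of_int \<lfloor>2 ^ Suc L * x\<rfloor> = 2 * of_int \<lfloor>2 ^ L * x\<rfloor> + of_bool (odd \<lfloor>2 ^ Suc L * x\<rfloor>)"
    proof -
      have "2 * (2 ^ L * x) = 2 ^ Suc L * x" by simp
      then have "\<lfloor>2 ^ Suc L * x\<rfloor> = 2 * \<lfloor>2 ^ L * x\<rfloor> + of_bool (odd \<lfloor>2 ^ Suc L * x\<rfloor>)"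
        using floor_double[of "2 ^ L * x"] by (simp only:)
      then have "real_of_int \<lfloor>2 ^ Suc L * x\<rfloor> = real_of_int (2 * \<lfloor>2 ^ L * x\<rfloor> + of_bool (odd \<lfloor>2 ^ Suc L * x\<rfloor>))"
        by (rule arg_cong)
      also have "\<dots> = 2 * of_int \<lfloor>2 ^ L * x\<rfloor> + of_bool (odd \<lfloor>2 ^ Suc L * x\<rfloor>)"
        unfolding of_int_add of_int_mult of_int_of_bool by simp
      finally show ?thesis .
    qed
    have "(\<Sum>l<Suc L. of_bool (odd \<lfloor>2 ^ Suc l * x\<rfloor>) / 2 ^ Suc l)
        = of_int \<lfloor>2 ^ L * x\<rfloor> / (2::real) ^ L + of_bool (odd \<lfloor>2 ^ Suc L * x\<rfloor>) / 2 ^ Suc L"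
      unfolding sum.lessThan_Suc Suc.IH ..
    also have "\<dots> = (2 * of_int \<lfloor>2 ^ L * x\<rfloor> + of_bool (odd \<lfloor>2 ^ Suc L * x\<rfloor>)) / 2 ^ Suc L"
      unfolding add_divide_distrib by simp
    finally show ?case unfolding * .
  qed
  from dyadic_floor_tendsto[of x]
  have "(\<lambda>l. of_bool (odd \<lfloor>2 ^ Suc l * x\<rfloor>) / (2::real) ^ Suc l) sums x"
    unfolding sums_def part .
  then show ?thesis unfolding binary_value_def by (rule sums_unique[symmetric])
qed

text \<open>Tannery's theorem, that is, dominated convergence for series with the majorant 2^(-l -
  1). The limit digits need not be the canonical expansion of the limit.\<close>

lemma convergent_binary_value:
  assumes "\<And>l. \<exists>d. \<forall>\<^sub>F n in sequentially. B n l = d"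
  shows "convergent (\<lambda>n. binary_value (B n))"
proof -
  obtain D where D: "\<And>l. \<forall>\<^sub>F n in sequentially. B n l = D l"
    using assms by metis
  have lim: "(\<lambda>n. of_bool (B n l) / (2::real) ^ Suc l) \<longlonglongrightarrow> of_bool (D l) / 2 ^ Suc l" for l
    using D[of l] by (intro tendsto_eventually) (auto elim!: eventually_mono)
  have sum: "summable (\<lambda>l. (1/2::real) ^ Suc l)"
    by (intro summable_Suc_iff[THEN iffD2] summable_geometric) simp
  have bound: "\<forall>\<^sub>F (l, n) in at_top \<times>\<^sub>F sequentially. norm (of_bool (B n l) / (2::real) ^ Suc l) \<le> (1/2) ^ Suc l"
    by (intro always_eventually) (auto simp: power_one_over)
  have "(\<lambda>n. \<Sum>l. of_bool (B n l) / (2::real) ^ Suc l) \<longlonglongrightarrow> (\<Sum>l. of_bool (D l) / 2 ^ Suc l)"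
    using tannerys_theorem[OF lim bound sum] by simp
  then show ?thesis unfolding binary_value_def convergent_def by blast
qed

section \<open>Coding a bounded countable family of vectors by one real number\<close>

context
  fixes R :: "'i::countable \<Rightarrow> real"
begin

text \<open>The number m encodes a member i of the family, a coordinate k and the position l of a
  binary digit. The affine map sends [- R i, R i] strictly inside (0, 1), also for R i = 0, so that
  \<open>binary_value_digits\<close> applies.\<close>

definition family_digits :: "('i \<Rightarrow> 'a::euclidean_space) \<Rightarrow> nat \<Rightarrow> bool" where
  "family_digits z m = (case from_nat m of (i, k, l) \<Rightarrow>
     odd \<lfloor>2 ^ Suc l * ((z i \<bullet> from_nat_into Basis k + R i + 1) / (2 * R i + 3))\<rfloor>)"

definition family_decode :: "real \<Rightarrow> 'i \<Rightarrow> 'a::euclidean_space" where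
  "family_decode c i = (\<Sum>b\<in>Basis. ((2 * R i + 3) *
     binary_value (\<lambda>l. cantor_digit (to_nat (i, to_nat_on (Basis :: 'a set) b, l)) c) - R i - 1) *\<^sub>R b)"

lemma family_decode_code:
  fixes z :: "'i \<Rightarrow> 'a::euclidean_space"
  assumes z: "\<And>i. norm (z i) \<le> R i"
  shows "family_decode (cantor_code (family_digits z)) = z"
proof
  fix i
  have val: "binary_value (\<lambda>l. cantor_digit (to_nat (i, to_nat_on (Basis :: 'a set) b, l)) (cantor_code (family_digits z)))
      = (z i \<bullet> b + R i + 1) / (2 * R i + 3)" if b: "b \<in> Basis" for b
  proof -
    have R: "0 \<le> R i" using z[of i] norm_ge_zero order_trans by blast
    have "\<bar>z i \<bullet> b\<bar> \<le> R i" using Basis_le_norm[OF b, of "z i"] z[of i] by simp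
    then have "0 \<le> (z i \<bullet> b + R i + 1) / (2 * R i + 3)" "(z i \<bullet> b + R i + 1) / (2 * R i + 3) < 1"
      using R by (auto simp: field_simps abs_le_iff)
    from binary_value_digits[OF this] show ?thesis
      using b by (simp add: cantor_digit_code family_digits_def countable_finite)
  qed
  have "family_decode (cantor_code (family_digits z)) i = (\<Sum>b\<in>Basis. (z i \<bullet> b) *\<^sub>R b)"
    unfolding family_decode_def
  proof (intro sum.cong refl)
    fix b :: 'a assume b: "b \<in> Basis"
    have "0 \<le> R i" using z[of i] norm_ge_zero order_trans by blast
    then have "2 * R i + 3 \<noteq> 0" by linarith
    then show "((2 * R i + 3) * binary_value (\<lambda>l. cantor_digit (to_nat (i, to_nat_on Basis b, l))
         (cantor_code (family_digits z))) - R i - 1) *\<^sub>R b = (z i \<bullet> b) *\<^sub>R b"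
      by (simp add: val[OF b])
  qed
  then show "family_decode (cantor_code (family_digits z)) i = z i"
    by (simp add: euclidean_representation)
qed

lemma measurable_family_code:
  fixes Z :: "'b \<Rightarrow> 'i \<Rightarrow> 'a::euclidean_space"
  assumes [measurable]: "\<And>i. (\<lambda>x. Z x i) \<in> borel_measurable M"
  shows "(\<lambda>x. cantor_code (family_digits (Z x))) \<in> borel_measurable M"
  by (rule measurable_cantor_code) (simp add: family_digits_def split: prod.split)

lemma measurable_family_decode:
  "family_decode \<in> measurable borel (PiM UNIV (\<lambda>_. borel :: 'a::euclidean_space measure))"
proof -
  have "(\<lambda>c. family_decode c i :: 'a) \<in> borel_measurable borel" for i
    unfolding family_decode_def binary_value_def of_bool_def by measurable
  then show ?thesis
    by (intro measurable_PiM_single'[where f="\<lambda>i c. family_decode c i"]) auto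
qed

lemma convergent_family_decode:
  assumes "\<And>n. c n \<in> cantor_range" "convergent c"
  shows "convergent (\<lambda>n. family_decode (c n) i :: 'a::euclidean_space)"
proof -
  have "convergent (\<lambda>n. binary_value (\<lambda>l. cantor_digit (to_nat (i, to_nat_on (Basis :: 'a set) b, l)) (c n)))" for b
    by (rule convergent_binary_value) (rule eventually_cantor_digit_const[OF assms])
  then obtain v where v: "\<And>b. (\<lambda>n. binary_value (\<lambda>l. cantor_digit (to_nat (i, to_nat_on (Basis :: 'a set) b, l)) (c n))) \<longlonglongrightarrow> v b"
    unfolding convergent_def by metis
  have "(\<lambda>n. family_decode (c n) i :: 'a) \<longlonglongrightarrow> (\<Sum>b\<in>Basis. ((2 * R i + 3) * v b - R i - 1) *\<^sub>R b)"
    unfolding family_decode_def by (intro tendsto_intros v)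
  then show ?thesis unfolding convergent_def by blast
qed

end

section \<open>Quantile functions and almost everywhere convergence\<close>

lemma quantile_tendsto:
  assumes \<mu>: "\<And>n. real_distribution (\<mu> n)" and M: "real_distribution M" and lim: "weak_conv_m \<mu> M"
    and \<omega>: "0 < \<omega>" "\<omega> < 1" and cont: "isCont (\<lambda>\<omega>. Inf {x. \<omega> \<le> cdf M x}) \<omega>"
  shows "(\<lambda>n. Inf {x. \<omega> \<le> cdf (\<mu> n) x}) \<longlonglongrightarrow> Inf {x. \<omega> \<le> cdf M x}"
proof -
  interpret \<mu>: cdf_distribution "\<mu> n" for n unfolding cdf_distribution_def by (rule \<mu>)
  interpret M: cdf_distribution M unfolding cdf_distribution_def by (rule M)
  have conv: "(\<lambda>n. cdf (\<mu> n) x) \<longlonglongrightarrow> cdf M x" if "measure M {x} = 0" for x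
    using lim M.isCont_cdf that by (auto simp: weak_conv_m_def weak_conv_def)
  have dense: "\<exists>x. a < x \<and> x < b \<and> measure M {x} = 0" if "a < b" for a b
    using open_minus_countable[OF M.countable_support, of "{a<..<b}"] that by auto
  show ?thesis
  proof (rule order_tendstoI)
    \<comment> \<open>The lower estimate works at every level: points that are not atoms are dense
      because atoms are countable, the distribution functions converge there, and the quantile is a
      pseudoinverse of the distribution function.\<close>
    fix a assume "a < Inf {x. \<omega> \<le> cdf M x}"
    then obtain x where x: "a < x" "x < Inf {x. \<omega> \<le> cdf M x}" "measure M {x} = 0"
      using dense by blast
    then have "cdf M x < \<omega>" using M.pseudoinverse[OF \<omega>, of x] by linarith
    from order_tendstoD(2)[OF conv[OF x(3)] this]
    show "\<forall>\<^sub>F n in sequentially. a < Inf {x. \<omega> \<le> cdf (\<mu> n) x}"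
    proof eventually_elim
      case (elim n)
      then show ?case using \<mu>.pseudoinverse[OF \<omega>, of n x] x(1) by linarith
    qed
  next
    \<comment> \<open>The upper estimate needs a strict inequality between \<omega> and the limit
      distribution function. Continuity of the quantile function at \<omega> supplies it by way of a
      slightly larger level.\<close>
    fix a assume a: "Inf {x. \<omega> \<le> cdf M x} < a"
    from cont have "((\<lambda>\<omega>. Inf {x. \<omega> \<le> cdf M x}) \<longlongrightarrow> Inf {x. \<omega> \<le> cdf M x}) (at_right \<omega>)"
      unfolding isCont_def by (rule tendsto_within_subset) auto
    from order_tendstoD(2)[OF this a] eventually_at_right_less[of \<omega>]
      eventually_at_rightI[of \<omega> 1 "\<lambda>x. x < 1"] \<omega>
    have "\<forall>\<^sub>F \<omega>' in at_right \<omega>. Inf {x. \<omega>' \<le> cdf M x} < a \<and> \<omega> < \<omega>' \<and> \<omega>' < 1"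
      by (auto simp: eventually_conj_iff)
    then obtain \<omega>' where \<omega>': "Inf {x. \<omega>' \<le> cdf M x} < a" "\<omega> < \<omega>'" "\<omega>' < 1"
      using eventually_happens'[OF trivial_limit_at_right_real] by blast
    then obtain x where x: "Inf {x. \<omega>' \<le> cdf M x} < x" "x < a" "measure M {x} = 0"
      using dense by blast
    then have "\<omega>' \<le> cdf M x" using M.pseudoinverse[of \<omega>' x] \<omega>' \<omega> by auto
    then have "\<omega> < cdf M x" using \<omega>' by simp
    from order_tendstoD(1)[OF conv[OF x(3)] this]
    show "\<forall>\<^sub>F n in sequentially. Inf {x. \<omega> \<le> cdf (\<mu> n) x} < a"
    proof eventually_elim
      case (elim n)
      then show ?case using \<mu>.pseudoinverse[OF \<omega>, of n x] x(2) by linarith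
    qed
  qed
qed

text \<open>Dilating (0, 1) to (0, m) transports the quantile construction to the fibre interval and
  multiplies the law by m. At the levels 0 and 1 the infimum may be over an unbounded or empty set,
  so q is set to 0 there.\<close>

lemma distr_rescaled_quantile:
  fixes \<mu> :: "real measure"
  assumes m: "0 < m" and \<mu>: "real_distribution \<mu>"
  defines "q \<equiv> \<lambda>\<theta>. if 0 < \<theta> \<and> \<theta> < m then Inf {x. \<theta> / m \<le> cdf \<mu> x} else 0"
  shows "q \<in> borel_measurable borel"
    and "distr (lebesgue_on {0..m}) borel q = scale_measure (ennreal m) \<mu>"
proof -
  interpret cdf_distribution \<mu> unfolding cdf_distribution_def by (rule \<mu>)
  have I: "(\<lambda>\<omega>. if \<omega> \<in> {0<..<1} then I \<omega> else 0) \<in> borel_measurable borel"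
    using measurable_CI by (subst (asm) measurable_restrict_space_iff) auto
  have q_eq: "q \<theta> = (\<lambda>\<omega>. if \<omega> \<in> {0<..<1} then I \<omega> else 0) (\<theta> / m)" for \<theta>
    using m by (auto simp: q_def field_simps)
  show qm[measurable]: "q \<in> borel_measurable borel"
    unfolding q_eq[abs_def] by (rule measurable_compose[OF _ I]) measurable
  have qm': "q \<in> borel_measurable (lebesgue_on {0..m})"
    by (rule borel_measurable_lebesgue_on_of_borel[OF qm])
  show "distr (lebesgue_on {0..m}) borel q = scale_measure (ennreal m) \<mu>"
  proof (rule measure_eqI)
    fix A assume "A \<in> sets (distr (lebesgue_on {0..m}) borel q)"
    then have A[measurable]: "A \<in> sets borel" by simp
    define S where "S = {\<omega> \<in> {0<..<1}. I \<omega> \<in> A}"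
    have Sm: "S \<in> sets borel"
      using measurable_sets[OF measurable_CI A] by (simp add: S_def space_restrict_space vimage_def Int_def sets_restrict_space_iff conj_commute)
    have "emeasure (distr (lebesgue_on {0..m}) borel q) A = emeasure lebesgue (q -` A \<inter> {0..m})"
      using qm' by (subst emeasure_distr) (auto simp: emeasure_restrict_space)
    also have "\<dots> = emeasure lborel (q -` A \<inter> {0..m})"
      using measurable_sets[OF qm A] by simp
    also have "\<dots> = emeasure lborel (q -` A \<inter> {0<..<m})"
    proof (rule emeasure_eq_AE)
      show "AE x in lborel. (x \<in> q -` A \<inter> {0..m}) = (x \<in> q -` A \<inter> {0<..<m})"
        using AE_lborel_singleton[of 0] AE_lborel_singleton[of m] by eventually_elim auto
    qed (use measurable_sets[OF qm A] in auto)
    also have "q -` A \<inter> {0<..<m} = (\<lambda>\<omega>. m *\<^sub>R \<omega> + 0) ` S"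
    proof safe
      fix \<theta> assume t: "q \<theta> \<in> A" "\<theta> \<in> {0<..<m}"
      then have "\<theta> / m \<in> S" using m by (auto simp: S_def q_def)
      moreover have "\<theta> = m *\<^sub>R (\<theta> / m) + 0" using m by simp
      ultimately show "\<theta> \<in> (\<lambda>\<omega>. m *\<^sub>R \<omega> + 0) ` S" by blast
    qed (use m in \<open>auto simp: S_def q_def\<close>)
    also have "emeasure lborel ((\<lambda>\<omega>. m *\<^sub>R \<omega> + 0) ` S) = emeasure lebesgue ((\<lambda>\<omega>. m *\<^sub>R \<omega> + 0) ` S)"
    proof -
      have "(\<lambda>\<omega>. m *\<^sub>R \<omega> + 0) ` S = (\<lambda>\<theta>. \<theta> / m) -` S \<inter> space borel"
        using m by (force simp: image_iff)
      also have "\<dots> \<in> sets borel" by (rule measurable_sets[OF _ Sm]) measurable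
      finally show ?thesis by simp
    qed
    also have "\<dots> = ennreal m * emeasure lebesgue S"
      using emeasure_lebesgue_affine[of m 0 S] m by simp
    also have "emeasure lebesgue S = emeasure lborel S" using Sm by simp
    also have "emeasure lborel S = emeasure (distr (restrict_space lborel {0<..<1}) borel I) A"
    proof -
      have "I \<in> measurable (restrict_space lborel {0<..<1}) borel"
        using measurable_CI by (simp cong: measurable_cong_sets add: sets_restrict_space)
      then have "emeasure (distr (restrict_space lborel {0<..<1}) borel I) A = emeasure (restrict_space lborel {0<..<1}) S"
        by (simp add: emeasure_distr space_restrict_space S_def vimage_def Int_def conj_commute)
      also have "\<dots> = emeasure lborel S"
        by (rule emeasure_restrict_space) (auto simp: S_def)
      finally show ?thesis by (rule sym)
    qed
    also have "\<dots> = emeasure \<mu> A" by (simp only: distr_I_eq_M)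
    finally show "emeasure (distr (lebesgue_on {0..m}) borel q) A = emeasure (scale_measure (ennreal m) \<mu>) A"
      by simp
  qed simp
qed

text \<open>All codes lie in [0, 1/2], so their laws are tight whatever the family is. Decoding
  inverts coding, which transfers equality of laws from codes to families; on
  \<open>cantor_range\<close> it also turns convergence of codes into convergence of every
  component.\<close>

lemma skorokhod_subsequence:
  fixes Z :: "nat \<Rightarrow> real \<Rightarrow> 'i::countable \<Rightarrow> 'a::euclidean_space"
  assumes m: "0 < m" and meas: "\<And>n i. (\<lambda>\<theta>. Z n \<theta> i) \<in> borel_measurable (lebesgue_on {0..m})"
    and R: "\<And>n \<theta> i. \<theta> \<in> {0..m} \<Longrightarrow> norm (Z n \<theta> i) \<le> R i"
  obtains r Y where "strict_mono (r :: nat \<Rightarrow> nat)"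
    and "\<And>n. Y n \<in> measurable (lebesgue_on {0..m}) (PiM UNIV (\<lambda>_. borel))"
    and "\<And>n. distr (lebesgue_on {0..m}) (PiM UNIV (\<lambda>_. borel)) (Y n) =
         distr (lebesgue_on {0..m}) (PiM UNIV (\<lambda>_. borel)) (Z (r n))"
    and "AE \<theta> in lebesgue_on {0..m}. \<forall>i. convergent (\<lambda>n. Y n \<theta> i)"
proof -
  let ?Q = "lebesgue_on {0..m}"
  define c where "c n \<theta> = cantor_code (family_digits R (Z n \<theta>))" for n \<theta>
  have cm[measurable]: "c n \<in> borel_measurable ?Q" for n
    unfolding c_def by (rule measurable_family_code) (rule meas)
  have dec_c: "family_decode R (c n \<theta>) = Z n \<theta>" if "\<theta> \<in> {0..m}" for n \<theta>
    unfolding c_def by (rule family_decode_code) (use R that in auto)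
  \<comment> \<open>Helly's theorem concerns probability measures, so the mass m is divided out here
    and restored in \<open>\<nu>_scale\<close>.\<close>
  define \<nu> where "\<nu> n = distr (scale_measure (ennreal (1 / m)) ?Q) borel (c n)" for n
  have cm': "c n \<in> borel_measurable (scale_measure (ennreal (1 / m)) ?Q)" for n
    using cm by (simp cong: measurable_cong_sets)
  have spQ: "space ?Q = {0..m}" by (simp add: space_restrict_space)
  have emQ: "emeasure ?Q {0..m} = ennreal m" using m by (simp add: emeasure_restrict_space)
  have prob_scaled: "prob_space (scale_measure (ennreal (1 / m)) ?Q)"
    using m by (intro prob_spaceI) (simp add: space_scale_measure spQ emQ flip: ennreal_mult)
  have \<nu>: "real_distribution (\<nu> n)" for n
    unfolding \<nu>_def real_distribution_def real_distribution_axioms_def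
    using prob_space.prob_space_distr[OF prob_scaled cm'] by simp
  have \<nu>_scale: "scale_measure (ennreal m) (\<nu> n) = distr ?Q borel (c n)" for n
  proof (rule measure_eqI)
    fix A assume "A \<in> sets (scale_measure (ennreal m) (\<nu> n))"
    then have A: "A \<in> sets borel" by (simp add: \<nu>_def)
    have "ennreal m * (ennreal (1 / m) * x) = x" for x
      using m by (simp add: mult.assoc[symmetric] flip: ennreal_mult)
    then show "emeasure (scale_measure (ennreal m) (\<nu> n)) A = emeasure (distr ?Q borel (c n)) A"
      using A cm cm' by (simp add: \<nu>_def emeasure_distr space_scale_measure)
  qed (simp add: \<nu>_def)
  have tight: "tight \<nu>"
    unfolding tight_def
  proof (intro conjI allI impI \<nu>)
    fix e :: real assume "0 < e"
    have "measure (\<nu> n) {-1<..1} = 1" for n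
    proof -
      have "-1 < c n \<theta> \<and> c n \<theta> \<le> 1" for \<theta>
        using cantor_code_bounds[of "family_digits R (Z n \<theta>)"] by (simp add: c_def)
      then have "c n -` {-1<..1} \<inter> space ?Q = space ?Q" by auto
      then show ?thesis
        using cm' prob_space.prob_space[OF prob_scaled] by (simp add: \<nu>_def measure_distr space_scale_measure)
    qed
    then show "\<exists>a b. a < b \<and> (\<forall>n. 1 - e < measure (\<nu> n) {a<..b})"
      using \<open>0 < e\<close> by (intro exI[of _ "-1"] exI[of _ 1]) auto
  qed
  from tight_imp_convergent_subsubsequence[OF tight strict_mono_id]
  obtain r N where r: "strict_mono r" and N: "real_distribution N" and conv: "weak_conv_m (\<nu> \<circ> id \<circ> r) N"
    by blast
  define q where "q \<mu> \<theta> = (if 0 < \<theta> \<and> \<theta> < m then Inf {x. \<theta> / m \<le> cdf \<mu> x} else 0)" for \<mu> \<theta>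
  have qm: "q (\<nu> n) \<in> borel_measurable borel" for n
    unfolding q_def by (rule distr_rescaled_quantile(1)[OF m \<nu>])
  have qm'[measurable]: "q (\<nu> n) \<in> borel_measurable ?Q" for n
    by (rule borel_measurable_lebesgue_on_of_borel[OF qm])
  have q_distr: "distr ?Q borel (q (\<nu> n)) = distr ?Q borel (c n)" for n
    using distr_rescaled_quantile(2)[OF m \<nu>, of n] by (simp add: q_def[abs_def] \<nu>_scale)
  have dm: "family_decode R \<in> measurable borel (PiM UNIV (\<lambda>_::'i. borel :: 'a measure))"
    by (rule measurable_family_decode)
  show thesis
  proof (rule that[OF r, of "\<lambda>n \<theta>. family_decode R (q (\<nu> (r n)) \<theta>)"])
    show "(\<lambda>\<theta>. family_decode R (q (\<nu> (r n)) \<theta>)) \<in> measurable ?Q (PiM UNIV (\<lambda>_::'i. borel :: 'a measure))" for n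
      using measurable_compose[OF qm'[of "r n"] dm] .
    show "distr ?Q (PiM UNIV (\<lambda>_::'i. borel :: 'a measure)) (\<lambda>\<theta>. family_decode R (q (\<nu> (r n)) \<theta>)) =
         distr ?Q (PiM UNIV (\<lambda>_. borel)) (Z (r n))" for n
    proof -
      have "distr ?Q (PiM UNIV (\<lambda>_::'i. borel :: 'a measure)) (\<lambda>\<theta>. family_decode R (q (\<nu> (r n)) \<theta>))
          = distr (distr ?Q borel (q (\<nu> (r n)))) (PiM UNIV (\<lambda>_. borel)) (family_decode R)"
        using distr_distr[OF dm qm'[of "r n"]] by (simp add: comp_def)
      also have "\<dots> = distr ?Q (PiM UNIV (\<lambda>_. borel)) (\<lambda>\<theta>. family_decode R (c (r n) \<theta>))"
        unfolding q_distr using distr_distr[OF dm cm[of "r n"]] by (simp add: comp_def)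
      also have "\<dots> = distr ?Q (PiM UNIV (\<lambda>_. borel)) (Z (r n))"
        by (rule distr_cong) (auto simp: dec_c spQ)
      finally show ?thesis .
    qed
    \<comment> \<open>A quantile function need not produce codes pointwise, but it has the law of
      the codes, and membership in a Borel set can be read off the law.\<close>
    have "AE \<theta> in ?Q. q (\<nu> n) \<theta> \<in> cantor_range" for n
    proof -
      have "AE x in distr ?Q borel (c n). x \<in> cantor_range"
        by (subst AE_distr_iff) (auto simp: c_def cantor_code_in_range)
      then show ?thesis
        unfolding q_distr[symmetric] by (subst (asm) AE_distr_iff) auto
    qed
    then have rng: "AE \<theta> in ?Q. \<forall>n. q (\<nu> n) \<theta> \<in> cantor_range"
      by (simp add: AE_all_countable)
    \<comment> \<open>A monotone function has at most countably many discontinuities, so after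
      dilation these levels are negligible.\<close>
    define D where "D = {\<omega>\<in>{0<..<1}. \<not> isCont (\<lambda>\<omega>. Inf {x. \<omega> \<le> cdf N x}) \<omega>}"
    have "countable D"
    proof -
      interpret cdf_distribution N unfolding cdf_distribution_def by (rule N)
      show ?thesis unfolding D_def by (rule mono_on_ctble_discont_open[OF _ mono_I]) simp
    qed
    then have "countable ((\<lambda>\<omega>. m * \<omega>) ` D \<union> {0, m})" by simp
    then have neg: "negligible ((\<lambda>\<omega>. m * \<omega>) ` D \<union> {0, m})"
      using countable_imp_null_set_lborel negligible_iff_null_sets null_sets_completionI by blast
    have cnv: "AE \<theta> in ?Q. convergent (\<lambda>n. q (\<nu> (r n)) \<theta>)"
    proof (rule AE_lebesgue_on_negligible[OF neg])
      fix \<theta> assume t: "\<theta> \<in> {0..m}" "\<theta> \<notin> (\<lambda>\<omega>. m * \<omega>) ` D \<union> {0, m}"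
      then have t': "0 < \<theta>" "\<theta> < m" by auto
      have "\<theta> / m \<notin> D"
      proof
        assume "\<theta> / m \<in> D"
        then have "m * (\<theta> / m) \<in> (\<lambda>\<omega>. m * \<omega>) ` D" by (rule imageI)
        with t m show False by simp
      qed
      with t' m have "isCont (\<lambda>\<omega>. Inf {x. \<omega> \<le> cdf N x}) (\<theta> / m)" by (auto simp: D_def)
      from quantile_tendsto[OF _ N conv _ _ this] \<nu> t' m
      show "convergent (\<lambda>n. q (\<nu> (r n)) \<theta>)"
        by (auto simp: q_def convergent_def comp_def)
    qed simp
    show "AE \<theta> in ?Q. \<forall>i. convergent (\<lambda>n. family_decode R (q (\<nu> (r n)) \<theta>) i :: 'a)"
      using rng cnv by eventually_elim (auto intro: convergent_family_decode)
  qed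
qed

section \<open>Paths given by their values at rational times\<close>

lemma emeasure_distr_eq_nn_integral:
  assumes [measurable]: "f \<in> borel_measurable Q" "U \<in> sets borel"
  shows "emeasure (distr Q borel f) U = (\<integral>\<^sup>+x. indicator U (f x) \<partial>Q)"
proof -
  have "emeasure (distr Q borel f) U = (\<integral>\<^sup>+y. indicator U y \<partial>distr Q borel f)" by simp
  also have "\<dots> = (\<integral>\<^sup>+x. indicator U (f x) \<partial>Q)" by (rule nn_integral_distr) measurable
  finally show ?thesis .
qed

text \<open>By Fatou's lemma the limit law gives open sets at most their \<mu>-mass. Total masses
  agree, so compact sets get at least their \<mu>-mass, and by inner regularity so do all Borel
  sets. Applied to a set and its complement this is equality.\<close>

lemma distr_eq_of_AE_tendsto:
  fixes f :: "nat \<Rightarrow> 'b \<Rightarrow> 'a::euclidean_space"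
  assumes Q: "finite_measure Q"
    and [measurable]: "\<And>n. f n \<in> borel_measurable Q" "h \<in> borel_measurable Q"
    and distr: "\<And>n. distr Q borel (f n) = \<mu>" and lim: "AE x in Q. (\<lambda>n. f n x) \<longlonglongrightarrow> h x"
  shows "distr Q borel h = \<mu>"
proof -
  interpret finite_measure Q by (rule Q)
  define \<nu> where "\<nu> = distr Q borel h"
  have sets: "sets \<nu> = sets borel" "sets \<mu> = sets borel" "space \<nu> = UNIV" "space \<mu> = UNIV"
    using distr[of 0] by (auto simp: \<nu>_def)
  interpret \<nu>: finite_measure \<nu> unfolding \<nu>_def by (rule finite_measure_distr) measurable
  interpret \<mu>: finite_measure \<mu> unfolding distr[of 0, symmetric] by (rule finite_measure_distr) measurable
  have UNIV: "emeasure \<nu> UNIV = emeasure \<mu> UNIV"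
    unfolding \<nu>_def distr[of 0, symmetric] by (simp add: emeasure_distr)
  have open_le: "emeasure \<nu> U \<le> emeasure \<mu> U" if "open U" for U
  proof -
    have U[measurable]: "U \<in> sets borel" using that by simp
    have "emeasure \<nu> U = (\<integral>\<^sup>+x. indicator U (h x) \<partial>Q)"
      unfolding \<nu>_def by (rule emeasure_distr_eq_nn_integral) measurable
    also have "\<dots> \<le> (\<integral>\<^sup>+x. liminf (\<lambda>n. indicator U (f n x)) \<partial>Q)"
    proof (rule nn_integral_mono_AE, use lim in eventually_elim)
      case (elim x)
      show ?case
      proof (cases "h x \<in> U")
        case True
        from topological_tendstoD[OF elim that True]
        have "\<forall>\<^sub>F n in sequentially. (1::ennreal) \<le> indicator U (f n x)"
          by (auto elim!: eventually_mono)
        from Liminf_bounded[OF this] show ?thesis using True by simp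
      qed simp
    qed
    also have "\<dots> \<le> liminf (\<lambda>n. \<integral>\<^sup>+x. indicator U (f n x) \<partial>Q)"
      by (rule nn_integral_liminf) measurable
    also have "(\<lambda>n. \<integral>\<^sup>+x. indicator U (f n x) \<partial>Q) = (\<lambda>n. emeasure \<mu> U)"
    proof
      fix n
      show "(\<integral>\<^sup>+x. indicator U (f n x) \<partial>Q) = emeasure \<mu> U"
        unfolding distr[of n, symmetric] by (rule emeasure_distr_eq_nn_integral[symmetric]) measurable
    qed
    finally show ?thesis by (simp add: Liminf_const)
  qed
  have compl: "emeasure \<nu> (- A) \<le> emeasure \<mu> (- A) \<longleftrightarrow> emeasure \<mu> A \<le> emeasure \<nu> A" if "A \<in> sets borel" for A
  proof -
    have "measure \<nu> (- A) = measure \<nu> UNIV - measure \<nu> A" "measure \<mu> (- A) = measure \<mu> UNIV - measure \<mu> A"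
      using \<nu>.finite_measure_compl[of A] \<mu>.finite_measure_compl[of A] that sets by (auto simp: Compl_eq_Diff_UNIV)
    moreover have "measure \<nu> UNIV = measure \<mu> UNIV" using UNIV by (simp add: measure_def)
    moreover have "measure \<nu> A \<le> measure \<nu> UNIV" "measure \<mu> A \<le> measure \<mu> UNIV"
      using \<nu>.bounded_measure[of A] \<mu>.bounded_measure[of A] sets by auto
    ultimately show ?thesis by (simp add: \<nu>.emeasure_eq_measure \<mu>.emeasure_eq_measure)
  qed
  have le: "emeasure \<mu> B \<le> emeasure \<nu> B" if B: "B \<in> sets borel" for B
  proof -
    have "emeasure \<mu> B = (SUP K\<in>{K. K \<subseteq> B \<and> compact K}. emeasure \<mu> K)"
      by (rule inner_regular) (use sets B in auto)
    also have "\<dots> \<le> emeasure \<nu> B"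
    proof (rule SUP_least)
      fix K assume "K \<in> {K. K \<subseteq> B \<and> compact K}"
      then have K: "K \<subseteq> B" "closed K" using compact_imp_closed by auto
      then have "emeasure \<mu> K \<le> emeasure \<nu> K" using compl[of K] open_le[of "- K"] by auto
      also have "\<dots> \<le> emeasure \<nu> B" using K B sets by (intro emeasure_mono) auto
      finally show "emeasure \<mu> K \<le> emeasure \<nu> B" .
    qed
    finally show ?thesis .
  qed
  have "\<nu> = \<mu>"
  proof (rule measure_eqI)
    fix A assume "A \<in> sets \<nu>"
    then have A: "A \<in> sets borel" using sets by simp
    then show "emeasure \<nu> A = emeasure \<mu> A"
      using le[of A] le[of "- A"] compl[of "- A"] by (auto intro: antisym)
  qed (use sets in simp)
  then show ?thesis by (simp add: \<nu>_def)
qed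

lemma abs_INF_diff_le:
  fixes f h :: "'b \<Rightarrow> real"
  assumes "A \<noteq> {}" "\<And>x. x \<in> A \<Longrightarrow> 0 \<le> f x" "\<And>x. x \<in> A \<Longrightarrow> 0 \<le> h x" "\<And>x. x \<in> A \<Longrightarrow> \<bar>f x - h x\<bar> \<le> d"
  shows "\<bar>(INF x\<in>A. f x) - (INF x\<in>A. h x)\<bar> \<le> d"
proof -
  have *: "(INF x\<in>A. f x) - d \<le> (INF x\<in>A. h x)"
    if "\<And>x. x \<in> A \<Longrightarrow> 0 \<le> f x" "\<And>x. x \<in> A \<Longrightarrow> \<bar>f x - h x\<bar> \<le> d" for f h :: "'b \<Rightarrow> real"
  proof (rule cINF_greatest[OF assms(1)])
    fix x assume x: "x \<in> A"
    have "(INF x\<in>A. f x) \<le> f x" using that x by (intro cINF_lower bdd_belowI2[of _ 0]) auto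
    then show "(INF x\<in>A. f x) - d \<le> h x" using that(2)[OF x] by linarith
  qed
  from *[of f h] *[of h f] assms show ?thesis by (auto simp: abs_le_iff abs_minus_commute)
qed

(* A path is stored by its values at rational times, together with 1 / (1 + length). *)
definition path_data :: "(rat \<Rightarrow> 'a::euclidean_space \<times> real) \<Rightarrow> bool" where
  "path_data z \<longleftrightarrow>
     (\<forall>s\<ge>0. \<forall>t\<ge>0. norm (fst (z s) - fst (z t)) \<le> of_rat \<bar>s - t\<bar>) \<and> fst (z 0) = 0 \<and> 0 < snd (z 0) \<and>
     (\<forall>s\<ge>0. \<forall>t\<ge>0. 1 < of_rat s * snd (z 0) \<longrightarrow> 1 < of_rat t * snd (z 0) \<longrightarrow> fst (z s) = fst (z t))"

lemma path_data_lipschitz: "path_data z \<Longrightarrow> 0 \<le> s \<Longrightarrow> 0 \<le> t \<Longrightarrow> norm (fst (z s) - fst (z t)) \<le> of_rat \<bar>s - t\<bar>"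
  and path_data_0: "path_data z \<Longrightarrow> fst (z 0) = 0"
  and path_data_pos: "path_data z \<Longrightarrow> 0 < snd (z 0)"
  and path_data_stop: "path_data z \<Longrightarrow> 0 \<le> s \<Longrightarrow> 0 \<le> t \<Longrightarrow> 1 < of_rat s * snd (z 0) \<Longrightarrow>
     1 < of_rat t * snd (z 0) \<Longrightarrow> fst (z s) = fst (z t)"
  unfolding path_data_def by blast+

text \<open>An infimum over countably many times is measurable in z; by density of the rationals it
  is the distance from x to the whole trajectory.\<close>

definition range_dist :: "(rat \<Rightarrow> 'a::euclidean_space \<times> real) \<Rightarrow> 'a \<Rightarrow> real" where
  "range_dist z x = (INF s\<in>{0..}. norm (fst (z s) - x))"

text \<open>For path data the sequence is eventually constant. Taking its limit avoids a measurable
  choice of a time at which the path has stopped.\<close>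

definition endpoint :: "(rat \<Rightarrow> 'a::euclidean_space \<times> real) \<Rightarrow> 'a" where
  "endpoint z = lim (\<lambda>k. fst (z (of_nat k)))"

(* The term K / 2 ^ N dominates the oscillation of W along a step; it makes these sums lower
   bounds of the cost and keeps the base of powr away from 0. *)
definition riemann_cost ::
  "('a::euclidean_space \<Rightarrow> real) \<Rightarrow> real \<Rightarrow> real \<Rightarrow> nat \<Rightarrow> (rat \<Rightarrow> 'a \<times> real) \<Rightarrow> ennreal" where
  "riemann_cost W K a N z = (\<Sum>i<N * 2 ^ N. ennreal ((W (fst (z (of_nat i / 2 ^ N))) + K / 2 ^ N) powr a *
      norm (fst (z (of_nat (Suc i) / 2 ^ N)) - fst (z (of_nat i / 2 ^ N)))))"

section \<open>Measurability on the space of path data\<close>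

abbreviation "data_space \<equiv> PiM UNIV (\<lambda>_::rat. borel :: ('a::euclidean_space \<times> real) measure)"

lemma measurable_data_component[measurable]:
  "(\<lambda>z. z s) \<in> borel_measurable (data_space :: (rat \<Rightarrow> 'a::euclidean_space \<times> real) measure)"
  by (rule measurable_component_singleton) simp

lemma measurable_fst_data[measurable]:
  "(\<lambda>z. fst (z s)) \<in> borel_measurable (data_space :: (rat \<Rightarrow> 'a::euclidean_space \<times> real) measure)"
  by (rule measurable_compose[OF measurable_data_component borel_measurable_continuous_onI])
     (intro continuous_intros)

lemma measurable_snd_data[measurable]:
  "(\<lambda>z. snd (z s)) \<in> borel_measurable (data_space :: (rat \<Rightarrow> 'a::euclidean_space \<times> real) measure)"
  by (rule measurable_compose[OF measurable_data_component borel_measurable_continuous_onI])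
     (intro continuous_intros)

lemma measurable_path_data[measurable]:
  "Measurable.pred (data_space :: (rat \<Rightarrow> 'a::euclidean_space \<times> real) measure) path_data"
proof -
  let ?M = "data_space :: (rat \<Rightarrow> 'a \<times> real) measure"
  have 1: "Measurable.pred ?M (\<lambda>z. norm (fst (z s) - fst (z t)) \<le> c)" for s t and c :: real
    by measurable
  have "Measurable.pred ?M (\<lambda>z. norm (fst (z s)) \<le> 0)" for s
    by measurable
  then have 2: "Measurable.pred ?M (\<lambda>z. fst (z s) = 0)" "Measurable.pred ?M (\<lambda>z. fst (z s) = fst (z t))" for s t
    using 1[of s t 0] by simp_all
  have 3: "Measurable.pred ?M (\<lambda>z. c < d * snd (z s))" for s and c d :: real
    by measurable
  have 4: "Measurable.pred ?M (\<lambda>z. 0 < snd (z s))" for s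
    using 3[of 0 1 s] by simp
  show ?thesis
    unfolding path_data_def
    by (intro pred_intros_logic pred_intros_countable 1 2 3 4) measurable
qed

lemma measurable_endpoint[measurable]:
  "endpoint \<in> borel_measurable (data_space :: (rat \<Rightarrow> 'a::euclidean_space \<times> real) measure)"
  unfolding endpoint_def by (rule borel_measurable_lim_metric) measurable

lemma measurable_range_dist[measurable]:
  "(\<lambda>z. range_dist z x) \<in> borel_measurable (data_space :: (rat \<Rightarrow> 'a::euclidean_space \<times> real) measure)"
  unfolding range_dist_def by (rule borel_measurable_cINF) (auto intro!: bdd_belowI2[of _ 0])

lemma measurable_riemann_cost:
  assumes [measurable]: "W \<in> borel_measurable borel"
  shows "riemann_cost W K a N \<in> borel_measurable (data_space :: (rat \<Rightarrow> 'a::euclidean_space \<times> real) measure)"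
  unfolding riemann_cost_def[abs_def] by measurable

section \<open>Limits of path data\<close>

lemma range_dist_nonneg: "0 \<le> range_dist z x"
  unfolding range_dist_def by (rule cINF_greatest) auto

lemma range_dist_diff_le:
  assumes "\<And>s. 0 \<le> s \<Longrightarrow> norm (fst (z s) - fst (w s)) \<le> d"
  shows "\<bar>range_dist z x - range_dist w y\<bar> \<le> d + norm (x - y)"
  unfolding range_dist_def
proof (rule abs_INF_diff_le)
  fix s :: rat assume "s \<in> {0..}"
  then have "norm (fst (z s) - fst (w s)) \<le> d" using assms by auto
  moreover have "\<bar>norm (fst (z s) - x) - norm (fst (w s) - y)\<bar> \<le> norm ((fst (z s) - x) - (fst (w s) - y))"
    by (rule norm_triangle_ineq3)
  moreover have "(fst (z s) - x) - (fst (w s) - y) = (fst (z s) - fst (w s)) - (x - y)" by simp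
  ultimately show "\<bar>norm (fst (z s) - x) - norm (fst (w s) - y)\<bar> \<le> d + norm (x - y)"
    using norm_triangle_ineq4[of "fst (z s) - fst (w s)" "x - y"] by simp
qed auto

lemma endpoint_eq:
  assumes "path_data z" "0 \<le> s" "1 < of_rat s * snd (z 0)"
  shows "endpoint z = fst (z s)"
  unfolding endpoint_def
proof (rule limI, rule tendsto_eventually)
  obtain n where n: "s \<le> of_nat n" using real_arch_simple by blast
  have "fst (z (of_nat k)) = fst (z s)" if "n \<le> k" for k
  proof -
    have "s \<le> of_nat k" using n that by (meson le_trans of_nat_mono order_trans)
    then have "(of_rat s :: real) \<le> of_rat (of_nat k)" by (simp only: of_rat_less_eq)
    moreover have "0 < snd (z 0)" using path_data_pos[OF assms(1)] .
    ultimately have "1 < of_rat (of_nat k) * snd (z 0)"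
      using assms(3) mult_right_mono[of "of_rat s" "of_rat (of_nat k)" "snd (z 0)"] by linarith
    then show ?thesis using path_data_stop[OF assms(1) _ assms(2) _ assms(3)] by simp
  qed
  then show "\<forall>\<^sub>F k in sequentially. fst (z (of_nat k)) = fst (z s)"
    by (auto simp: eventually_sequentially)
qed

lemma ex_large_rat:
  fixes u :: real assumes "0 < u" shows "\<exists>n::nat. 0 < n \<and> 1 < of_rat (of_nat n) * u"
proof -
  obtain n :: nat where "1 < real n * u" using ex_less_of_nat_mult[OF assms, of 1] by auto
  moreover from this have "0 < n" by (cases n) auto
  ultimately show ?thesis by auto
qed

text \<open>The premises of the resting condition are strict inequalities, so if they hold for w
  they hold for all late z n, and the equality passes to the limit. The Lipschitz and starting
  conditions are closed; positivity of the length code can be lost in the limit and is therefore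
  assumed.\<close>

lemma path_data_limit:
  assumes z: "\<And>n. path_data (z n)" and lim: "\<And>s. (\<lambda>n. z n s) \<longlonglongrightarrow> w s" and u: "0 < snd (w 0)"
  shows "path_data w"
  unfolding path_data_def
proof (intro conjI allI impI)
  have f: "(\<lambda>n. fst (z n s)) \<longlonglongrightarrow> fst (w s)" for s using lim tendsto_fst by blast
  have us: "(\<lambda>n. snd (z n 0)) \<longlonglongrightarrow> snd (w 0)" using lim tendsto_snd by blast
  show "norm (fst (w s) - fst (w t)) \<le> of_rat \<bar>s - t\<bar>" if "0 \<le> s" "0 \<le> t" for s t
  proof (rule LIMSEQ_le_const2)
    show "(\<lambda>n. norm (fst (z n s) - fst (z n t))) \<longlonglongrightarrow> norm (fst (w s) - fst (w t))"
      by (intro tendsto_intros f)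
  qed (use path_data_lipschitz[OF z that] in blast)
  show "fst (w 0) = 0"
    by (rule LIMSEQ_unique[OF f[of 0]]) (simp add: path_data_0[OF z])
  show "0 < snd (w 0)" by fact
  fix s t :: rat assume st: "0 \<le> s" "0 \<le> t" "1 < of_rat s * snd (w 0)" "1 < of_rat t * snd (w 0)"
  have "(\<lambda>n. of_rat s * snd (z n 0)) \<longlonglongrightarrow> of_rat s * snd (w 0)" "(\<lambda>n. of_rat t * snd (z n 0)) \<longlonglongrightarrow> of_rat t * snd (w 0)"
    by (intro tendsto_intros us)+
  from order_tendstoD(1)[OF this(1) st(3)] order_tendstoD(1)[OF this(2) st(4)]
  have "\<forall>\<^sub>F n in sequentially. fst (z n s) = fst (z n t)"
  proof eventually_elim
    case (elim n)
    with path_data_stop[OF z st(1,2)] show ?case by blast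
  qed
  from LIMSEQ_unique[OF Lim_transform_eventually[OF f[of s] this] f[of t]]
  show "fst (w s) = fst (w t)" .
qed

text \<open>One integer time k lies beyond the resting times of the limit and of all late paths, so
  it gives all these endpoints at once.\<close>

lemma endpoint_tendsto:
  assumes z: "\<And>n. path_data (z n)" and lim: "\<And>s. (\<lambda>n. z n s) \<longlonglongrightarrow> w s" and w: "path_data w"
  shows "(\<lambda>n. endpoint (z n)) \<longlonglongrightarrow> endpoint w"
proof -
  have "0 < snd (w 0)" using path_data_pos[OF w] .
  from ex_large_rat[OF this] obtain k :: nat where k: "1 < of_rat (of_nat k) * snd (w 0)" by blast
  have "(\<lambda>n. of_rat (of_nat k) * snd (z n 0)) \<longlonglongrightarrow> of_rat (of_nat k) * snd (w 0)"
    by (intro tendsto_intros tendsto_snd lim)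
  from order_tendstoD(1)[OF this k]
  have "\<forall>\<^sub>F n in sequentially. endpoint (z n) = fst (z n (of_nat k))"
    by eventually_elim (auto intro: endpoint_eq[OF z])
  moreover have "(\<lambda>n. fst (z n (of_nat k))) \<longlonglongrightarrow> endpoint w"
    unfolding endpoint_eq[OF w _ k, simplified] by (intro tendsto_fst lim)
  ultimately show ?thesis by (simp add: tendsto_cong)
qed

(* All paths stop before a common time, so pointwise convergence of 1-Lipschitz paths is uniform. *)
lemma path_data_uniform:
  assumes z: "\<And>n. path_data (z n)" and lim: "\<And>s. (\<lambda>n. z n s) \<longlonglongrightarrow> w s" and w: "path_data w" and e: "0 < e"
  shows "\<forall>\<^sub>F n in sequentially. \<forall>s\<ge>0. norm (fst (z n s) - fst (w s)) \<le> e"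
proof -
  have "0 < snd (w 0)" using path_data_pos[OF w] .
  from ex_large_rat[OF this] obtain B :: nat where B: "1 < of_rat (of_nat B) * snd (w 0)" by blast
  \<comment> \<open>A grid of mesh below e / 3 on [0, B], where all late paths rest after B: one
    third of e comes from convergence at the finitely many grid points, two thirds from the
    Lipschitz bounds of the two paths.\<close>
  obtain k :: nat where k: "0 < k" "1 / real k < e / 3"
    using reals_Archimedean[of "e / 3"] e by (metis divide_pos_pos inverse_eq_divide zero_less_Suc zero_less_numeral)
  define S where "S = (\<lambda>j::nat. of_nat j / of_nat k :: rat) ` {..B * k}"
  have "(\<lambda>n. of_rat (of_nat B) * snd (z n 0)) \<longlonglongrightarrow> of_rat (of_nat B) * snd (w 0)"
    by (intro tendsto_intros tendsto_snd lim)
  from order_tendstoD(1)[OF this B] have ev1: "\<forall>\<^sub>F n in sequentially. 1 < of_rat (of_nat B) * snd (z n 0)" .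
  have "\<forall>\<^sub>F n in sequentially. norm (fst (z n s) - fst (w s)) < e / 3" for s
    using tendstoD[OF tendsto_fst[OF lim], of "e / 3"] e by (simp add: dist_norm)
  then have ev2: "\<forall>\<^sub>F n in sequentially. \<forall>s\<in>S. norm (fst (z n s) - fst (w s)) < e / 3"
    by (intro eventually_ball_finite) (auto simp: S_def)
  from ev1 ev2 show ?thesis
  proof eventually_elim
    case (elim n)
    have main: "norm (fst (z n s) - fst (w s)) \<le> e" if s: "0 \<le> s" "s \<le> of_nat B" for s :: rat
    proof -
      define j where "j = nat \<lfloor>s * of_nat k\<rfloor>"
      have j: "of_nat j \<le> s * of_nat k" "s * of_nat k < of_nat j + 1"
        using s floor_correct[of "s * of_nat k"] by (auto simp: j_def of_nat_nat)
      have "s * of_nat k \<le> of_nat (B * k)" using s by (simp add: mult_right_mono)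
      then have "(of_nat j :: rat) \<le> of_nat (B * k)" using j by linarith
      then have "j \<le> B * k" by (simp only: of_nat_le_iff)
      then have jS: "of_nat j / of_nat k \<in> S" by (auto simp: S_def)
      have "s - of_nat j / of_nat k = (s * of_nat k - of_nat j) / of_nat k"
        using k by (simp add: diff_divide_distrib)
      moreover have "(s * of_nat k - of_nat j) / of_nat k \<le> 1 / of_nat k"
        using j by (intro divide_right_mono) auto
      moreover have "0 \<le> (s * of_nat k - of_nat j) / of_nat k"
        using j by simp
      ultimately have "\<bar>s - of_nat j / of_nat k\<bar> \<le> 1 / of_nat k" by simp
      then have "(of_rat \<bar>s - of_nat j / of_nat k\<bar> :: real) \<le> of_rat (1 / of_nat k)"
        by (simp only: of_rat_less_eq)
      also have "\<dots> < e / 3" using k by (simp add: of_rat_divide)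
      finally have close: "(of_rat \<bar>s - of_nat j / of_nat k\<bar> :: real) < e / 3" .
      have "norm (fst (z n s) - fst (z n (of_nat j / of_nat k))) < e / 3"
        "norm (fst (w s) - fst (w (of_nat j / of_nat k))) < e / 3"
        using path_data_lipschitz[OF z s(1), of "of_nat j / of_nat k" n]
          path_data_lipschitz[OF w s(1), of "of_nat j / of_nat k"] close by auto
      moreover have "norm (fst (z n (of_nat j / of_nat k)) - fst (w (of_nat j / of_nat k))) < e / 3"
        using elim(2) jS by blast
      ultimately have "dist (fst (z n s)) (fst (z n (of_nat j / of_nat k))) < e / 3"
        "dist (fst (z n (of_nat j / of_nat k))) (fst (w (of_nat j / of_nat k))) < e / 3"
        "dist (fst (w (of_nat j / of_nat k))) (fst (w s)) < e / 3"
        by (simp_all add: dist_norm norm_minus_commute)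
      then have "dist (fst (z n s)) (fst (w s)) < e"
        using dist_triangle[of "fst (z n s)" "fst (w s)" "fst (z n (of_nat j / of_nat k))"]
          dist_triangle[of "fst (z n (of_nat j / of_nat k))" "fst (w s)" "fst (w (of_nat j / of_nat k))"]
        by linarith
      then show ?thesis by (simp add: dist_norm)
    qed
    show ?case
    proof (intro allI impI)
      fix s :: rat assume s: "0 \<le> s"
      show "norm (fst (z n s) - fst (w s)) \<le> e"
      proof (cases "s \<le> of_nat B")
        case False
        then have sB: "(of_rat (of_nat B) :: real) \<le> of_rat s" by (simp only: of_rat_less_eq)
        have pos: "0 < snd (w 0)" "0 < snd (z n 0)" using path_data_pos[OF w] path_data_pos[OF z] .
        have "1 < of_rat s * snd (w 0)" "1 < of_rat s * snd (z n 0)"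
          using B elim(1) mult_right_mono[OF sB, of "snd (w 0)"] mult_right_mono[OF sB, of "snd (z n 0)"] pos
          by linarith+
        then have "fst (w s) = fst (w (of_nat B))" "fst (z n s) = fst (z n (of_nat B))"
          using endpoint_eq[OF w s] endpoint_eq[OF w _ B] endpoint_eq[OF z s] endpoint_eq[OF z _ elim(1)] by auto
        then show ?thesis using main[of "of_nat B"] by simp
      qed (use main s in blast)
    qed
  qed
qed

lemma range_dist_tendsto:
  assumes z: "\<And>n. path_data (z n)" and lim: "\<And>s. (\<lambda>n. z n s) \<longlonglongrightarrow> w s" and w: "path_data w"
    and x: "x \<longlonglongrightarrow> y"
  shows "(\<lambda>n. range_dist (z n) (x n)) \<longlonglongrightarrow> range_dist w y"
proof (rule tendstoI)
  fix e :: real assume e: "0 < e"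
  have "\<forall>\<^sub>F n in sequentially. \<forall>s\<ge>0. norm (fst (z n s) - fst (w s)) \<le> e / 2"
    using path_data_uniform[OF z lim w, of "e / 2"] e by simp
  moreover have "\<forall>\<^sub>F n in sequentially. norm (x n - y) < e / 2"
    using tendstoD[OF x, of "e / 2"] e by (simp add: dist_norm)
  ultimately show "\<forall>\<^sub>F n in sequentially. dist (range_dist (z n) (x n)) (range_dist w y) < e"
  proof eventually_elim
    case (elim n)
    then have "\<bar>range_dist (z n) (x n) - range_dist w y\<bar> \<le> e / 2 + norm (x n - y)"
      by (intro range_dist_diff_le) auto
    with elim show ?case by (simp add: dist_real_def)
  qed
qed

section \<open>Compactness\<close>

lemma finite_measure_lebesgue_on_Icc: "finite_measure (lebesgue_on {a..b::real})"
  by (intro finite_measureI, cases "a \<le> b") (simp_all add: space_restrict_space emeasure_restrict_space)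

text \<open>The function g stands for d -> J (d / \<epsilon>), K0 for its Lipschitz constant and m
  for the total mass.\<close>

locale profile =
  fixes g :: "real \<Rightarrow> real" and K0 :: real and m :: real
  assumes g_nonneg: "\<And>d. 0 \<le> d \<Longrightarrow> 0 \<le> g d" and g_le: "\<And>d. 0 \<le> d \<Longrightarrow> g d \<le> 1"
    and g_lip: "\<And>d d'. 0 \<le> d \<Longrightarrow> 0 \<le> d' \<Longrightarrow> \<bar>g d - g d'\<bar> \<le> K0 * \<bar>d - d'\<bar>"
    and K0: "0 \<le> K0" and m: "0 < m"
begin

abbreviation Q :: "real measure" where "Q \<equiv> lebesgue_on {0..m}"

definition mult :: "(real \<Rightarrow> rat \<Rightarrow> 'a::euclidean_space \<times> real) \<Rightarrow> 'a \<Rightarrow> real" where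
  "mult Z x = (LINT \<theta>|Q. g (range_dist (Z \<theta>) x))"

sublocale Q: finite_measure Q
  by (rule finite_measure_lebesgue_on_Icc)

lemma space_Q: "space Q = {0..m}"
  by (simp add: space_restrict_space)

lemma measure_Q: "measure Q (space Q) = m"
  using m by (simp add: space_restrict_space measure_restrict_space)

lemma g_measurable: "(\<lambda>d. g (max 0 d)) \<in> borel_measurable borel"
proof (intro borel_measurable_continuous_onI)
  have "K0-lipschitz_on UNIV (\<lambda>d. g (max 0 d))"
  proof (rule lipschitz_onI[OF _ K0])
    fix x y :: real
    have "\<bar>g (max 0 x) - g (max 0 y)\<bar> \<le> K0 * \<bar>max 0 x - max 0 y\<bar>" by (rule g_lip) auto
    also have "\<dots> \<le> K0 * \<bar>x - y\<bar>" using K0 by (intro mult_left_mono) auto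
    finally show "dist (g (max 0 x)) (g (max 0 y)) \<le> K0 * dist x y" by (simp add: dist_real_def)
  qed
  then show "continuous_on UNIV (\<lambda>d. g (max 0 d))" by (rule lipschitz_on_continuous_on)
qed

lemma g_range_dist_measurable[measurable]:
  "(\<lambda>z. g (range_dist z x)) \<in> borel_measurable (data_space :: (rat \<Rightarrow> 'a::euclidean_space \<times> real) measure)"
  using measurable_compose[OF measurable_range_dist g_measurable, of x] by (simp add: range_dist_nonneg)

lemma norm_g_range_dist_le: "norm (g (range_dist z x)) \<le> 1"
  using g_nonneg[OF range_dist_nonneg, of z x] g_le[OF range_dist_nonneg, of z x] by simp

context
  fixes Z :: "real \<Rightarrow> rat \<Rightarrow> 'a::euclidean_space \<times> real"
  assumes Z[measurable]: "Z \<in> measurable Q data_space"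
begin

lemma integrable_g: "integrable Q (\<lambda>\<theta>. g (range_dist (Z \<theta>) x))"
proof (rule Q.integrable_const_bound[where B=1])
  show "AE \<theta> in Q. norm (g (range_dist (Z \<theta>) x)) \<le> 1"
    using norm_g_range_dist_le by (intro always_eventually) blast
  show "(\<lambda>\<theta>. g (range_dist (Z \<theta>) x)) \<in> borel_measurable Q"
    using measurable_compose[OF Z g_range_dist_measurable] .
qed

lemma mult_nonneg: "0 \<le> mult Z x"
  unfolding mult_def by (intro integral_nonneg_AE always_eventually) (simp add: g_nonneg range_dist_nonneg)

lemma mult_le: "mult Z x \<le> m"
proof -
  have "mult Z x \<le> (LINT \<theta>|Q. 1)"
    unfolding mult_def by (rule integral_mono[OF integrable_g]) (auto simp: g_le range_dist_nonneg)
  then show ?thesis using measure_Q by simp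
qed

lemma mult_lipschitz: "\<bar>mult Z x - mult Z y\<bar> \<le> m * K0 * norm (x - y)"
proof -
  have "\<bar>mult Z x - mult Z y\<bar> = \<bar>LINT \<theta>|Q. g (range_dist (Z \<theta>) x) - g (range_dist (Z \<theta>) y)\<bar>"
    unfolding mult_def by (subst Bochner_Integration.integral_diff) (auto intro: integrable_g)
  also have "\<dots> \<le> (LINT \<theta>|Q. \<bar>g (range_dist (Z \<theta>) x) - g (range_dist (Z \<theta>) y)\<bar>)"
    by (rule integral_abs_bound)
  also have "\<dots> \<le> (LINT \<theta>|Q. K0 * norm (x - y))"
  proof (rule integral_mono)
    fix \<theta>
    have "\<bar>range_dist (Z \<theta>) x - range_dist (Z \<theta>) y\<bar> \<le> norm (x - y)"
      using range_dist_diff_le[of "Z \<theta>" "Z \<theta>" 0 x y] by simp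
    then show "\<bar>g (range_dist (Z \<theta>) x) - g (range_dist (Z \<theta>) y)\<bar> \<le> K0 * norm (x - y)"
      using g_lip[OF range_dist_nonneg range_dist_nonneg, of "Z \<theta>" x "Z \<theta>" y] mult_left_mono[OF _ K0]
      by (meson order_trans)
  qed (intro integrable_abs Bochner_Integration.integrable_diff integrable_g, simp)
  also have "\<dots> = m * K0 * norm (x - y)" using measure_Q by simp
  finally show ?thesis .
qed

lemma continuous_mult: "continuous_on S (mult Z)"
proof -
  have "(m * K0)-lipschitz_on S (mult Z)"
    by (rule lipschitz_onI) (use mult_lipschitz K0 m in \<open>auto simp: dist_norm\<close>)
  then show ?thesis by (rule lipschitz_on_continuous_on)
qed

lemma measurable_mult[measurable]: "mult Z \<in> borel_measurable borel"
  by (rule borel_measurable_continuous_onI[OF continuous_mult])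

text \<open>Multiplicities survive the replacement of path data by others with the same law,
  although the fibres are rearranged; the next lemma then extends this to the mean Riemann
  sums.\<close>

lemma mult_distr: "mult Z x = (LINT z|distr Q data_space Z. g (range_dist z x))"
  unfolding mult_def by (subst integral_distr) auto

lemma integral_riemann_cost_distr:
  "(\<integral>\<^sup>+\<theta>. riemann_cost (mult Z) K a N (Z \<theta>) \<partial>Q) = (\<integral>\<^sup>+z. riemann_cost (mult Z) K a N z \<partial>distr Q data_space Z)"
  by (subst nn_integral_distr) (auto intro: measurable_riemann_cost)

end

text \<open>The points x n are allowed to move because the multiplicity is evaluated at points of
  paths that converge themselves. Dominated convergence applies since g is at most 1.\<close>

lemma mult_tendsto:
  fixes Y :: "nat \<Rightarrow> real \<Rightarrow> rat \<Rightarrow> 'a::euclidean_space \<times> real"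
  assumes Y: "\<And>n. Y n \<in> measurable Q data_space" and Z: "Z \<in> measurable Q data_space"
    and path: "AE \<theta> in Q. (\<forall>n. path_data (Y n \<theta>)) \<and> path_data (Z \<theta>) \<and> (\<forall>s. (\<lambda>n. Y n \<theta> s) \<longlonglongrightarrow> Z \<theta> s)"
    and x: "x \<longlonglongrightarrow> y"
  shows "(\<lambda>n. mult (Y n) (x n)) \<longlonglongrightarrow> mult Z y"
  unfolding mult_def
proof (rule integral_dominated_convergence[where w="\<lambda>_. 1"])
  show "(\<lambda>\<theta>. g (range_dist (Z \<theta>) y)) \<in> borel_measurable Q"
    using integrable_g[OF Z] by auto
  show "(\<lambda>\<theta>. g (range_dist (Y n \<theta>) (x n))) \<in> borel_measurable Q" for n
    using integrable_g[OF Y] by auto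
  show "AE \<theta> in Q. norm (g (range_dist (Y n \<theta>) (x n))) \<le> 1" for n
    using norm_g_range_dist_le by (intro always_eventually) blast
  show "AE \<theta> in Q. (\<lambda>n. g (range_dist (Y n \<theta>) (x n))) \<longlonglongrightarrow> g (range_dist (Z \<theta>) y)"
    using path
  proof eventually_elim
    case (elim \<theta>)
    then have lim: "(\<lambda>n. range_dist (Y n \<theta>) (x n)) \<longlonglongrightarrow> range_dist (Z \<theta>) y"
      by (intro range_dist_tendsto x) auto
    have "(\<lambda>n. g (range_dist (Y n \<theta>) (x n)) - g (range_dist (Z \<theta>) y)) \<longlonglongrightarrow> 0"
    proof (rule Lim_null_comparison)
      show "\<forall>\<^sub>F n in sequentially. norm (g (range_dist (Y n \<theta>) (x n)) - g (range_dist (Z \<theta>) y))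
          \<le> K0 * \<bar>range_dist (Y n \<theta>) (x n) - range_dist (Z \<theta>) y\<bar>"
        unfolding real_norm_def by (intro always_eventually allI g_lip range_dist_nonneg)
      have "(\<lambda>n. K0 * \<bar>range_dist (Y n \<theta>) (x n) - range_dist (Z \<theta>) y\<bar>) \<longlonglongrightarrow> K0 * \<bar>range_dist (Z \<theta>) y - range_dist (Z \<theta>) y\<bar>"
        by (intro tendsto_intros lim)
      then show "(\<lambda>n. K0 * \<bar>range_dist (Y n \<theta>) (x n) - range_dist (Z \<theta>) y\<bar>) \<longlonglongrightarrow> 0" by simp
    qed
    then show ?case by (rule LIM_zero_cancel)
  qed
qed auto

text \<open>The path property, the end law and the mean Riemann sums are all determined by the law.
  They can therefore be transferred from X (r n) to the Skorokhod representatives Y n, which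
  converge almost everywhere. The bound B is on the mean of 1 / snd, which for a plan is the mean of
  1 + length.\<close>

lemma path_compactness:
  fixes X :: "nat \<Rightarrow> real \<Rightarrow> rat \<Rightarrow> 'a::euclidean_space \<times> real" and \<mu> :: "'a measure"
  assumes X: "\<And>n. X n \<in> measurable Q data_space"
    and path: "\<And>n \<theta>. \<theta> \<in> {0..m} \<Longrightarrow> path_data (X n \<theta>)"
    and R: "\<And>n \<theta> s. \<theta> \<in> {0..m} \<Longrightarrow> norm (X n \<theta> s) \<le> R s"
    and B: "\<And>n. (\<integral>\<^sup>+\<theta>. ennreal (1 / snd (X n \<theta> 0)) \<partial>Q) \<le> B" "B < \<infinity>"
    and endpt: "\<And>n. distr Q borel (\<lambda>\<theta>. endpoint (X n \<theta>)) = \<mu>" and K: "0 < K"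
  obtains r Z where "strict_mono (r :: nat \<Rightarrow> nat)" "Z \<in> measurable Q data_space"
    "AE \<theta> in Q. path_data (Z \<theta>)" "distr Q borel (\<lambda>\<theta>. endpoint (Z \<theta>)) = \<mu>"
    "\<And>N. (\<integral>\<^sup>+\<theta>. riemann_cost (mult Z) K a N (Z \<theta>) \<partial>Q)
       \<le> liminf (\<lambda>n. \<integral>\<^sup>+\<theta>. riemann_cost (mult (X (r n))) K a N (X (r n) \<theta>) \<partial>Q)"
proof -
  have Xs: "(\<lambda>\<theta>. X n \<theta> s) \<in> borel_measurable Q" for n s
    using measurable_compose[OF X measurable_data_component] .
  have "\<exists>r Y. strict_mono (r :: nat \<Rightarrow> nat) \<and> (\<forall>n. Y n \<in> measurable Q data_space) \<and>
    (\<forall>n. distr Q data_space (Y n) = distr Q data_space (X (r n))) \<and>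
    (AE \<theta> in Q. \<forall>s. convergent (\<lambda>n. Y n \<theta> s))"
  proof (rule skorokhod_subsequence[where Z=X and R=R, OF m Xs])
    show "norm (X n \<theta> s) \<le> R s" if "\<theta> \<in> {0..m}" for n \<theta> s by (rule R[OF that])
    fix r and Y :: "nat \<Rightarrow> real \<Rightarrow> rat \<Rightarrow> 'a \<times> real"
    assume "strict_mono (r :: nat \<Rightarrow> nat)" "\<And>n. Y n \<in> measurable Q data_space"
      "\<And>n. distr Q data_space (Y n) = distr Q data_space (X (r n))"
      "AE \<theta> in Q. \<forall>s. convergent (\<lambda>n. Y n \<theta> s)"
    then show ?thesis by (intro exI[of _ r] exI[of _ Y] conjI allI)
  qed
  then obtain r Y where r: "strict_mono (r :: nat \<Rightarrow> nat)" and Y: "\<And>n. Y n \<in> measurable Q data_space"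
    and law: "\<And>n. distr Q data_space (Y n) = distr Q data_space (X (r n))"
    and conv: "AE \<theta> in Q. \<forall>s. convergent (\<lambda>n. Y n \<theta> s)"
    by (elim exE conjE) (rule that, assumption, (erule spec)+, assumption)
  have Ys[measurable]: "(\<lambda>\<theta>. Y n \<theta> s) \<in> borel_measurable Q" for n s
    using measurable_compose[OF Y measurable_data_component] .
  define Z where "Z \<theta> s = lim (\<lambda>n. Y n \<theta> s)" for \<theta> s
  have Zs[measurable]: "(\<lambda>\<theta>. Z \<theta> s) \<in> borel_measurable Q" for s
    unfolding Z_def by (rule borel_measurable_lim_metric) measurable
  have Z: "Z \<in> measurable Q data_space"
    using measurable_PiM_single'[of UNIV "\<lambda>s \<theta>. Z \<theta> s" Q "\<lambda>_. borel"] by simp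
  have Ysnd[measurable]: "(\<lambda>\<theta>. snd (Y n \<theta> s)) \<in> borel_measurable Q" for n s
    using measurable_compose[OF Y measurable_snd_data] .
  \<comment> \<open>Any measurable property that X (r n) has on all fibres holds for Y n on almost
    all of them, as both have the same law.\<close>
  have transfer: "AE \<theta> in Q. P (Y n \<theta>)"
    if P: "Measurable.pred data_space P" and ae: "\<And>\<theta>. \<theta> \<in> {0..m} \<Longrightarrow> P (X (r n) \<theta>)" for P n
  proof -
    have "AE z in distr Q data_space (X (r n)). P z"
      using P ae by (subst AE_distr_iff[OF X]) (auto simp: space_Q intro!: AE_I2)
    then show ?thesis unfolding law[symmetric] using P by (subst (asm) AE_distr_iff[OF Y]) auto
  qed
  have Ypath: "AE \<theta> in Q. \<forall>n. path_data (Y n \<theta>)"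
    unfolding AE_all_countable by (intro allI transfer[OF measurable_path_data path])
  have lim: "AE \<theta> in Q. \<forall>s. (\<lambda>n. Y n \<theta> s) \<longlonglongrightarrow> Z \<theta> s"
    using conv by eventually_elim (auto simp: Z_def convergent_LIMSEQ_iff)
  have Bn: "(\<integral>\<^sup>+\<theta>. ennreal (1 / snd (Y n \<theta> 0)) \<partial>Q) \<le> B" for n
  proof -
    have [measurable]: "(\<lambda>z. ennreal (1 / snd (z (0::rat)))) \<in> borel_measurable (data_space :: (rat \<Rightarrow> 'a \<times> real) measure)"
      by measurable
    have "(\<integral>\<^sup>+\<theta>. ennreal (1 / snd (Y n \<theta> 0)) \<partial>Q) = (\<integral>\<^sup>+z. ennreal (1 / snd (z 0)) \<partial>distr Q data_space (Y n))"
      by (subst nn_integral_distr[OF Y]) auto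
    also have "\<dots> = (\<integral>\<^sup>+\<theta>. ennreal (1 / snd (X (r n) \<theta> 0)) \<partial>Q)"
      unfolding law by (subst nn_integral_distr[OF X]) auto
    finally show ?thesis using B(1) by simp
  qed
  \<comment> \<open>Tightness in the form of Fatou's lemma: on almost every fibre the lengths do not
    tend to infinity.\<close>
  have "(\<integral>\<^sup>+\<theta>. liminf (\<lambda>n. ennreal (1 / snd (Y n \<theta> 0))) \<partial>Q) \<le> liminf (\<lambda>n. \<integral>\<^sup>+\<theta>. ennreal (1 / snd (Y n \<theta> 0)) \<partial>Q)"
    by (rule nn_integral_liminf) measurable
  also have "\<dots> \<le> B"
    using Bn by (intro Liminf_le) auto
  finally have "(\<integral>\<^sup>+\<theta>. liminf (\<lambda>n. ennreal (1 / snd (Y n \<theta> 0))) \<partial>Q) \<noteq> \<infinity>" using B(2) by auto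
  then have "AE \<theta> in Q. liminf (\<lambda>n. ennreal (1 / snd (Y n \<theta> 0))) \<noteq> \<infinity>"
    by (intro nn_integral_PInf_AE) measurable
  then have Zpath: "AE \<theta> in Q. path_data (Z \<theta>)"
    using Ypath lim
  proof eventually_elim
    case (elim \<theta>)
    have snd: "(\<lambda>n. snd (Y n \<theta> 0)) \<longlonglongrightarrow> snd (Z \<theta> 0)" using elim(3) tendsto_snd by blast
    have pos: "0 < snd (Y n \<theta> 0)" for n using elim(2) path_data_pos[of "Y n \<theta>"] by blast
    \<comment> \<open>Otherwise the positive codes would tend to a limit that is at most 0, and
      their reciprocals would exceed every constant, against the finite liminf.\<close>
    have "0 < snd (Z \<theta> 0)"
    proof (rule ccontr)
      assume neg: "\<not> 0 < snd (Z \<theta> 0)"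
      obtain c :: real where c: "0 < c" "liminf (\<lambda>n. ennreal (1 / snd (Y n \<theta> 0))) < ennreal c"
      proof -
        define l where "l = liminf (\<lambda>n. ennreal (1 / snd (Y n \<theta> 0)))"
        have "l \<noteq> \<infinity>" using elim(1) by (simp only: l_def not_False_eq_True)
        then obtain b where "0 \<le> b" "l = ennreal b" by (cases l) auto
        then have b: "0 \<le> b" "liminf (\<lambda>n. ennreal (1 / snd (Y n \<theta> 0))) = ennreal b" by (simp_all only: l_def)
        show thesis
        proof (rule that[of "b + 1"])
          show "0 < b + 1" using b(1) by simp
          show "liminf (\<lambda>n. ennreal (1 / snd (Y n \<theta> 0))) < ennreal (b + 1)"
            unfolding b(2) using b(1) by (simp add: ennreal_less_iff)
        qed
      qed
      have "0 < 1 / c" using c(1) by simp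
      then have "snd (Z \<theta> 0) < 1 / c" using neg by linarith
      from order_tendstoD(2)[OF snd this]
      have "\<forall>\<^sub>F n in sequentially. ennreal c \<le> ennreal (1 / snd (Y n \<theta> 0))"
      proof eventually_elim
        case (elim n)
        moreover have "0 < snd (Y n \<theta> 0)" by (rule pos)
        ultimately show ?case using c(1)
          by (intro ennreal_leI) (simp add: pos_less_divide_eq pos_le_divide_eq mult.commute)
      qed
      from Liminf_bounded[OF this] c(2) show False by simp
    qed
    then show ?case using path_data_limit[of "\<lambda>n. Y n \<theta>" "Z \<theta>"] elim(2,3) by blast
  qed
  have all: "AE \<theta> in Q. (\<forall>n. path_data (Y n \<theta>)) \<and> path_data (Z \<theta>) \<and> (\<forall>s. (\<lambda>n. Y n \<theta> s) \<longlonglongrightarrow> Z \<theta> s)"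
    using Ypath Zpath lim by eventually_elim blast
  have endptm: "(\<lambda>\<theta>. endpoint (W \<theta>)) \<in> borel_measurable Q" if "W \<in> measurable Q data_space" for W :: "real \<Rightarrow> rat \<Rightarrow> 'a \<times> real"
    using measurable_compose[OF that measurable_endpoint] .
  have Yend: "distr Q borel (\<lambda>\<theta>. endpoint (Y n \<theta>)) = \<mu>" for n
  proof -
    have "distr Q borel (\<lambda>\<theta>. endpoint (Y n \<theta>)) = distr (distr Q data_space (Y n)) borel endpoint"
      using distr_distr[OF measurable_endpoint Y] by (simp add: comp_def)
    also have "\<dots> = distr Q borel (\<lambda>\<theta>. endpoint (X (r n) \<theta>))"
      unfolding law using distr_distr[OF measurable_endpoint X] by (simp add: comp_def)
    finally show ?thesis using endpt by simp
  qed
  show thesis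
  proof (rule that[OF r Z Zpath])
    show "distr Q borel (\<lambda>\<theta>. endpoint (Z \<theta>)) = \<mu>"
    proof (rule distr_eq_of_AE_tendsto[OF Q.finite_measure_axioms endptm[OF Y] endptm[OF Z] Yend])
      show "AE \<theta> in Q. (\<lambda>n. endpoint (Y n \<theta>)) \<longlonglongrightarrow> endpoint (Z \<theta>)"
        using all by eventually_elim (auto intro: endpoint_tendsto)
    qed
    fix N
    have rm: "(\<lambda>\<theta>. riemann_cost (mult W) K a N (W \<theta>)) \<in> borel_measurable Q"
      if "W \<in> measurable Q data_space" for W :: "real \<Rightarrow> rat \<Rightarrow> 'a \<times> real"
      using measurable_compose[OF that measurable_riemann_cost[OF measurable_mult[OF that]]] .
    have "(\<integral>\<^sup>+\<theta>. riemann_cost (mult Z) K a N (Z \<theta>) \<partial>Q) \<le> (\<integral>\<^sup>+\<theta>. liminf (\<lambda>n. riemann_cost (mult (Y n)) K a N (Y n \<theta>)) \<partial>Q)"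
    proof (rule nn_integral_mono_AE, use all in eventually_elim)
      case (elim \<theta>)
      have f: "(\<lambda>n. fst (Y n \<theta> s)) \<longlonglongrightarrow> fst (Z \<theta> s)" for s
        using elim tendsto_fst by blast
      have pos: "mult Z x + K / 2 ^ N \<noteq> 0" for x
        using add_nonneg_pos[OF mult_nonneg[OF Z, of x], of "K / 2 ^ N"] K by simp
      have w: "(\<lambda>n. (mult (Y n) (fst (Y n \<theta> s)) + K / 2 ^ N) powr a) \<longlonglongrightarrow> (mult Z (fst (Z \<theta> s)) + K / 2 ^ N) powr a" for s
        by (rule tendsto_powr[OF tendsto_add[OF mult_tendsto[OF Y Z all f[of s]] tendsto_const] tendsto_const pos])
      have d: "(\<lambda>n. norm (fst (Y n \<theta> s) - fst (Y n \<theta> t))) \<longlonglongrightarrow> norm (fst (Z \<theta> s) - fst (Z \<theta> t))" for s t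
        by (rule tendsto_norm[OF tendsto_diff[OF f f]])
      have "(\<lambda>n. riemann_cost (mult (Y n)) K a N (Y n \<theta>)) \<longlonglongrightarrow> riemann_cost (mult Z) K a N (Z \<theta>)"
        unfolding riemann_cost_def by (rule tendsto_sum, rule tendsto_ennrealI, rule tendsto_mult[OF w d])
      from lim_imp_Liminf[OF sequentially_bot this]
      show "riemann_cost (mult Z) K a N (Z \<theta>) \<le> liminf (\<lambda>n. riemann_cost (mult (Y n)) K a N (Y n \<theta>))"
        by simp
    qed
    also have "\<dots> \<le> liminf (\<lambda>n. \<integral>\<^sup>+\<theta>. riemann_cost (mult (Y n)) K a N (Y n \<theta>) \<partial>Q)"
      by (rule nn_integral_liminf[OF rm[OF Y]])
    also have "(\<lambda>n. \<integral>\<^sup>+\<theta>. riemann_cost (mult (Y n)) K a N (Y n \<theta>) \<partial>Q)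
      = (\<lambda>n. \<integral>\<^sup>+\<theta>. riemann_cost (mult (X (r n))) K a N (X (r n) \<theta>) \<partial>Q)"
    proof
      fix n
      have "mult (Y n) = mult (X (r n))"
        by (rule ext) (simp only: mult_distr[OF X] mult_distr[OF Y] law)
      with integral_riemann_cost_distr[OF Y, of n K a N] integral_riemann_cost_distr[OF X, of "r n" K a N] show "(\<integral>\<^sup>+\<theta>. riemann_cost (mult (Y n)) K a N (Y n \<theta>) \<partial>Q)
          = (\<integral>\<^sup>+\<theta>. riemann_cost (mult (X (r n))) K a N (X (r n) \<theta>) \<partial>Q)"
        by (simp only: law)
    qed
    finally show "(\<integral>\<^sup>+\<theta>. riemann_cost (mult Z) K a N (Z \<theta>) \<partial>Q)
       \<le> liminf (\<lambda>n. \<integral>\<^sup>+\<theta>. riemann_cost (mult (X (r n))) K a N (X (r n) \<theta>) \<partial>Q)" .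
  qed
qed

end

section \<open>From plans to path data\<close>

lemma of_rat_abs_diff: "of_rat \<bar>s - t\<bar> = \<bar>of_rat s - of_rat t :: real\<bar>"
  by (simp add: abs_if of_rat_diff of_rat_less of_rat_minus)

lemma ext_powr_ge:
  assumes "0 \<le> w" "w \<le> w'" "0 < w'" "a \<le> 0"
  shows "ennreal (w' powr a) \<le> ext_powr w a"
proof (cases "w = 0")
  case True
  then show ?thesis using assms by (auto simp: ext_powr_def)
next
  case False
  then show ?thesis using assms by (auto simp: ext_powr_def intro!: ennreal_leI powr_mono2')
qed

lemma measurable_ext_powr: "(\<lambda>w. ext_powr w a) \<in> borel_measurable borel"
  unfolding ext_powr_def by measurable

lemma INF_rat_eq_INF_real:
  fixes q :: "real \<Rightarrow> 'a::real_normed_vector"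
  assumes q: "\<And>s t. 0 \<le> s \<Longrightarrow> 0 \<le> t \<Longrightarrow> norm (q s - q t) \<le> \<bar>s - t\<bar>"
  shows "(INF s\<in>{0..}. norm (q (of_rat s) - x)) = (INF s\<in>{0..}. norm (q s - x))"
proof (rule antisym)
  have bdd: "bdd_below ((\<lambda>s. norm (q s - x)) ` A)" for A by (rule bdd_belowI2[of _ 0]) simp
  have bdd': "bdd_below ((\<lambda>s. norm (q (of_rat s) - x)) ` A)" for A by (rule bdd_belowI2[of _ 0]) simp
  show "(INF s\<in>{0..}. norm (q s - x)) \<le> (INF s\<in>{0..}. norm (q (of_rat s) - x))"
    by (rule cINF_greatest) (auto intro!: cINF_lower bdd)
  show "(INF s\<in>{0..}. norm (q (of_rat s) - x)) \<le> (INF s\<in>{0..}. norm (q s - x))"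
  proof (rule cINF_greatest)
    fix s :: real assume "s \<in> {0..}"
    then have s: "0 \<le> s" by simp
    show "(INF s\<in>{0..}. norm (q (of_rat s) - x)) \<le> norm (q s - x)"
    proof (rule field_le_epsilon)
      fix e :: real assume "0 < e"
      then obtain r where r: "s < of_rat r" "of_rat r < s + e" using of_rat_dense[of s "s + e"] by auto
      have r0: "(0::real) \<le> of_rat r" using r s by linarith
      then have "0 \<le> r" by (simp add: zero_le_of_rat_iff)
      then have "(INF s\<in>{0..}. norm (q (of_rat s) - x)) \<le> norm (q (of_rat r) - x)"
        by (intro cINF_lower bdd') auto
      also have "\<dots> = norm ((q (of_rat r) - q s) + (q s - x))" by simp
      also have "\<dots> \<le> norm (q (of_rat r) - q s) + norm (q s - x)" by (rule norm_triangle_ineq)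
      also have "\<dots> \<le> norm (q s - x) + e" using q[OF r0 s] r by simp
      finally show "(INF s\<in>{0..}. norm (q (of_rat s) - x)) \<le> norm (q s - x) + e" .
    qed
  qed auto
qed

text \<open>The infimum over positive times need not be attained: it is 0 for a constant path. The
  path equals p T at all later times, and continuity gives the value at the infimum itself.\<close>

lemma (in stopped_path) value_at_stopping_time:
  assumes "\<gamma> \<theta> = p"
  shows "\<gamma> \<theta> (stopping_time \<gamma> \<theta>) = p T"
proof -
  define S where "S = {t. t > 0 \<and> (\<forall>t'\<ge>t. p t' = p t)}"
  define \<sigma> where "\<sigma> = Inf S"
  have "p t' = p (T + 1)" if "T + 1 \<le> t'" for t'
    by (rule trans[OF const const[symmetric]]) (use that in simp_all)
  \<comment> \<open>T + 1 instead of T, because T may be 0 and S contains positive times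
    only.\<close>
  then have TS: "T + 1 \<in> S" unfolding S_def using T by (intro CollectI conjI allI impI) simp
  have bdd: "bdd_below S" by (rule bdd_belowI[of _ 0]) (auto simp: S_def)
  have \<sigma>0: "0 \<le> \<sigma>" unfolding \<sigma>_def by (rule cInf_greatest) (use TS in \<open>auto simp: S_def\<close>)
  have after: "p t = p T" if t: "\<sigma> < t" for t
  proof -
    obtain t0 where t0: "t0 \<in> S" "t0 < t"
      using t TS cInf_lessD[of S t] unfolding \<sigma>_def by blast
    then have eq: "p t' = p t0" if "t0 \<le> t'" for t' using that unfolding S_def by blast
    have "p t = p t0" "p (max t T) = p t0" by (rule eq, use t0 in simp)+
    moreover have "p (max t T) = p T" by (rule const) simp
    ultimately show "p t = p T" by simp
  qed
  have "norm (p \<sigma> - p T) \<le> e" if "0 < e" for e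
  proof -
    have "p (\<sigma> + e) = p T" using after that by simp
    then show ?thesis using lipschitz_onD[OF lip, of \<sigma> "\<sigma> + e"] \<sigma>0 that by (simp add: dist_norm)
  qed
  then have "p \<sigma> = p T"
    using field_le_epsilon[of "norm (p \<sigma> - p T)" 0] by auto
  then show ?thesis unfolding stopping_time_def assms \<sigma>_def S_def .
qed

locale irrigation = profile "\<lambda>d. J (d / \<epsilon>)" K0 "measure \<mu> UNIV"
  for J :: "real \<Rightarrow> real" and \<epsilon> K0 :: real and \<mu> :: "'a::euclidean_space measure" +
  fixes \<alpha> :: real
  assumes \<alpha>: "\<alpha> \<le> 1"
begin

abbreviation "M \<equiv> measure \<mu> UNIV"

text \<open>By \<open>mult_lipschitz\<close>, M * K0 is a Lipschitz constant of the multiplicity;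
  the summand 1 makes K positive, as required of the correction in
  \<open>riemann_cost\<close>.\<close>

definition K :: real where "K = M * K0 + 1"

lemma K: "0 < K" "M * K0 \<le> K"
  using K0 m by (auto simp: K_def add_nonneg_pos)

section \<open>Arc-length data of an admissible plan\<close>

context
  fixes \<gamma> :: "real \<Rightarrow> real \<Rightarrow> 'a"
  assumes \<gamma>: "\<gamma> \<in> irrigation_plans \<mu>"
begin

definition T :: "real \<Rightarrow> real" where
  "T \<theta> = (SOME t. 0 \<le> t \<and> (\<forall>t'\<ge>t. \<gamma> \<theta> t' = \<gamma> \<theta> t))"

text \<open>Negative rationals are sent to the starting point, so every component is bounded and
  measurable. The code of the length is copied into all components and read off at 0.\<close>

definition plan_data :: "real \<Rightarrow> rat \<Rightarrow> 'a \<times> real" where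
  "plan_data \<theta> s = (arclen_param (\<gamma> \<theta>) (of_rat (max 0 s)), 1 / (1 + total_len (\<gamma> \<theta>)))"

lemma plan_stopped_path: assumes "\<theta> \<in> {0..M}" shows "stopped_path (\<gamma> \<theta>) (T \<theta>)"
proof -
  have "\<exists>t. 0 \<le> t \<and> (\<forall>t'\<ge>t. \<gamma> \<theta> t' = \<gamma> \<theta> t)" "1-lipschitz_on {0..} (\<gamma> \<theta>)"
    using \<gamma> assms unfolding irrigation_plans_def fibres_def by blast+
  moreover from someI_ex[OF this(1)] have "0 \<le> T \<theta> \<and> (\<forall>t'\<ge>T \<theta>. \<gamma> \<theta> t' = \<gamma> \<theta> (T \<theta>))"
    unfolding T_def .
  ultimately show ?thesis by unfold_locales blast+
qed

lemma plan_start: "\<theta> \<in> {0..M} \<Longrightarrow> \<gamma> \<theta> 0 = 0"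
  using \<gamma> unfolding irrigation_plans_def fibres_def by blast

lemma plan_section_measurable: assumes "0 \<le> t" shows "(\<lambda>\<theta>. \<gamma> \<theta> t) \<in> borel_measurable Q"
proof -
  have "(\<lambda>(\<theta>, t). \<gamma> \<theta> t) \<in> borel_measurable (Q \<Otimes>\<^sub>M lebesgue_on {0..})"
    using \<gamma> unfolding irrigation_plans_def fibres_def by blast
  note f = this
  have "(\<lambda>\<theta>. (\<theta>, t)) \<in> measurable Q (Q \<Otimes>\<^sub>M lebesgue_on {0..})"
    using assms by (intro measurable_Pair2') (simp add: space_restrict_space)
  from measurable_compose[OF this f] show ?thesis by simp
qed

lemma plan_arclen_param_measurable: "0 \<le> s \<Longrightarrow> (\<lambda>\<theta>. arclen_param (\<gamma> \<theta>) s) \<in> borel_measurable Q"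
  by (rule borel_measurable_arclen_param[where T=T]) (auto simp: space_Q intro: plan_stopped_path plan_section_measurable)

lemma plan_total_len_measurable: "(\<lambda>\<theta>. total_len (\<gamma> \<theta>)) \<in> borel_measurable Q"
  by (rule borel_measurable_total_len[where T=T]) (auto simp: space_Q intro: plan_stopped_path plan_section_measurable)

lemma plan_data_measurable: "plan_data \<in> measurable Q data_space"
proof -
  have a: "(\<lambda>\<theta>. arclen_param (\<gamma> \<theta>) (of_rat (max 0 s))) \<in> borel_measurable Q" for s :: rat
    by (rule plan_arclen_param_measurable) simp
  have b: "(\<lambda>\<theta>. 1 / (1 + total_len (\<gamma> \<theta>))) \<in> borel_measurable Q"
    by (intro borel_measurable_divide borel_measurable_add borel_measurable_const plan_total_len_measurable)
  have "(\<lambda>\<theta>. plan_data \<theta> s) \<in> borel_measurable Q" for s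
    unfolding plan_data_def by (rule borel_measurable_Pair[OF a b])
  then show ?thesis
    by (intro measurable_PiM_single'[of UNIV "\<lambda>s \<theta>. plan_data \<theta> s" Q "\<lambda>_. borel"]) simp_all
qed

lemma plan_path_data: assumes "\<theta> \<in> {0..M}" shows "path_data (plan_data \<theta>)"
proof -
  interpret stopped_path "\<gamma> \<theta>" "T \<theta>" by (rule plan_stopped_path[OF assms])
  show ?thesis
    unfolding path_data_def
  proof (intro conjI allI impI)
    fix s t :: rat assume st: "0 \<le> s" "0 \<le> t"
    then have st': "(0::real) \<le> of_rat s" "(0::real) \<le> of_rat t" by (simp_all add: zero_le_of_rat_iff)
    show "norm (fst (plan_data \<theta> s) - fst (plan_data \<theta> t)) \<le> of_rat \<bar>s - t\<bar>"
      using norm_arclen_param_diff[OF st'] st by (simp add: plan_data_def max_def of_rat_abs_diff)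
    assume "1 < of_rat s * snd (plan_data \<theta> 0)" "1 < of_rat t * snd (plan_data \<theta> 0)"
    moreover have "0 < 1 + total_len (\<gamma> \<theta>)" using total_len_nonneg[of "\<gamma> \<theta>"] by linarith
    ultimately have "total_len (\<gamma> \<theta>) \<le> of_rat s" "total_len (\<gamma> \<theta>) \<le> of_rat t"
      by (simp_all add: plan_data_def pos_less_divide_eq)
    then show "fst (plan_data \<theta> s) = fst (plan_data \<theta> t)"
      using st by (simp add: plan_data_def max_def arclen_param_final)
  next
    show "0 < snd (plan_data \<theta> 0)"
      using total_len_nonneg[of "\<gamma> \<theta>"] by (simp add: plan_data_def add_pos_nonneg)
  qed (simp add: plan_data_def plan_start[OF assms])
qed

lemma plan_data_norm: assumes "\<theta> \<in> {0..M}" shows "norm (plan_data \<theta> s) \<le> of_rat (max 0 s) + 1"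
proof -
  interpret stopped_path "\<gamma> \<theta>" "T \<theta>" by (rule plan_stopped_path[OF assms])
  have "norm (arclen_param (\<gamma> \<theta>) (of_rat (max 0 s)) - arclen_param (\<gamma> \<theta>) 0) \<le> \<bar>of_rat (max 0 s) - 0\<bar>"
    by (rule norm_arclen_param_diff) (simp_all add: zero_le_of_rat_iff)
  then have "norm (fst (plan_data \<theta> s)) \<le> of_rat (max 0 s)"
    using plan_start[OF assms] by (simp add: plan_data_def zero_le_of_rat_iff)
  moreover have "norm (snd (plan_data \<theta> s)) \<le> 1"
    using total_len_nonneg[of "\<gamma> \<theta>"] by (simp add: plan_data_def divide_le_eq)
  ultimately show ?thesis
    using norm_triangle_ineq[of "(fst (plan_data \<theta> s), 0)" "(0, snd (plan_data \<theta> s))"]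
    by (simp add: norm_Pair)
qed

lemma plan_data_endpoint: assumes "\<theta> \<in> {0..M}" shows "endpoint (plan_data \<theta>) = \<gamma> \<theta> (stopping_time \<gamma> \<theta>)"
proof -
  interpret stopped_path "\<gamma> \<theta>" "T \<theta>" by (rule plan_stopped_path[OF assms])
  have pd: "path_data (plan_data \<theta>)" by (rule plan_path_data[OF assms])
  obtain n :: nat where n: "1 < of_rat (of_nat n) * snd (plan_data \<theta> 0)"
    using ex_large_rat[OF path_data_pos[OF pd]] by blast
  moreover have "0 < 1 + total_len (\<gamma> \<theta>)" using total_len_nonneg[of "\<gamma> \<theta>"] by linarith
  ultimately have "total_len (\<gamma> \<theta>) \<le> real n"
    by (simp add: plan_data_def pos_less_divide_eq)
  then have "fst (plan_data \<theta> (of_nat n)) = \<gamma> \<theta> (T \<theta>)"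
    by (simp add: plan_data_def arclen_param_final)
  moreover have "endpoint (plan_data \<theta>) = fst (plan_data \<theta> (of_nat n))"
    by (rule endpoint_eq[OF pd _ n]) simp
  ultimately have "endpoint (plan_data \<theta>) = \<gamma> \<theta> (T \<theta>)" by simp
  then show ?thesis using value_at_stopping_time[of \<gamma> \<theta>] by simp
qed

lemma plan_data_distr: "distr Q borel (\<lambda>\<theta>. endpoint (plan_data \<theta>)) = \<mu>"
proof -
  have "distr Q borel (\<lambda>\<theta>. endpoint (plan_data \<theta>)) = distr Q borel (\<lambda>\<theta>. \<gamma> \<theta> (stopping_time \<gamma> \<theta>))"
    by (rule distr_cong) (auto simp: space_Q plan_data_endpoint)
  also have "\<dots> = \<mu>" using \<gamma> unfolding irrigation_plans_def fibres_def by blast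
  finally show ?thesis .
qed

text \<open>Reparametrization keeps the trace of a path, and rational times are dense in it.\<close>

lemma plan_range_dist: assumes "\<theta> \<in> {0..M}" shows "range_dist (plan_data \<theta>) x = (INF t\<in>{0..}. norm (\<gamma> \<theta> t - x))"
proof -
  interpret stopped_path "\<gamma> \<theta>" "T \<theta>" by (rule plan_stopped_path[OF assms])
  have "range_dist (plan_data \<theta>) x = (INF s\<in>{0..}. norm (arclen_param (\<gamma> \<theta>) (of_rat s) - x))"
    unfolding range_dist_def by (intro INF_cong refl) (simp add: plan_data_def max_def)
  also have "\<dots> = (INF s\<in>{0..}. norm (arclen_param (\<gamma> \<theta>) s - x))"
    by (rule INF_rat_eq_INF_real[OF norm_arclen_param_diff])
  also have "\<dots> = (INF y\<in>arclen_param (\<gamma> \<theta>) ` {0..}. norm (y - x))"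
    by (simp add: image_image)
  also have "\<dots> = (INF t\<in>{0..}. norm (\<gamma> \<theta> t - x))"
    unfolding arclen_param_image by (simp add: image_image)
  finally show ?thesis .
qed

lemma plan_mult: "mult plan_data = mollified_multiplicity J \<epsilon> \<mu> \<gamma>"
proof
  fix x
  show "mult plan_data x = mollified_multiplicity J \<epsilon> \<mu> \<gamma> x"
    unfolding mult_def mollified_multiplicity_def fibres_def
    by (intro Bochner_Integration.integral_cong refl) (simp add: space_Q plan_range_dist)
qed

definition inner_cost :: "real \<Rightarrow> ennreal" where
  "inner_cost \<theta> = (\<integral>\<^sup>+t. ext_powr (mult plan_data (\<gamma> \<theta> t)) (\<alpha> - 1) * ennreal (speed (\<gamma> \<theta>) t) \<partial>lebesgue_on {0..})"

lemma plan_cost: "mollified_cost J \<alpha> \<epsilon> \<mu> \<gamma> = (\<integral>\<^sup>+\<theta>. inner_cost \<theta> \<partial>Q)"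
  unfolding mollified_cost_def inner_cost_def plan_mult speed_def fibres_def ..

text \<open>During one step the path stays within 2^(-N) of its sampled position, so its
  multiplicity exceeds the sampled one by at most K / 2 ^ N. Since \<alpha> - 1 \<le> 0, the weight
  of the corrected sample lies below the true weight.\<close>

lemma plan_riemann_cost_le:
  assumes "\<theta> \<in> {0..M}"
  shows "riemann_cost (mult plan_data) K (\<alpha> - 1) N (plan_data \<theta>) \<le> inner_cost \<theta>"
proof -
  interpret stopped_path "\<gamma> \<theta>" "T \<theta>" by (rule plan_stopped_path[OF assms])
  have "continuous_on {0..} (\<lambda>t. mult plan_data (\<gamma> \<theta> t))"
    by (rule continuous_on_compose2[OF continuous_mult[OF plan_data_measurable, of UNIV] lipschitz_on_continuous_on[OF lip]]) auto
  then have "(\<lambda>t. mult plan_data (\<gamma> \<theta> t)) \<in> borel_measurable (lebesgue_on {0..})"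
    by (rule continuous_imp_measurable_on_sets_lebesgue) auto
  then have cm: "(\<lambda>t. ext_powr (mult plan_data (\<gamma> \<theta> t)) (\<alpha> - 1)) \<in> borel_measurable (lebesgue_on {0..})"
    by (rule measurable_compose[OF _ measurable_ext_powr])
  define C where "C i = (mult plan_data (arclen_param (\<gamma> \<theta>) (real i * (1 / 2 ^ N))) + K / 2 ^ N) powr (\<alpha> - 1)" for i
  have "(\<Sum>i<N * 2 ^ N. ennreal (C i * norm (arclen_param (\<gamma> \<theta>) (real (Suc i) * (1 / 2 ^ N)) - arclen_param (\<gamma> \<theta>) (real i * (1 / 2 ^ N)))))
     \<le> inner_cost \<theta>"
    unfolding inner_cost_def
  proof (rule arclen_param_riemann_sum_le[OF cm])
    fix i t assume t: "0 \<le> t" and close: "norm (\<gamma> \<theta> t - arclen_param (\<gamma> \<theta>) (real i * (1 / 2 ^ N))) \<le> 1 / 2 ^ N"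
    let ?q = "arclen_param (\<gamma> \<theta>) (real i * (1 / 2 ^ N))"
    have "mult plan_data (\<gamma> \<theta> t) - mult plan_data ?q \<le> M * K0 * norm (\<gamma> \<theta> t - ?q)"
      using mult_lipschitz[OF plan_data_measurable, of "\<gamma> \<theta> t" ?q] by linarith
    also have "\<dots> \<le> K * (1 / 2 ^ N)"
      using K K0 m close by (intro mult_mono) auto
    finally have "mult plan_data (\<gamma> \<theta> t) \<le> mult plan_data ?q + K / 2 ^ N" by simp
    then show "ennreal (C i) \<le> ext_powr (mult plan_data (\<gamma> \<theta> t)) (\<alpha> - 1)"
      unfolding C_def using K(1) \<alpha>
      by (intro ext_powr_ge mult_nonneg[OF plan_data_measurable] add_nonneg_pos) auto
  qed (auto simp: C_def)
  also have "(\<Sum>i<N * 2 ^ N. ennreal (C i * norm (arclen_param (\<gamma> \<theta>) (real (Suc i) * (1 / 2 ^ N)) - arclen_param (\<gamma> \<theta>) (real i * (1 / 2 ^ N)))))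
     = riemann_cost (mult plan_data) K (\<alpha> - 1) N (plan_data \<theta>)"
    unfolding riemann_cost_def C_def
  proof (rule sum.cong[OF refl])
    fix i
    have *: "fst (plan_data \<theta> (of_nat j / 2 ^ N)) = arclen_param (\<gamma> \<theta>) (real j * (1 / 2 ^ N))" for j
      by (simp add: plan_data_def max_def of_rat_divide of_rat_power)
    show "ennreal ((mult plan_data (arclen_param (\<gamma> \<theta>) (real i * (1 / 2 ^ N))) + K / 2 ^ N) powr (\<alpha> - 1) *
          norm (arclen_param (\<gamma> \<theta>) (real (Suc i) * (1 / 2 ^ N)) - arclen_param (\<gamma> \<theta>) (real i * (1 / 2 ^ N)))) =
        ennreal ((mult plan_data (fst (plan_data \<theta> (of_nat i / 2 ^ N))) + K / 2 ^ N) powr (\<alpha> - 1) *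
          norm (fst (plan_data \<theta> (of_nat (Suc i) / 2 ^ N)) - fst (plan_data \<theta> (of_nat i / 2 ^ N))))"
      unfolding * ..
  qed
  finally show ?thesis .
qed

lemma plan_riemann_cost_integral_le:
  "(\<integral>\<^sup>+\<theta>. riemann_cost (mult plan_data) K (\<alpha> - 1) N (plan_data \<theta>) \<partial>Q) \<le> mollified_cost J \<alpha> \<epsilon> \<mu> \<gamma>"
  unfolding plan_cost by (intro nn_integral_mono plan_riemann_cost_le) (simp add: space_Q)

lemma plan_total_len_le:
  assumes "\<theta> \<in> {0..M}" shows "ennreal (total_len (\<gamma> \<theta>)) \<le> ennreal (M powr (1 - \<alpha>)) * inner_cost \<theta>"
proof -
  interpret stopped_path "\<gamma> \<theta>" "T \<theta>" by (rule plan_stopped_path[OF assms])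
  have "ennreal (M powr (\<alpha> - 1)) * ennreal (total_len (\<gamma> \<theta>))
      = (\<integral>\<^sup>+t. ennreal (M powr (\<alpha> - 1)) * ennreal (speed (\<gamma> \<theta>) t) \<partial>lebesgue_on {0..})"
    unfolding integral_speed_eq_total_len[symmetric] by (rule nn_integral_cmult[symmetric]) measurable
  also have "\<dots> \<le> inner_cost \<theta>"
    unfolding inner_cost_def using m \<alpha>
    by (intro nn_integral_mono mult_right_mono ext_powr_ge mult_le[OF plan_data_measurable] mult_nonneg[OF plan_data_measurable]) auto
  finally have "ennreal (M powr (1 - \<alpha>)) * (ennreal (M powr (\<alpha> - 1)) * ennreal (total_len (\<gamma> \<theta>)))
      \<le> ennreal (M powr (1 - \<alpha>)) * inner_cost \<theta>"
    by (rule mult_left_mono) simp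
  moreover have "M powr (1 - \<alpha>) * (M powr (\<alpha> - 1) * total_len (\<gamma> \<theta>)) = total_len (\<gamma> \<theta>)"
    using m by (simp add: mult.assoc[symmetric] flip: powr_add)
  ultimately show ?thesis by (simp flip: ennreal_mult)
qed

lemma plan_data_bound:
  "(\<integral>\<^sup>+\<theta>. ennreal (1 / snd (plan_data \<theta> 0)) \<partial>Q) \<le> ennreal M + ennreal (M powr (1 - \<alpha>)) * mollified_cost J \<alpha> \<epsilon> \<mu> \<gamma>"
proof -
  note plan_total_len_measurable[measurable]
  have "(\<integral>\<^sup>+\<theta>. ennreal (1 / snd (plan_data \<theta> 0)) \<partial>Q) = (\<integral>\<^sup>+\<theta>. 1 + ennreal (total_len (\<gamma> \<theta>)) \<partial>Q)"
    by (intro nn_integral_cong) (simp add: plan_data_def flip: ennreal_1 ennreal_plus)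
  also have "\<dots> = (\<integral>\<^sup>+\<theta>. 1 \<partial>Q) + (\<integral>\<^sup>+\<theta>. ennreal (total_len (\<gamma> \<theta>)) \<partial>Q)"
    by (rule nn_integral_add) measurable
  also have "(\<integral>\<^sup>+\<theta>. 1 \<partial>Q) = ennreal M"
    using measure_Q by (simp add: Q.emeasure_eq_measure)
  also have "(\<integral>\<^sup>+\<theta>. ennreal (total_len (\<gamma> \<theta>)) \<partial>Q) \<le> ennreal (M powr (1 - \<alpha>)) * mollified_cost J \<alpha> \<epsilon> \<mu> \<gamma>"
  proof -
    have inv: "ennreal (M powr (\<alpha> - 1)) * ennreal (M powr (1 - \<alpha>)) = 1"
      using m by (simp flip: powr_add ennreal_mult)
    \<comment> \<open>The constant is pulled out of the integral of the measurable length.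
      Monotonicity alone then leads to the cost, which keeps measurability of
      \<open>inner_cost\<close> in \<theta> out of the argument.\<close>
    have "ennreal (M powr (\<alpha> - 1)) * (\<integral>\<^sup>+\<theta>. ennreal (total_len (\<gamma> \<theta>)) \<partial>Q)
        = (\<integral>\<^sup>+\<theta>. ennreal (M powr (\<alpha> - 1)) * ennreal (total_len (\<gamma> \<theta>)) \<partial>Q)"
      by (rule nn_integral_cmult[symmetric]) measurable
    also have "\<dots> \<le> mollified_cost J \<alpha> \<epsilon> \<mu> \<gamma>"
      unfolding plan_cost
    proof (rule nn_integral_mono)
      fix \<theta> assume "\<theta> \<in> space Q"
      then have "ennreal (M powr (\<alpha> - 1)) * ennreal (total_len (\<gamma> \<theta>))
          \<le> ennreal (M powr (\<alpha> - 1)) * (ennreal (M powr (1 - \<alpha>)) * inner_cost \<theta>)"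
        by (intro mult_left_mono plan_total_len_le) (auto simp: space_Q)
      also have "\<dots> = inner_cost \<theta>" by (simp add: mult.assoc[symmetric] inv)
      finally show "ennreal (M powr (\<alpha> - 1)) * ennreal (total_len (\<gamma> \<theta>)) \<le> inner_cost \<theta>" .
    qed
    finally have "ennreal (M powr (1 - \<alpha>)) * (ennreal (M powr (\<alpha> - 1)) * (\<integral>\<^sup>+\<theta>. ennreal (total_len (\<gamma> \<theta>)) \<partial>Q))
        \<le> ennreal (M powr (1 - \<alpha>)) * mollified_cost J \<alpha> \<epsilon> \<mu> \<gamma>"
      by (rule mult_left_mono) simp
    moreover have "ennreal (M powr (1 - \<alpha>)) * (ennreal (M powr (\<alpha> - 1)) * y) = y" for y
      using inv by (simp add: mult.assoc[symmetric] mult.commute[of "ennreal (M powr (1 - \<alpha>))"])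
    ultimately show ?thesis by simp
  qed
  finally show ?thesis by (simp add: add_left_mono)
qed

end

end

section \<open>From path data to plans\<close>

text \<open>The conventions for 0^a are the limits along positive bases: the constant 1 for a = 0
  and blow-up for a < 0. So the correction K / 2 ^ N can be removed in the limit even where the
  multiplicity vanishes.\<close>

lemma tendsto_ext_powr:
  fixes w :: "nat \<Rightarrow> real"
  assumes w: "w \<longlonglongrightarrow> v" and pos: "\<And>n. 0 < w n" and a: "a \<le> 0"
  shows "(\<lambda>n. ennreal (w n powr a)) \<longlonglongrightarrow> ext_powr v a"
proof -
  have v: "0 \<le> v" using LIMSEQ_le_const[OF w, of 0] pos less_imp_le by blast
  consider "v \<noteq> 0" | "v = 0" "a = 0" | "v = 0" "a < 0" using a by linarith
  then show ?thesis
  proof cases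
    case 1
    then show ?thesis
      unfolding ext_powr_def by (auto intro!: tendsto_ennrealI tendsto_powr w)
  next
    case 2
    then have "ennreal (w n powr a) = ext_powr v a" for n
      using pos[of n] by (simp add: ext_powr_def)
    then show ?thesis by simp
  next
    case 3
    have "LIM n sequentially. w n powr a :> at_top"
    proof -
      have "filterlim w (at_right 0) sequentially"
        using w pos less_imp_neq[OF pos] 3 by (auto simp: filterlim_at intro!: always_eventually)
      from filterlim_compose[OF ln_at_0 this]
      have "filterlim (\<lambda>n. - ln (w n)) at_top sequentially"
        by (simp add: filterlim_uminus_at_top)
      from filterlim_tendsto_pos_mult_at_top[OF tendsto_const _ this, of "- a"]
      have "filterlim (\<lambda>n. a * ln (w n)) at_top sequentially" using 3 by simp
      from filterlim_compose[OF exp_at_top this]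
      show ?thesis using less_imp_neq[OF pos] by (simp add: powr_def)
    qed
    then have "(\<lambda>n. ennreal (w n powr a)) \<longlonglongrightarrow> \<infinity>"
      by (simp add: ennreal_tendsto_top_eq_at_top)
    then show ?thesis using 3 by (simp add: ext_powr_def)
  qed
qed

text \<open>The dyadic point below t takes countably many values, so this extension from rational to
  real times stays jointly measurable in the data and t.\<close>

definition data_path :: "(rat \<Rightarrow> 'a::euclidean_space \<times> real) \<Rightarrow> real \<Rightarrow> 'a" where
  "data_path z t = lim (\<lambda>N. fst (z (of_nat (nat \<lfloor>2 ^ N * t\<rfloor>) / 2 ^ N)))"

section \<open>The continuous path determined by path data\<close>

context
  fixes z :: "rat \<Rightarrow> 'a::euclidean_space \<times> real"
  assumes z: "path_data z"
begin

lemma data_path_tendsto: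
  assumes t: "0 \<le> t"
  shows "(\<lambda>N. fst (z (of_nat (nat \<lfloor>2 ^ N * t\<rfloor>) / 2 ^ N))) \<longlonglongrightarrow> data_path z t"
proof -
  define d :: "nat \<Rightarrow> rat" where "d N = of_nat (nat \<lfloor>2 ^ N * t\<rfloor>) / 2 ^ N" for N
  have d0: "0 \<le> d N" for N by (simp add: d_def)
  have "(\<lambda>N. of_rat (d N)) \<longlonglongrightarrow> t"
    using dyadic_floor_tendsto[of t] t by (simp add: d_def of_rat_divide of_rat_power of_nat_nat)
  then have cau: "Cauchy (\<lambda>N. of_rat (d N) :: real)" by (rule LIMSEQ_imp_Cauchy)
  have "Cauchy (\<lambda>N. fst (z (d N)))"
  proof (rule metric_CauchyI)
    fix e :: real assume "0 < e"
    from metric_CauchyD[OF cau this] obtain k where k: "\<And>i j. k \<le> i \<Longrightarrow> k \<le> j \<Longrightarrow> dist (of_rat (d i) :: real) (of_rat (d j)) < e"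
      by blast
    have "dist (fst (z (d i))) (fst (z (d j))) < e" if "k \<le> i" "k \<le> j" for i j
      using path_data_lipschitz[OF z d0 d0, of i j] k[OF that] by (simp add: dist_norm of_rat_abs_diff)
    then show "\<exists>k. \<forall>i\<ge>k. \<forall>j\<ge>k. dist (fst (z (d i))) (fst (z (d j))) < e" by blast
  qed
  then show ?thesis
    unfolding data_path_def d_def by (simp add: Cauchy_convergent_iff convergent_LIMSEQ_iff)
qed

lemma data_path_diff_rat:
  assumes t: "0 \<le> t" and s: "0 \<le> s" shows "norm (data_path z t - fst (z s)) \<le> \<bar>t - of_rat s\<bar>"
proof (rule LIMSEQ_le)
  define d :: "nat \<Rightarrow> rat" where "d N = of_nat (nat \<lfloor>2 ^ N * t\<rfloor>) / 2 ^ N" for N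
  have d0: "0 \<le> d N" for N by (simp add: d_def)
  have "(\<lambda>N. of_rat (d N)) \<longlonglongrightarrow> t"
    using dyadic_floor_tendsto[of t] t by (simp add: d_def of_rat_divide of_rat_power of_nat_nat)
  then show "(\<lambda>N. \<bar>of_rat (d N) - of_rat s\<bar>) \<longlonglongrightarrow> \<bar>t - of_rat s\<bar>" by (intro tendsto_intros)
  show "(\<lambda>N. norm (fst (z (d N)) - fst (z s))) \<longlonglongrightarrow> norm (data_path z t - fst (z s))"
    using data_path_tendsto[OF t] unfolding d_def by (intro tendsto_intros)
  show "\<exists>k. \<forall>N\<ge>k. norm (fst (z (d N)) - fst (z s)) \<le> \<bar>of_rat (d N) - of_rat s\<bar>"
    using path_data_lipschitz[OF z d0 s] by (simp add: of_rat_abs_diff)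
qed

lemma data_path_of_rat: "0 \<le> s \<Longrightarrow> data_path z (of_rat s) = fst (z s)"
  using data_path_diff_rat[of "of_rat s" s] by simp

lemma data_path_lipschitz: assumes "0 \<le> s" "0 \<le> t" shows "norm (data_path z s - data_path z t) \<le> \<bar>s - t\<bar>"
proof -
  have *: "norm (data_path z s - data_path z t) \<le> t - s" if st: "0 \<le> s" "s < t" for s t
  proof -
    obtain r where r: "s < of_rat r" "of_rat r < t" using of_rat_dense[OF st(2)] by auto
    then have "(0::real) < of_rat r" using st by linarith
    then have r0: "0 \<le> r" by simp
    have "norm (data_path z s - data_path z t) \<le> norm (data_path z s - fst (z r)) + norm (data_path z t - fst (z r))"
      using norm_triangle_ineq4[of "data_path z s - fst (z r)" "data_path z t - fst (z r)"] by simp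
    also have "\<dots> \<le> \<bar>s - of_rat r\<bar> + \<bar>t - of_rat r\<bar>"
      using st r0 by (intro add_mono data_path_diff_rat) auto
    also have "\<dots> = t - s" using r by simp
    finally show ?thesis .
  qed
  show ?thesis
    using *[of s t] *[of t s] assms by (cases s t rule: linorder_cases) (auto simp: norm_minus_commute)
qed

lemma data_path_stop: "\<exists>T\<ge>0. \<forall>t\<ge>T. data_path z t = endpoint z"
proof -
  obtain n :: nat where n: "1 < of_rat (of_nat n) * snd (z 0)"
    using ex_large_rat[OF path_data_pos[OF z]] by blast
  have "data_path z t = endpoint z" if t: "real n \<le> t" for t
  proof -
    have t0: "0 \<le> t" using t by linarith
    have "norm (data_path z t - endpoint z) \<le> 0 + e" if e: "0 < e" for e
    proof -
      obtain r where r: "t < of_rat r" "of_rat r < t + e" using of_rat_dense[of t "t + e"] e by auto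
      then have "(0::real) < of_rat r" using t0 by linarith
      then have r0: "0 \<le> r" by simp
      have "real n * snd (z 0) \<le> of_rat r * snd (z 0)"
        using path_data_pos[OF z] r t by (intro mult_right_mono) auto
      then have "1 < of_rat r * snd (z 0)" using n by simp
      then have "endpoint z = fst (z r)" by (rule endpoint_eq[OF z r0])
      then show ?thesis using data_path_diff_rat[OF t0 r0] r by simp
    qed
    then have "norm (data_path z t - endpoint z) \<le> 0" by (rule field_le_epsilon)
    then show ?thesis by simp
  qed
  then show ?thesis by (intro exI[of _ "real n"]) auto
qed

lemma data_path_stopped_path: "\<exists>T. stopped_path (data_path z) T \<and> data_path z T = endpoint z"
proof -
  obtain T where T: "0 \<le> T" "\<And>t. T \<le> t \<Longrightarrow> data_path z t = endpoint z" using data_path_stop by blast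
  have "stopped_path (data_path z) T"
  proof
    show "1-lipschitz_on {0..} (data_path z)"
      by (rule lipschitz_onI) (use data_path_lipschitz in \<open>auto simp: dist_norm dist_real_def\<close>)
    show "data_path z t = data_path z T" if "T \<le> t" for t using T(2)[OF that] T(2)[of T] by simp
  qed (rule T(1))
  with T show ?thesis by blast
qed

lemma range_dist_data_path: "range_dist z x = (INF t\<in>{0..}. norm (data_path z t - x))"
proof -
  have "range_dist z x = (INF s\<in>{0..}. norm (data_path z (of_rat s) - x))"
    unfolding range_dist_def by (intro INF_cong refl) (simp add: data_path_of_rat)
  also have "\<dots> = (INF t\<in>{0..}. norm (data_path z t - x))"
    by (rule INF_rat_eq_INF_real[OF data_path_lipschitz])
  finally show ?thesis .
qed

end

context irrigation
begin

text \<open>Admissibility constrains every fibre, while limits are controlled almost everywhere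
  only; the exceptional fibres rest at the origin.\<close>

definition data_plan :: "(real \<Rightarrow> rat \<Rightarrow> 'a \<times> real) \<Rightarrow> real \<Rightarrow> real \<Rightarrow> 'a" where
  "data_plan Z \<theta> t = (if path_data (Z \<theta>) then data_path (Z \<theta>) t else 0)"

section \<open>Admissibility and cost of the limit plan\<close>

context
  fixes Z :: "real \<Rightarrow> rat \<Rightarrow> 'a \<times> real"
  assumes Z: "Z \<in> measurable Q data_space" and path: "AE \<theta> in Q. path_data (Z \<theta>)"
    and distr: "distr Q borel (\<lambda>\<theta>. endpoint (Z \<theta>)) = \<mu>"
begin

lemma data_plan_good: "path_data (Z \<theta>) \<Longrightarrow> data_plan Z \<theta> = data_path (Z \<theta>)"
  by (rule ext) (simp add: data_plan_def)

lemma data_plan_stopped_path: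
  "\<exists>T. stopped_path (data_plan Z \<theta>) T \<and> data_plan Z \<theta> T = (if path_data (Z \<theta>) then endpoint (Z \<theta>) else 0)"
proof (cases "path_data (Z \<theta>)")
  case True
  then show ?thesis using data_path_stopped_path[OF True] by (simp add: data_plan_good)
next
  case False
  then have "data_plan Z \<theta> = (\<lambda>t. 0)" by (auto simp: data_plan_def)
  moreover have "stopped_path (\<lambda>t. 0 :: 'a) 0" by unfold_locales (auto intro: lipschitz_on_constant lipschitz_on_le)
  ultimately show ?thesis using False by (intro exI[of _ 0]) simp
qed

text \<open>A pointwise limit of functions that depend on t through a dyadic index only; for each
  fixed index they are measurable functions of the data alone.\<close>

lemma data_plan_measurable:
  "(\<lambda>(\<theta>, t). data_plan Z \<theta> t) \<in> borel_measurable (Q \<Otimes>\<^sub>M lebesgue_on {0..})"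
proof (rule borel_measurable_LIMSEQ_metric)
  let ?P = "Q \<Otimes>\<^sub>M lebesgue_on {0..} :: (real \<times> real) measure"
  define f where "f N x = (if path_data (Z (fst x)) then fst (Z (fst x) (of_nat (nat \<lfloor>2 ^ N * snd x\<rfloor>) / 2 ^ N)) else 0)"
    for N :: nat and x :: "real \<times> real"
  show "f N \<in> borel_measurable ?P" for N
    unfolding f_def
  proof (rule measurable_compose_countable[where f="\<lambda>i x. if path_data (Z (fst x)) then fst (Z (fst x) (of_nat i / 2 ^ N)) else 0"
      and g="\<lambda>x. nat \<lfloor>2 ^ N * snd x\<rfloor>"])
    have "(\<lambda>t::real. t) \<in> borel_measurable (lebesgue_on {0..})"
      by (rule borel_measurable_lebesgue_on_of_borel) simp
    from measurable_compose[OF measurable_snd this] have [measurable]: "(\<lambda>x. snd x) \<in> borel_measurable ?P" .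
    show "(\<lambda>x. nat \<lfloor>2 ^ N * snd x\<rfloor>) \<in> measurable ?P (count_space UNIV)" by measurable
    fix i
    have "(\<lambda>z. if path_data z then fst (z (of_nat i / 2 ^ N)) else 0) \<in> borel_measurable (data_space :: (rat \<Rightarrow> 'a \<times> real) measure)"
      by measurable
    from measurable_compose[OF measurable_compose[OF measurable_fst Z] this]
    show "(\<lambda>x. if path_data (Z (fst x)) then fst (Z (fst x) (of_nat i / 2 ^ N)) else 0) \<in> borel_measurable ?P" .
  qed
  fix x assume "x \<in> space ?P"
  then have "0 \<le> snd x" by (auto simp: space_pair_measure space_restrict_space)
  then show "(\<lambda>N. f N x) \<longlonglongrightarrow> (case x of (\<theta>, t) \<Rightarrow> data_plan Z \<theta> t)"
    using data_path_tendsto[of "Z (fst x)" "snd x"] by (simp add: f_def data_plan_def split_beta)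
qed

lemma data_plan_in_irrigation_plans: "data_plan Z \<in> irrigation_plans \<mu>"
  unfolding irrigation_plans_def fibres_def
proof (intro CollectI conjI ballI)
  show "(\<lambda>(\<theta>, t). data_plan Z \<theta> t) \<in> borel_measurable (Q \<Otimes>\<^sub>M lebesgue_on {0..})"
    by (rule data_plan_measurable)
  fix \<theta>
  obtain T where "stopped_path (data_plan Z \<theta>) T" using data_plan_stopped_path by blast
  then interpret stopped_path "data_plan Z \<theta>" T .
  show "1-lipschitz_on {0..} (data_plan Z \<theta>)" by (rule lip)
  show "\<exists>t\<ge>0. \<forall>t'\<ge>t. data_plan Z \<theta> t' = data_plan Z \<theta> t" using T const by blast
next
  fix \<theta>
  show "data_plan Z \<theta> 0 = 0"
    using data_path_of_rat[of "Z \<theta>" 0] path_data_0[of "Z \<theta>"] by (simp add: data_plan_def)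
next
  have stop: "data_plan Z \<theta> (stopping_time (data_plan Z) \<theta>) = (if path_data (Z \<theta>) then endpoint (Z \<theta>) else 0)" for \<theta>
    using data_plan_stopped_path[of \<theta>] stopped_path.value_at_stopping_time[of "data_plan Z \<theta>" _ "data_plan Z" \<theta>] by auto
  have m1: "(\<lambda>\<theta>. if path_data (Z \<theta>) then endpoint (Z \<theta>) else 0) \<in> borel_measurable Q"
  proof -
    have "(\<lambda>z. if path_data z then endpoint z else 0) \<in> borel_measurable (data_space :: (rat \<Rightarrow> 'a \<times> real) measure)"
      by measurable
    from measurable_compose[OF Z this] show ?thesis .
  qed
  have "distr Q borel (\<lambda>\<theta>. data_plan Z \<theta> (stopping_time (data_plan Z) \<theta>)) = distr Q borel (\<lambda>\<theta>. endpoint (Z \<theta>))"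
    unfolding stop
  proof (rule distr_cong_AE)
    show "AE \<theta> in Q. (if path_data (Z \<theta>) then endpoint (Z \<theta>) else 0) = endpoint (Z \<theta>)"
      using path by eventually_elim simp
    show "(\<lambda>\<theta>. endpoint (Z \<theta>)) \<in> borel_measurable Q" using measurable_compose[OF Z measurable_endpoint] .
  qed (use m1 in simp_all)
  then show "distr Q borel (\<lambda>\<theta>. data_plan Z \<theta> (stopping_time (data_plan Z) \<theta>)) = \<mu>" using distr by simp
qed

text \<open>Length may be lost in the limit, so Z need not be the arc-length data of its own plan.
  Both have the same traces on almost every fibre, and that determines the multiplicity.\<close>

lemma data_plan_mult: "mult (plan_data (data_plan Z)) = mult Z"
proof
  fix x
  note ip = data_plan_in_irrigation_plans
  show "mult (plan_data (data_plan Z)) x = mult Z x"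
    unfolding mult_def
  proof (rule integral_cong_AE)
    show "(\<lambda>\<theta>. J (range_dist (plan_data (data_plan Z) \<theta>) x / \<epsilon>)) \<in> borel_measurable Q"
      using integrable_g[OF plan_data_measurable[OF ip]] by auto
    show "(\<lambda>\<theta>. J (range_dist (Z \<theta>) x / \<epsilon>)) \<in> borel_measurable Q"
      using integrable_g[OF Z] by auto
    have "AE \<theta> in Q. \<theta> \<in> {0..M}" using AE_space[of Q] by (simp add: space_Q)
    with path show "AE \<theta> in Q. J (range_dist (plan_data (data_plan Z) \<theta>) x / \<epsilon>) = J (range_dist (Z \<theta>) x / \<epsilon>)"
      by eventually_elim (simp add: plan_range_dist[OF ip] range_dist_data_path data_plan_good)
  qed
qed

text \<open>The Riemann sums of Z sample the limit path at dyadic times, whatever its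
  parametrization, so \<open>weighted_length_le_liminf\<close> applies to it directly; the corrected
  weights converge by \<open>tendsto_ext_powr\<close>.\<close>

lemma data_plan_inner_cost_le:
  assumes good: "path_data (Z \<theta>)"
  shows "inner_cost (data_plan Z) \<theta> \<le> liminf (\<lambda>N. riemann_cost (mult Z) K (\<alpha> - 1) N (Z \<theta>))"
proof -
  obtain T where "stopped_path (data_plan Z \<theta>) T" using data_plan_stopped_path by blast
  then interpret stopped_path "data_plan Z \<theta>" T .
  define C where "C N s = (mult Z (data_plan Z \<theta> s) + K / 2 ^ N) powr (\<alpha> - 1)" for N :: nat and s
  have "inner_cost (data_plan Z) \<theta> \<le> liminf (\<lambda>N. \<Sum>i<N * 2 ^ N. ennreal (C N (real i / 2 ^ N) *
      norm (data_plan Z \<theta> (real (Suc i) / 2 ^ N) - data_plan Z \<theta> (real i / 2 ^ N))))"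
    unfolding inner_cost_def[OF data_plan_in_irrigation_plans] data_plan_mult
  proof (rule weighted_length_le_liminf[OF lip])
    show "AE t in lebesgue_on {0..}. (\<lambda>N. ennreal (C N (real (nat \<lfloor>2 ^ N * t\<rfloor>) / 2 ^ N))) \<longlonglongrightarrow> ext_powr (mult Z (data_plan Z \<theta> t)) (\<alpha> - 1)"
    proof (rule AE_lebesgue_on_negligible[of "{}"])
      fix t :: real assume "t \<in> {0..}"
      then have t: "0 \<le> t" by simp
      have "(\<lambda>N. real (nat \<lfloor>2 ^ N * t\<rfloor>) / 2 ^ N) \<longlonglongrightarrow> t"
        using dyadic_floor_tendsto[of t] t by (simp add: of_nat_nat)
      then have "(\<lambda>N. data_plan Z \<theta> (real (nat \<lfloor>2 ^ N * t\<rfloor>) / 2 ^ N)) \<longlonglongrightarrow> data_plan Z \<theta> t"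
        by (rule continuous_on_tendsto_compose[OF lipschitz_on_continuous_on[OF lip]]) (use t in auto)
      then have "(\<lambda>N. mult Z (data_plan Z \<theta> (real (nat \<lfloor>2 ^ N * t\<rfloor>) / 2 ^ N))) \<longlonglongrightarrow> mult Z (data_plan Z \<theta> t)"
        by (rule continuous_on_tendsto_compose[OF continuous_mult[OF Z, of UNIV]]) auto
      moreover have "(\<lambda>N. K * (1 / 2) ^ N) \<longlonglongrightarrow> K * 0"
        by (intro tendsto_intros LIMSEQ_power_zero) simp
      ultimately have "(\<lambda>N. mult Z (data_plan Z \<theta> (real (nat \<lfloor>2 ^ N * t\<rfloor>) / 2 ^ N)) + K * (1 / 2) ^ N) \<longlonglongrightarrow> mult Z (data_plan Z \<theta> t) + K * 0"
        by (rule tendsto_add)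
      then have "(\<lambda>N. mult Z (data_plan Z \<theta> (real (nat \<lfloor>2 ^ N * t\<rfloor>) / 2 ^ N)) + K / 2 ^ N) \<longlonglongrightarrow> mult Z (data_plan Z \<theta> t)"
        by (simp add: power_one_over)
      then show "(\<lambda>N. ennreal (C N (real (nat \<lfloor>2 ^ N * t\<rfloor>) / 2 ^ N))) \<longlonglongrightarrow> ext_powr (mult Z (data_plan Z \<theta> t)) (\<alpha> - 1)"
        unfolding C_def
      proof (rule tendsto_ext_powr)
        show "0 < mult Z (data_plan Z \<theta> (real (nat \<lfloor>2 ^ N * t\<rfloor>) / 2 ^ N)) + K / 2 ^ N" for N
          using K(1) by (intro add_nonneg_pos mult_nonneg[OF Z]) simp
      qed (use \<alpha> in simp)
    qed auto
  qed (simp add: C_def)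
  also have "(\<lambda>N. \<Sum>i<N * 2 ^ N. ennreal (C N (real i / 2 ^ N) *
      norm (data_plan Z \<theta> (real (Suc i) / 2 ^ N) - data_plan Z \<theta> (real i / 2 ^ N))))
     = (\<lambda>N. riemann_cost (mult Z) K (\<alpha> - 1) N (Z \<theta>))"
  proof
    fix N
    have *: "data_plan Z \<theta> (real i / 2 ^ N) = fst (Z \<theta> (of_nat i / 2 ^ N))" for i
      using data_path_of_rat[OF good, of "of_nat i / 2 ^ N"]
      by (simp add: data_plan_good[OF good] of_rat_divide of_rat_power)
    show "(\<Sum>i<N * 2 ^ N. ennreal (C N (real i / 2 ^ N) *
      norm (data_plan Z \<theta> (real (Suc i) / 2 ^ N) - data_plan Z \<theta> (real i / 2 ^ N)))) = riemann_cost (mult Z) K (\<alpha> - 1) N (Z \<theta>)"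
      unfolding riemann_cost_def C_def * ..
  qed
  finally show ?thesis .
qed

lemma data_plan_cost_le:
  "mollified_cost J \<alpha> \<epsilon> \<mu> (data_plan Z) \<le> liminf (\<lambda>N. \<integral>\<^sup>+\<theta>. riemann_cost (mult Z) K (\<alpha> - 1) N (Z \<theta>) \<partial>Q)"
proof -
  have "mollified_cost J \<alpha> \<epsilon> \<mu> (data_plan Z) \<le> (\<integral>\<^sup>+\<theta>. liminf (\<lambda>N. riemann_cost (mult Z) K (\<alpha> - 1) N (Z \<theta>)) \<partial>Q)"
    unfolding plan_cost[OF data_plan_in_irrigation_plans]
    by (rule nn_integral_mono_AE, use path in eventually_elim) (rule data_plan_inner_cost_le)
  also have "\<dots> \<le> liminf (\<lambda>N. \<integral>\<^sup>+\<theta>. riemann_cost (mult Z) K (\<alpha> - 1) N (Z \<theta>) \<partial>Q)"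
    by (rule nn_integral_liminf) (rule measurable_compose[OF Z measurable_riemann_cost[OF measurable_mult[OF Z]]])
  finally show ?thesis .
qed

end

section \<open>The direct method\<close>

lemma minimizer_exists:
  assumes ne: "irrigation_plans \<mu> \<noteq> {}"
  shows "\<exists>\<gamma>\<in>irrigation_plans \<mu>. \<forall>\<gamma>'\<in>irrigation_plans \<mu>. mollified_cost J \<alpha> \<epsilon> \<mu> \<gamma> \<le> mollified_cost J \<alpha> \<epsilon> \<mu> \<gamma>'"
proof (cases "(INF \<gamma>\<in>irrigation_plans \<mu>. mollified_cost J \<alpha> \<epsilon> \<mu> \<gamma>) = \<infinity>")
  case True
  then have "mollified_cost J \<alpha> \<epsilon> \<mu> \<gamma>' = \<infinity>" if "\<gamma>' \<in> irrigation_plans \<mu>" for \<gamma>'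
    using INF_lower[OF that, of "mollified_cost J \<alpha> \<epsilon> \<mu>"] by (simp add: top_unique)
  then show ?thesis using ne by (metis all_not_in_conv order_refl)
next
  case False
  define c where "c = (INF \<gamma>\<in>irrigation_plans \<mu>. mollified_cost J \<alpha> \<epsilon> \<mu> \<gamma>)"
  have "c \<noteq> top" using False by (simp only: c_def infinity_ennreal_def not_False_eq_True)
  then have c_fin: "c < \<infinity>" by (simp add: less_top)
  have "\<exists>\<gamma>\<in>irrigation_plans \<mu>. mollified_cost J \<alpha> \<epsilon> \<mu> \<gamma> < c + ennreal (1 / real (Suc n))" for n
  proof -
    have "0 < ennreal (1 / real (Suc n))" by simp
    then have "c < c + ennreal (1 / real (Suc n))"
      using c_fin by (cases c) (auto simp: ennreal_less_iff simp flip: ennreal_plus)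
    then show ?thesis using INF_less_iff[of "mollified_cost J \<alpha> \<epsilon> \<mu>"] by (simp only: c_def)
  qed
  then obtain \<gamma> where \<gamma>: "\<And>n. \<gamma> n \<in> irrigation_plans \<mu>"
    and \<gamma>_cost: "\<And>n. mollified_cost J \<alpha> \<epsilon> \<mu> (\<gamma> n) < c + ennreal (1 / real (Suc n))"
    by metis
  \<comment> \<open>The minimizing sequence exceeds the infimum by less than 1 / Suc n \<le> 1, so
    all its costs are at most c + 1.\<close>
  define B where "B = ennreal M + ennreal (M powr (1 - \<alpha>)) * (c + 1)"
  have bound: "(\<integral>\<^sup>+\<theta>. ennreal (1 / snd (plan_data (\<gamma> n) \<theta> 0)) \<partial>Q) \<le> B" for n
  proof -
    have "ennreal (1 / real (Suc n)) \<le> ennreal 1" by (intro ennreal_leI) simp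
    then have "c + ennreal (1 / real (Suc n)) \<le> c + 1" by (intro add_left_mono) simp
    then have "mollified_cost J \<alpha> \<epsilon> \<mu> (\<gamma> n) \<le> c + 1"
      using less_imp_le[OF \<gamma>_cost[of n]] by (rule order_trans[rotated])
    then have "ennreal M + ennreal (M powr (1 - \<alpha>)) * mollified_cost J \<alpha> \<epsilon> \<mu> (\<gamma> n) \<le> B"
      unfolding B_def by (intro add_left_mono mult_left_mono) simp_all
    with plan_data_bound[OF \<gamma>[of n]] show ?thesis by (rule order_trans)
  qed
  have B_fin: "B < \<infinity>" using c_fin by (simp add: B_def ennreal_mult_less_top)
  show ?thesis
  proof (rule path_compactness[where X="\<lambda>n. plan_data (\<gamma> n)" and a="\<alpha> - 1" and K=K and B=B and \<mu>=\<mu>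
        and R="\<lambda>s. of_rat (max 0 s) + 1"])
    fix r Z
    assume r: "strict_mono (r :: nat \<Rightarrow> nat)" and Z: "Z \<in> measurable Q data_space"
      and path: "AE \<theta> in Q. path_data (Z \<theta>)" and distr: "distr Q borel (\<lambda>\<theta>. endpoint (Z \<theta>)) = \<mu>"
      and lsc: "\<And>N. (\<integral>\<^sup>+\<theta>. riemann_cost (mult Z) K (\<alpha> - 1) N (Z \<theta>) \<partial>Q)
       \<le> liminf (\<lambda>n. \<integral>\<^sup>+\<theta>. riemann_cost (mult (plan_data (\<gamma> (r n)))) K (\<alpha> - 1) N (plan_data (\<gamma> (r n)) \<theta>) \<partial>Q)"
    \<comment> \<open>The mesh is fixed while n tends to infinity; it is refined only afterwards, in
      \<open>data_plan_cost_le\<close>.\<close>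
    have riemann_le: "(\<integral>\<^sup>+\<theta>. riemann_cost (mult Z) K (\<alpha> - 1) N (Z \<theta>) \<partial>Q) \<le> c" for N
    proof -
      have "(\<integral>\<^sup>+\<theta>. riemann_cost (mult Z) K (\<alpha> - 1) N (Z \<theta>) \<partial>Q)
         \<le> liminf (\<lambda>n. c + ennreal (1 / real (Suc (r n))))"
        by (rule order_trans[OF lsc], rule Liminf_mono, rule always_eventually, rule allI,
            rule order_trans[OF plan_riemann_cost_integral_le[OF \<gamma>] less_imp_le[OF \<gamma>_cost]])
      also have "\<dots> = c + ennreal 0"
      proof (rule lim_imp_Liminf)
        have "(\<lambda>n. 1 / real (Suc (r n))) \<longlonglongrightarrow> 0"
          using LIMSEQ_subseq_LIMSEQ[OF LIMSEQ_inverse_real_of_nat r] by (simp add: comp_def inverse_eq_divide)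
        then show "(\<lambda>n. c + ennreal (1 / real (Suc (r n)))) \<longlonglongrightarrow> c + ennreal 0"
          by (intro tendsto_add tendsto_const tendsto_ennrealI)
      qed simp
      finally show ?thesis by simp
    qed
    have "mollified_cost J \<alpha> \<epsilon> \<mu> (data_plan Z) \<le> c"
    proof (rule order_trans[OF data_plan_cost_le[OF Z path distr]])
      have "liminf (\<lambda>N. \<integral>\<^sup>+\<theta>. riemann_cost (mult Z) K (\<alpha> - 1) N (Z \<theta>) \<partial>Q) \<le> liminf (\<lambda>N. c)"
        by (rule Liminf_mono) (simp add: riemann_le)
      then show "liminf (\<lambda>N. \<integral>\<^sup>+\<theta>. riemann_cost (mult Z) K (\<alpha> - 1) N (Z \<theta>) \<partial>Q) \<le> c"
        by (simp add: Liminf_const)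
    qed
    moreover have "c \<le> mollified_cost J \<alpha> \<epsilon> \<mu> \<gamma>'" if "\<gamma>' \<in> irrigation_plans \<mu>" for \<gamma>'
      unfolding c_def by (rule INF_lower[OF that])
    ultimately show ?thesis
      using data_plan_in_irrigation_plans[OF Z path distr] by (intro bexI[of _ "data_plan Z"] ballI) (auto intro: order_trans)
  qed (fact plan_data_measurable[OF \<gamma>] plan_path_data[OF \<gamma>] plan_data_norm[OF \<gamma>] bound B_fin
      plan_data_distr[OF \<gamma>] K(1))+
qed

end

theorem theorem3p3:
  fixes \<mu> :: "'a::euclidean_space measure"
    and J :: "real \<Rightarrow> real" and \<alpha> \<epsilon> :: real
  assumes "radon_measure \<mu>"
    and "bounded (measure_support \<mu>)"
    and "mollifier J"
    and "0 \<le> \<alpha>" and "\<alpha> \<le> 1"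
    and "\<epsilon> > 0"
    and "irrigation_plans \<mu> \<noteq> {}"
  shows "\<exists>\<gamma>\<in>irrigation_plans \<mu>. \<forall>\<gamma>'\<in>irrigation_plans \<mu>.
           mollified_cost J \<alpha> \<epsilon> \<mu> \<gamma> \<le> mollified_cost J \<alpha> \<epsilon> \<mu> \<gamma>'"
proof (cases "measure \<mu> UNIV = 0")
  case True
  \<comment> \<open>The fibre interval is a single point, so every cost vanishes and any plan is a
    minimizer. This case is separate because the compactness argument divides by the mass.\<close>
  have "mollified_cost J \<alpha> \<epsilon> \<mu> \<gamma> = 0" for \<gamma>
  proof -
    have ae: "AE \<theta> in lebesgue_on {0..0::real}. f \<theta> = 0" for f :: "real \<Rightarrow> ennreal"
      by (rule AE_lebesgue_on_negligible[of "{0}"]) auto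
    have "(\<integral>\<^sup>+\<theta>. f \<theta> \<partial>lebesgue_on {0..0::real}) = 0" for f
      using nn_integral_cong_AE[OF ae[of f]] by simp
    then show ?thesis unfolding mollified_cost_def fibres_def True .
  qed
  then show ?thesis using assms(7) by auto
next
  case False
  then have pos: "0 < measure \<mu> UNIV" using measure_nonneg[of \<mu> UNIV] by linarith
  note mol = assms(3)[unfolded mollifier_def]
  obtain L where L: "L-lipschitz_on {0..} J" using mol by blast
  have J: "J 0 = 1" "\<And>r. 0 \<le> r \<Longrightarrow> 0 \<le> J r" "antimono_on {0..} J" using mol by blast+
  show ?thesis
  proof (rule irrigation.minimizer_exists)
    \<comment> \<open>Rescaling the argument by \<epsilon> divides the Lipschitz constant by
      \<epsilon>; the bound by 1 comes from J 0 = 1 and monotonicity.\<close>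
    show "irrigation J \<epsilon> (L / \<epsilon>) \<mu> \<alpha>"
    proof
      fix d d' :: real assume d: "0 \<le> d" "0 \<le> d'"
      show "0 \<le> J (d / \<epsilon>)" using d \<open>\<epsilon> > 0\<close> by (intro J(2)) simp
      show "J (d / \<epsilon>) \<le> 1"
        using monotone_onD[OF J(3), of 0 "d / \<epsilon>"] d \<open>\<epsilon> > 0\<close> J(1) by simp
      have "\<bar>J (d / \<epsilon>) - J (d' / \<epsilon>)\<bar> \<le> L * \<bar>d / \<epsilon> - d' / \<epsilon>\<bar>"
        using lipschitz_onD[OF L, of "d / \<epsilon>" "d' / \<epsilon>"] d \<open>\<epsilon> > 0\<close> by (simp add: dist_real_def)
      also have "\<dots> = L / \<epsilon> * \<bar>d - d'\<bar>"
        using \<open>\<epsilon> > 0\<close> by (simp flip: diff_divide_distrib)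
      finally show "\<bar>J (d / \<epsilon>) - J (d' / \<epsilon>)\<bar> \<le> L / \<epsilon> * \<bar>d - d'\<bar>" .
    qed (use lipschitz_on_nonneg[OF L] \<open>\<epsilon> > 0\<close> pos \<open>\<alpha> \<le> 1\<close> in simp_all)
    show "irrigation_plans \<mu> \<noteq> {}" by fact
  qed
qed

end
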